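(* Let $\Delta,\Delta'\subset\mathbb{R}^2$ be two-dimensional lattice polygons with $$\sharp(\Delta\cap\mathbb{Z}^2)-1=\sharp(\Delta'\cap\mathbb{Z}^2)-1=N,$$ and suppose that $\mathrm{Tor}(\Delta),\mathrm{Tor}(\Delta')\subset\mathbb{P}^N$ can be obtained from one another using a projective transformation of $\mathbb{P}^N$. Then $\Delta\cong\Delta'$.
   Context: Throughout, $k$ is an algebraically closed field of characteristic $0$, $\mathbb{T}^2=(k^\ast)^2$, and $\mathbb{P}^N$ is projective space over $k$. A lattice polygon is the convex hull in $\mathbb{R}^2$ of finitely many points of $\mathbb{Z}^2$. For a two-dimensional lattice polygon $\Delta$, $\mathrm{Tor}(\Delta)$ is the Zariski closure of the image of $$\varphi_\Delta:\mathbb{T}^2\hookrightarrow\mathbb{P}^{\sharp(\Delta\cap\mathbb{Z}^2)-1}:(\alpha,\beta)\mapsto(\alpha^i\beta^j)_{(i,j)\in\Delta\cap\mathbb{Z}^2}$$ (for some ordering of the lattice points of $\Delta$). The notation $\Delta\cong\Delta'$ means unimodular equivalence: there exist $A\in\mathrm{GL}_2(\mathbb{Z})$ and $b\in\mathbb{Z}^2$ such that the affine map $x\mapsto Ax+b$ takes $\Delta$ onto $\Delta'$. *)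

theory Defs
  imports "HOL-Analysis.Analysis" "HOL-Library.Poly_Mapping"
    "HOL-Computational_Algebra.Polynomial"
begin

section \<open>Lattice polygons\<close>

definition real_vec :: "int^'n \<Rightarrow> real^'n" where
  "real_vec m = (\<chi> i. real_of_int (m $ i))"

definition lattice_points :: "(real^2) set \<Rightarrow> (int^2) set" where
  "lattice_points \<Delta> = {m. real_vec m \<in> \<Delta>}"

definition lattice_polygon :: "(real^2) set \<Rightarrow> bool" where
  "lattice_polygon \<Delta> \<longleftrightarrow> (\<exists>S :: (int^2) set. finite S \<and> \<Delta> = convex hull (real_vec ` S))"

text \<open>Over \<^typ>\<open>int\<close>, \<^const>\<open>invertible\<close> means having an integral inverse, so the matrices
  \<open>A\<close> below are exactly the elements of \<open>GL\<^sub>2(\<int>)\<close>.\<close>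

definition unimodularly_equivalent :: "(real^2) set \<Rightarrow> (real^2) set \<Rightarrow> bool" where
  "unimodularly_equivalent \<Delta> \<Delta>' \<longleftrightarrow>
     (\<exists>(A :: int^2^2) (b :: int^2). invertible A \<and>
        (\<lambda>x. map_matrix real_of_int A *v x + real_vec b) ` \<Delta> = \<Delta>')"


section \<open>Projective space\<close>

text \<open>Projective space has homogeneous coordinates indexed by a finite type \<open>'n\<close>; it has
  dimension \<open>N\<close> when \<open>CARD('n) = N + 1\<close>.\<close>

definition proj_rel :: "'k::field^'n \<Rightarrow> 'k^'n \<Rightarrow> bool" where
  "proj_rel v w \<longleftrightarrow> v \<noteq> 0 \<and> w \<noteq> 0 \<and> (\<exists>c. c \<noteq> 0 \<and> w = c *s v)"

lemma part_equivp_proj_rel: "part_equivp (proj_rel :: 'k::field^'n \<Rightarrow> _)"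
proof (rule part_equivpI)
  have "proj_rel (1 :: 'k^'n) 1"
    unfolding proj_rel_def by (auto intro: exI[of _ 1])
  then show "\<exists>x :: 'k^'n. proj_rel x x" ..
next
  show "symp (proj_rel :: 'k^'n \<Rightarrow> _)"
  proof (rule sympI)
    fix v w :: "'k^'n"
    assume "proj_rel v w"
    then obtain c where "v \<noteq> 0" "w \<noteq> 0" "c \<noteq> 0" "w = c *s v"
      unfolding proj_rel_def by blast
    then show "proj_rel w v"
      unfolding proj_rel_def by (auto intro!: exI[of _ "inverse c"])
  qed
next
  show "transp (proj_rel :: 'k^'n \<Rightarrow> _)"
  proof (rule transpI)
    fix u v w :: "'k^'n"
    assume "proj_rel u v" "proj_rel v w"
    then obtain c d where "u \<noteq> 0" "w \<noteq> 0" "c \<noteq> 0" "v = c *s u" "d \<noteq> 0" "w = d *s v"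
      unfolding proj_rel_def by blast
    then show "proj_rel u w"
      unfolding proj_rel_def by (auto intro!: exI[of _ "d * c"])
  qed
qed

quotient_type (overloaded) ('k, 'n) proj_space = "'k::field^'n::finite" / partial: proj_rel
  by (rule part_equivp_proj_rel)

text \<open>The point with homogeneous coordinates \<open>v\<close>; meaningful only for \<open>v \<noteq> 0\<close>.\<close>

abbreviation proj_class :: "'k::field^'n \<Rightarrow> ('k, 'n::finite) proj_space" where
  "proj_class \<equiv> abs_proj_space"

lemma proj_class_eq_iff:
  assumes "v \<noteq> 0" "w \<noteq> 0"
  shows "proj_class v = proj_class w \<longleftrightarrow> (\<exists>c. c \<noteq> 0 \<and> w = c *s v)"
proof -
  have refl: "proj_rel u u" if "u \<noteq> 0" for u :: "'a^'b"
    using that unfolding proj_rel_def by (auto intro: exI[of _ 1])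
  have "proj_class v = proj_class w \<longleftrightarrow> proj_rel v w"
    using Quotient3_rel[OF Quotient3_proj_space, of v w] refl assms by blast
  then show ?thesis
    using assms by (simp add: proj_rel_def)
qed


section \<open>The Zariski topology on projective space\<close>

text \<open>A polynomial in the variables \<open>'n\<close> is a finitely supported map from exponent vectors
  to coefficients.\<close>

type_synonym ('k, 'n) mpoly = "('n \<Rightarrow>\<^sub>0 nat) \<Rightarrow>\<^sub>0 'k"

definition eval_mpoly :: "('k::comm_ring_1, 'n::finite) mpoly \<Rightarrow> 'k^'n \<Rightarrow> 'k" where
  "eval_mpoly p v =
     (\<Sum>m\<in>Poly_Mapping.keys p. poly_mapping.lookup p m * (\<Prod>i\<in>UNIV. (v $ i) ^ poly_mapping.lookup m i))"

definition homogeneous :: "nat \<Rightarrow> ('k::zero, 'n::finite) mpoly \<Rightarrow> bool" where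
  "homogeneous d p \<longleftrightarrow> (\<forall>m\<in>Poly_Mapping.keys p. (\<Sum>i\<in>UNIV. poly_mapping.lookup m i) = d)"

lemma eval_mpoly_scale:
  assumes "homogeneous d p"
  shows "eval_mpoly p (c *s v) = c ^ d * eval_mpoly p v"
proof -
  have "poly_mapping.lookup p m * (\<Prod>i\<in>UNIV. ((c *s v) $ i) ^ poly_mapping.lookup m i)
      = c ^ d * (poly_mapping.lookup p m * (\<Prod>i\<in>UNIV. (v $ i) ^ poly_mapping.lookup m i))"
    if "m \<in> Poly_Mapping.keys p" for m
  proof -
    have "c ^ d = (\<Prod>i\<in>UNIV. c ^ poly_mapping.lookup m i)"
      using assms that unfolding homogeneous_def by (metis power_sum)
    then show ?thesis
      by (simp add: power_mult_distrib prod.distrib mult_ac)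
  qed
  then show ?thesis
    unfolding eval_mpoly_def by (simp add: sum_distrib_left)
qed

definition proj_zeros :: "('k::field, 'n::finite) mpoly set \<Rightarrow> ('k, 'n) proj_space set" where
  "proj_zeros F = proj_class ` {v. v \<noteq> 0 \<and> (\<forall>p\<in>F. eval_mpoly p v = 0)}"

definition zariski_closed :: "('k::field, 'n::finite) proj_space set \<Rightarrow> bool" where
  "zariski_closed Z \<longleftrightarrow> (\<exists>F. (\<forall>p\<in>F. \<exists>d. homogeneous d p) \<and> Z = proj_zeros F)"

definition zariski_closure ::
    "('k::field, 'n::finite) proj_space set \<Rightarrow> ('k, 'n) proj_space set" where
  "zariski_closure S = zariski_closed hull S"

definition projective_transformation ::
    "(('k::field, 'n::finite) proj_space \<Rightarrow> ('k, 'n) proj_space) \<Rightarrow> bool" where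
  "projective_transformation g \<longleftrightarrow>
     (\<exists>M :: 'k^'n^'n. invertible M \<and> (\<forall>v. v \<noteq> 0 \<longrightarrow> g (proj_class v) = proj_class (M *v v)))"


section \<open>Toric surfaces\<close>

text \<open>An ordering of the lattice points of \<open>\<Delta>\<close> assigns them bijectively to the homogeneous
  coordinates.\<close>

definition lattice_point_ordering :: "(real^2) set \<Rightarrow> ('n \<Rightarrow> int^2) \<Rightarrow> bool" where
  "lattice_point_ordering \<Delta> e \<longleftrightarrow> bij_betw e UNIV (lattice_points \<Delta>)"

definition torus :: "('k::field \<times> 'k) set" where
  "torus = {(\<alpha>, \<beta>). \<alpha> \<noteq> 0 \<and> \<beta> \<noteq> 0}"

definition toric_map :: "('n::finite \<Rightarrow> int^2) \<Rightarrow> 'k::field \<times> 'k \<Rightarrow> ('k, 'n) proj_space" where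
  "toric_map e = (\<lambda>(\<alpha>, \<beta>). proj_class (\<chi> n. \<alpha> powi (e n $ 1) * \<beta> powi (e n $ 2)))"

text \<open>\<open>Tor e\<close> is the toric surface of \<open>\<Delta>\<close> when \<open>e\<close> is an ordering of the lattice points
  of \<open>\<Delta>\<close>.\<close>

definition Tor :: "('n::finite \<Rightarrow> int^2) \<Rightarrow> ('k::field, 'n) proj_space set" where
  "Tor e = zariski_closure (toric_map e ` torus)"

end

theory Submission
  imports Defs
begin

text \<open>Write \<open>S\<close> and \<open>S'\<close> for the sets of lattice points of the two polygons, and let the matrix \<open>M\<close> carry
the affine cone over \<open>Tor \<Delta>\<close> to the affine cone over \<open>Tor \<Delta>'\<close>. The rows of \<open>M\<close> are the coefficient
vectors of Laurent polynomials \<open>f\<^sub>m\<close> (\<open>m \<in> S'\<close>) that form a basis of the span of the monomials \<open>x\<^sup>s\<close>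
with \<open>s \<in> S\<close>. The usual explanation of the theorem is that the torus of \<open>Tor \<Delta>'\<close>, transported by \<open>M\<close>,
and the torus of \<open>Tor \<Delta>\<close> are maximal tori of the automorphism group of the same projective surface, and
hence conjugate. The proof below replaces conjugacy of maximal tori by a computation of eigenvalues.

\<^bold>\<open>Infinitesimal automorphisms.\<close> Let \<open>L\<close> be an integral affine function that is nonnegative on \<open>S'\<close>.
The matrices \<open>M\<^sup>-\<^sup>1 diag(t\<^sup>L\<^sup>(\<^sup>m\<^sup>)) M\<close> preserve the cone over \<open>Tor \<Delta>\<close>, so they respect the binomial equations
that come from the affine relations in \<open>S\<close>. Differentiation at \<open>t = 1\<close> shows that
\<open>A = M\<^sup>-\<^sup>1 diag(L(m)) M\<close> acts by \<open>x\<^sup>s \<mapsto> \<Sum>\<^sub>\<alpha> \<Lambda>\<^sub>\<alpha>(s) x\<^sup>s\<^sup>+\<^sup>\<alpha>\<close> with coefficients \<open>\<Lambda>\<^sub>\<alpha>\<close> that are affine functions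
of \<open>s\<close> (\<open>toric_derivation_of_binomials\<close>). Its eigenvalues are the numbers \<open>L(m)\<close>, with
eigenvectors \<open>f\<^sub>m\<close>. Call \<open>\<alpha> \<noteq> 0\<close> a root if \<open>\<Lambda>\<^sub>\<alpha>\<close> does not vanish on \<open>S\<close>. Since \<open>\<Lambda>\<^sub>\<alpha>(s) = 0\<close> whenever
\<open>s + \<alpha> \<notin> S\<close>, the points of \<open>S\<close> that a root pushes out of \<open>S\<close> lie on one line, a strong restriction on the
shape of \<open>S\<close>.

\<^bold>\<open>The spectrum is affine.\<close> Unless \<open>S\<close> is a multiple of the standard unimodular triangle, there is an
affine function \<open>u\<close> such that every eigenvalue of \<open>A\<close> has the form \<open>u(s)\<close> with \<open>s \<in> S\<close>
(\<open>toric_derivation_simplex_or_spectrum\<close>). If all roots lie in a closed half plane, then \<open>A\<close> is block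
triangular, and the blocks are operators on polynomials in one variable whose eigenvalues can be read off
from the order of vanishing of an eigenvector at a root of a quadratic polynomial
(\<open>affine_spectrum_half_plane\<close>). If they do not, a case analysis leaves only the triangle and the rectangle,
and for a rectangle \<open>A\<close> is a sum of two commuting operators of the same kind (\<open>affine_spectrum_rectangle\<close>).

\<^bold>\<open>Recovering the polygon.\<close> Now take \<open>L(x, y) = x + K y + const\<close> with \<open>K\<close> very large. The equality of the
values of \<open>L\<close> on \<open>S'\<close> with values of \<open>u\<close> on \<open>S\<close> gives a bijection from \<open>S\<close> to \<open>S'\<close>. Affine relations in
\<open>S\<close> hold for the values of \<open>u\<close>, hence for the values of \<open>L\<close> on the images, and hence, as \<open>K\<close> is large, for
the images themselves. Thus the bijection is affine; it is unimodular because both sets contain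
unimodular triangles (\<open>unimod_of_affine_spectrum\<close>). The situation is symmetric in the two polygons, so it
suffices that one of them is not a multiple of the standard triangle. If both are such multiples, the
number of lattice points decides (\<open>simplex_like_unimod\<close>).\<close>

section \<open>Affine functions and unimodular maps of the lattice plane\<close>

text \<open>Twice the signed area of the triangle \<open>p q r\<close>; it vanishes exactly for collinear points.\<close>

definition cross :: "int \<times> int \<Rightarrow> int \<times> int \<Rightarrow> int \<times> int \<Rightarrow> int" where
  "cross p q r = (fst q - fst p) * (snd r - snd p) - (snd q - snd p) * (fst r - fst p)"

definition affine_fun :: "(int \<times> int \<Rightarrow> 'k::comm_ring_1) \<Rightarrow> bool" where
  "affine_fun g \<longleftrightarrow> (\<exists>a b c. \<forall>x y. g (x, y) = a + b * of_int x + c * of_int y)"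

lemma affine_fun_add:
  assumes "affine_fun g" "affine_fun h"
  shows "affine_fun (\<lambda>z. g z + h z)"
proof -
  obtain a b c a' b' c' where "\<forall>x y. g (x, y) = a + b * of_int x + c * of_int y"
    "\<forall>x y. h (x, y) = a' + b' * of_int x + c' * of_int y"
    using assms unfolding affine_fun_def by blast
  then have "\<forall>x y. g (x, y) + h (x, y) = (a + a') + (b + b') * of_int x + (c + c') * of_int y"
    by (simp add: algebra_simps)
  then show ?thesis
    unfolding affine_fun_def by blast
qed

lemma affine_fun_scale:
  assumes "affine_fun g"
  shows "affine_fun (\<lambda>z. k * g z)"
proof -
  obtain a b c where "\<forall>x y. g (x, y) = a + b * of_int x + c * of_int y"
    using assms unfolding affine_fun_def by blast
  then have "\<forall>x y. k * g (x, y) = k * a + (k * b) * of_int x + (k * c) * of_int y"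
    by (simp add: algebra_simps)
  then show ?thesis
    unfolding affine_fun_def by blast
qed

lemma affine_fun_const: "affine_fun (\<lambda>z. k)"
  unfolding affine_fun_def by (rule exI[of _ k], rule exI[of _ 0], rule exI[of _ 0]) simp

lemma affine_fun_cross:
  fixes p q r :: "int \<times> int"
  shows "affine_fun (\<lambda>z. of_int (cross p z r) :: 'k::comm_ring_1)"
    "affine_fun (\<lambda>z. of_int (cross p q z) :: 'k)"
proof -
  have "\<forall>x y. (of_int (cross p (x, y) r) :: 'k) = of_int (- fst p * (snd r - snd p) + snd p * (fst r - fst p))
      + of_int (snd r - snd p) * of_int x + of_int (- (fst r - fst p)) * of_int y"
    by (simp add: cross_def algebra_simps)
  then show "affine_fun (\<lambda>z. of_int (cross p z r) :: 'k)"
    unfolding affine_fun_def by blast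
  have "\<forall>x y. (of_int (cross p q (x, y)) :: 'k) = of_int (- (fst q - fst p) * snd p + (snd q - snd p) * fst p)
      + of_int (- (snd q - snd p)) * of_int x + of_int (fst q - fst p) * of_int y"
    by (simp add: cross_def algebra_simps)
  then show "affine_fun (\<lambda>z. of_int (cross p q z) :: 'k)"
    unfolding affine_fun_def by blast
qed

text \<open>An affine function with three non-collinear zeros vanishes: eliminating with the edge vectors shows
that \<open>cross p q r\<close> kills its linear coefficients, and in characteristic \<open>0\<close> this integer is a unit.\<close>

lemma affine_fun_eq_0:
  fixes g :: "int \<times> int \<Rightarrow> 'k::field_char_0"
  assumes "affine_fun g" "g p = 0" "g q = 0" "g r = 0" "cross p q r \<noteq> 0"
  shows "g z = 0"
proof -
  obtain a b c where g: "\<And>x y. g (x, y) = a + b * of_int x + c * of_int y"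
    using assms(1) unfolding affine_fun_def by blast
  have g': "g z = a + b * of_int (fst z) + c * of_int (snd z)" for z
    using g[of "fst z" "snd z"] by simp
  have p: "a + b * of_int (fst p) + c * of_int (snd p) = 0"
    and q: "b * of_int (fst q - fst p) + c * of_int (snd q - snd p) = 0"
    and r: "b * of_int (fst r - fst p) + c * of_int (snd r - snd p) = 0"
  proof -
    show "a + b * of_int (fst p) + c * of_int (snd p) = 0"
      using assms(2) g'[of p] by simp
    have "b * of_int (fst q - fst p) + c * of_int (snd q - snd p) = g q - g p"
      "b * of_int (fst r - fst p) + c * of_int (snd r - snd p) = g r - g p"
      unfolding g' by (simp_all add: algebra_simps)
    then show "b * of_int (fst q - fst p) + c * of_int (snd q - snd p) = 0"
      "b * of_int (fst r - fst p) + c * of_int (snd r - snd p) = 0"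
      using assms(2-4) by simp_all
  qed
  have "b * of_int (cross p q r) =
      (b * of_int (fst q - fst p) + c * of_int (snd q - snd p)) * of_int (snd r - snd p)
      - (b * of_int (fst r - fst p) + c * of_int (snd r - snd p)) * of_int (snd q - snd p)"
    unfolding cross_def by (simp add: algebra_simps)
  then have b: "b = 0"
    using q r assms(5) by simp
  have "c * of_int (cross p q r) =
      (b * of_int (fst r - fst p) + c * of_int (snd r - snd p)) * of_int (fst q - fst p)
      - (b * of_int (fst q - fst p) + c * of_int (snd q - snd p)) * of_int (fst r - fst p)"
    unfolding cross_def by (simp add: algebra_simps)
  then have c: "c = 0"
    using q r assms(5) by simp
  show ?thesis
    using p b c by (simp add: g')
qed

definition unimod :: "(int \<times> int \<Rightarrow> int \<times> int) \<Rightarrow> bool" where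
  "unimod P \<longleftrightarrow> (\<exists>a b c d s t. (a * d - b * c = 1 \<or> a * d - b * c = -1) \<and>
     P = (\<lambda>(x, y). (a * x + b * y + s, c * x + d * y + t)))"

lemma unimod_comp:
  assumes "unimod P" "unimod Q"
  shows "unimod (P \<circ> Q)"
proof -
  obtain a b c d s t where P: "a * d - b * c = 1 \<or> a * d - b * c = -1"
    "P = (\<lambda>(x, y). (a * x + b * y + s, c * x + d * y + t))"
    using assms(1) unfolding unimod_def by blast
  obtain a' b' c' d' s' t' where Q: "a' * d' - b' * c' = 1 \<or> a' * d' - b' * c' = -1"
    "Q = (\<lambda>(x, y). (a' * x + b' * y + s', c' * x + d' * y + t'))"
    using assms(2) unfolding unimod_def by blast
  have "(a * a' + b * c') * (c * b' + d * d') - (a * b' + b * d') * (c * a' + d * c')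
      = (a * d - b * c) * (a' * d' - b' * c')"
    by (simp add: algebra_simps)
  then have det: "(a * a' + b * c') * (c * b' + d * d') - (a * b' + b * d') * (c * a' + d * c') = 1
      \<or> (a * a' + b * c') * (c * b' + d * d') - (a * b' + b * d') * (c * a' + d * c') = -1"
    using P(1) Q(1) by auto
  have "P \<circ> Q = (\<lambda>(x, y). ((a * a' + b * c') * x + (a * b' + b * d') * y + (a * s' + b * t' + s),
      (c * a' + d * c') * x + (c * b' + d * d') * y + (c * s' + d * t' + t)))"
    unfolding P(2) Q(2) by (auto simp: fun_eq_iff algebra_simps)
  then show ?thesis
    unfolding unimod_def using det by blast
qed

lemma unimod_inverse:
  assumes "unimod P"
  obtains Q where "unimod Q" "\<And>z. P (Q z) = z" "\<And>z. Q (P z) = z"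
proof -
  obtain a b c d s t where D: "a * d - b * c = 1 \<or> a * d - b * c = -1"
    and P: "P = (\<lambda>(x, y). (a * x + b * y + s, c * x + d * y + t))"
    using assms unfolding unimod_def by blast
  define D where "D = a * d - b * c"
  have D1: "D = 1 \<or> D = -1" and DD: "D * D = 1" and ad: "a * d = D + b * c"
    using D unfolding D_def by auto
  define Q where "Q = (\<lambda>(x, y). ((D * d) * x + (- D * b) * y + D * (b * t - d * s),
      (- D * c) * x + (D * a) * y + D * (c * s - a * t)))"
  have "(D * d) * (D * a) - (- D * b) * (- D * c) = (D * D) * D"
    by (simp add: D_def algebra_simps)
  then have det: "(D * d) * (D * a) - (- D * b) * (- D * c) = D"
    by (simp add: DD)
  have "unimod Q"
    unfolding unimod_def Q_def using det D1 by blast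
  moreover have "P (Q z) = z" for z
  proof (cases z)
    case (Pair x y)
    have "a * ((D * d) * x + (- D * b) * y + D * (b * t - d * s))
        + b * ((- D * c) * x + (D * a) * y + D * (c * s - a * t)) + s = D * (a * d - b * c) * (x - s) + s"
      by (simp add: algebra_simps)
    moreover have "c * ((D * d) * x + (- D * b) * y + D * (b * t - d * s))
        + d * ((- D * c) * x + (D * a) * y + D * (c * s - a * t)) + t = D * (a * d - b * c) * (y - t) + t"
      by (simp add: algebra_simps)
    ultimately show ?thesis
      using DD by (simp add: Pair P Q_def D_def[symmetric])
  qed
  moreover have "Q (P z) = z" for z
  proof (cases z)
    case (Pair x y)
    have "(D * d) * (a * x + b * y + s) + (- D * b) * (c * x + d * y + t) + D * (b * t - d * s)
        = D * (a * d - b * c) * x"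
      by (simp add: algebra_simps)
    moreover have "(- D * c) * (a * x + b * y + s) + (D * a) * (c * x + d * y + t) + D * (c * s - a * t)
        = D * (a * d - b * c) * y"
      by (simp add: algebra_simps)
    ultimately show ?thesis
      using DD by (simp add: Pair P Q_def D_def[symmetric])
  qed
  ultimately show ?thesis
    using that by blast
qed

lemma affine_fun_unimod:
  assumes "affine_fun g" "unimod P"
  shows "affine_fun (\<lambda>z. g (P z))"
proof -
  obtain a b c where g: "\<And>x y. g (x, y) = a + b * of_int x + c * of_int y"
    using assms(1) unfolding affine_fun_def by blast
  obtain a' b' c' d' s' t' where P: "P = (\<lambda>(x, y). (a' * x + b' * y + s', c' * x + d' * y + t'))"
    using assms(2) unfolding unimod_def by blast
  have "g (P (x, y)) = (a + b * of_int s' + c * of_int t') + (b * of_int a' + c * of_int c') * of_int x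
      + (b * of_int b' + c * of_int d') * of_int y" for x y
    unfolding P by (simp add: g algebra_simps)
  then show ?thesis
    unfolding affine_fun_def by blast
qed

lemma cross_unimod:
  assumes "unimod P"
  shows "\<bar>cross (P p) (P q) (P r)\<bar> = \<bar>cross p q r\<bar>"
proof -
  obtain a b c d s t where D: "a * d - b * c = 1 \<or> a * d - b * c = -1"
    and P: "P = (\<lambda>(x, y). (a * x + b * y + s, c * x + d * y + t))"
    using assms unfolding unimod_def by blast
  have "cross (P p) (P q) (P r) = (a * d - b * c) * cross p q r"
    unfolding P cross_def by (simp add: case_prod_unfold algebra_simps)
  then show ?thesis
    using D by (auto simp: abs_mult)
qed

text \<open>A finite set with this property consists of the lattice points of its convex hull. Three points suffice in the
plane (Caratheodory), and clearing denominators in the barycentric coordinates keeps the condition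
inside the integers.\<close>

definition lattice_convex :: "(int \<times> int) set \<Rightarrow> bool" where
  "lattice_convex S \<longleftrightarrow> (\<forall>p\<in>S. \<forall>q\<in>S. \<forall>r\<in>S. \<forall>a b c z. a \<ge> 0 \<longrightarrow> b \<ge> 0 \<longrightarrow> c \<ge> 0 \<longrightarrow> a + b + c > 0 \<longrightarrow>
     (a + b + c) * fst z = a * fst p + b * fst q + c * fst r \<longrightarrow>
     (a + b + c) * snd z = a * snd p + b * snd q + c * snd r \<longrightarrow> z \<in> S)"

lemma lattice_convexD:
  assumes "lattice_convex S" "p \<in> S" "q \<in> S" "r \<in> S" "a \<ge> 0" "b \<ge> 0" "c \<ge> 0" "a + b + c > 0"
    "(a + b + c) * fst z = a * fst p + b * fst q + c * fst r"
    "(a + b + c) * snd z = a * snd p + b * snd q + c * snd r"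
  shows "z \<in> S"
  using assms unfolding lattice_convex_def by blast

lemma lattice_convex_column:
  assumes "lattice_convex S" "(i, j1) \<in> S" "(i, j2) \<in> S" "j1 \<le> j" "j \<le> j2"
  shows "(i, j) \<in> S"
proof (cases "j1 = j2")
  case False
  have "(j2 - j1) * j = (j2 - j) * j1 + (j - j1) * j2"
    by (simp add: algebra_simps)
  with False assms show ?thesis
    by (intro lattice_convexD[OF assms(1-3) assms(3), of "j2 - j" "j - j1" 0]) (auto simp: algebra_simps)
qed (use assms in auto)

lemma lattice_convex_row:
  assumes "lattice_convex S" "(i1, j) \<in> S" "(i2, j) \<in> S" "i1 \<le> i" "i \<le> i2"
  shows "(i, j) \<in> S"
proof (cases "i1 = i2")
  case False
  have "(i2 - i1) * i = (i2 - i) * i1 + (i - i1) * i2"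
    by (simp add: algebra_simps)
  with False assms show ?thesis
    by (intro lattice_convexD[OF assms(1-3) assms(3), of "i2 - i" "i - i1" 0]) (auto simp: algebra_simps)
qed (use assms in auto)

section \<open>Toric derivations\<close>

text \<open>\<open>\<Lambda>\<close> encodes the operator \<open>A (x\<^sup>s) = (\<Sum>\<alpha>. \<Lambda> \<alpha> s * x\<^sup>s\<^sup>+\<^sup>\<alpha>)\<close> on the span of the monomials with
exponents in \<open>S\<close>, which the last condition makes well defined. That \<open>\<Lambda> \<alpha>\<close> is affine in \<open>s\<close> means
\<open>A = g\<^sub>0 + g\<^sub>1 x \<partial>\<^sub>x + g\<^sub>2 y \<partial>\<^sub>y\<close> for Laurent polynomials \<open>g\<^sub>i\<close>: these are the infinitesimal
linear automorphisms of the affine cone over the toric surface. The nonzero \<open>\<alpha>\<close> with \<open>\<Lambda> \<alpha> \<noteq> 0\<close> on \<open>S\<close> are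
called roots.\<close>

definition toric_derivation :: "(int \<times> int) set \<Rightarrow> (int \<times> int \<Rightarrow> int \<times> int \<Rightarrow> 'k::field_char_0) \<Rightarrow> bool" where
  "toric_derivation S \<Lambda> \<longleftrightarrow> finite S \<and> lattice_convex S \<and> (\<forall>\<alpha>. affine_fun (\<Lambda> \<alpha>)) \<and>
     (\<forall>\<alpha>. \<forall>s\<in>S. s + \<alpha> \<notin> S \<longrightarrow> \<Lambda> \<alpha> s = 0)"

text \<open>\<open>f\<close> lists the coefficients of a Laurent polynomial; the sum is the coefficient of \<open>x\<^sup>s\<close> in its image.\<close>

definition eigenvector ::
  "(int \<times> int) set \<Rightarrow> (int \<times> int \<Rightarrow> int \<times> int \<Rightarrow> 'k::field_char_0) \<Rightarrow> (int \<times> int \<Rightarrow> 'k) \<Rightarrow> 'k \<Rightarrow> bool" where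
  "eigenvector S \<Lambda> f \<mu> \<longleftrightarrow> (\<forall>s. s \<notin> S \<longrightarrow> f s = 0) \<and> (\<exists>s\<in>S. f s \<noteq> 0) \<and>
     (\<forall>s\<in>S. \<mu> * f s = (\<Sum>n\<in>S. f n * \<Lambda> (s - n) n))"

text \<open>The eigenvalues are indexed by \<open>S\<close> in the way that they would be for a diagonal operator of the torus.\<close>

definition affine_spectrum :: "(int \<times> int) set \<Rightarrow> (int \<times> int \<Rightarrow> int \<times> int \<Rightarrow> 'k::field_char_0) \<Rightarrow> bool" where
  "affine_spectrum S \<Lambda> \<longleftrightarrow> (\<exists>u. affine_fun u \<and> (\<forall>f \<mu>. eigenvector S \<Lambda> f \<mu> \<longrightarrow> (\<exists>s\<in>S. \<mu> = u s)))"

definition standard_simplex :: "int \<Rightarrow> (int \<times> int) set" where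
  "standard_simplex d = {(i, j). 0 \<le> j \<and> j \<le> i \<and> i \<le> d}"

definition simplex_like :: "(int \<times> int) set \<Rightarrow> bool" where
  "simplex_like S \<longleftrightarrow> (\<exists>Q d. unimod Q \<and> d \<ge> 0 \<and> S = Q ` standard_simplex d)"

text \<open>The same operator in new coordinates: a point \<open>z\<close> now stands for \<open>P z\<close>, and a shift \<open>\<alpha>\<close> for its image under the
linear part of \<open>P\<close>. All notions about toric derivations are invariant under this change, which
allows normalizations of \<open>S\<close> without loss of generality.\<close>

definition pull :: "(int \<times> int \<Rightarrow> int \<times> int) \<Rightarrow> (int \<times> int \<Rightarrow> int \<times> int \<Rightarrow> 'k) \<Rightarrow> int \<times> int \<Rightarrow> int \<times> int \<Rightarrow> 'k" where
  "pull P \<Lambda> \<alpha> z = \<Lambda> (P \<alpha> - P 0) (P z)"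

lemma unimod_add:
  assumes "unimod P"
  shows "P (z + \<alpha>) = P z + (P \<alpha> - P 0)"
  using assms unfolding unimod_def by (auto simp: case_prod_unfold algebra_simps zero_prod_def)

lemma unimod_diff:
  assumes "unimod P"
  shows "P (z - w) - P 0 = P z - P w"
  using assms unfolding unimod_def by (auto simp: case_prod_unfold algebra_simps zero_prod_def)

lemma unimod_inj: "unimod P \<Longrightarrow> inj P"
  by (metis injI unimod_inverse)

lemma unimod_image_vimage: "unimod P \<Longrightarrow> P ` (P -` S) = S"
  by (metis surj_def surj_image_vimage_eq unimod_inverse)

lemma lattice_convex_vimage:
  assumes "lattice_convex S" "unimod P"
  shows "lattice_convex (P -` S)"
  unfolding lattice_convex_def
proof (intro ballI allI impI)
  fix p q r a b c z
  assume *: "p \<in> P -` S" "q \<in> P -` S" "r \<in> P -` S" "0 \<le> a" "0 \<le> b" "0 \<le> c" "0 < a + b + c"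
    "(a + b + c) * fst z = a * fst p + b * fst q + c * fst r"
    "(a + b + c) * snd z = a * snd p + b * snd q + c * snd r"
  obtain a' b' c' d' s' t' where P: "P = (\<lambda>(x, y). (a' * x + b' * y + s', c' * x + d' * y + t'))"
    using assms(2) unfolding unimod_def by blast
  have "(a + b + c) * fst (P z) = a' * ((a + b + c) * fst z) + b' * ((a + b + c) * snd z) + (a + b + c) * s'"
    by (simp add: P case_prod_unfold algebra_simps)
  also have "\<dots> = a * fst (P p) + b * fst (P q) + c * fst (P r)"
    unfolding *(8,9) by (simp add: P case_prod_unfold algebra_simps)
  finally have 1: "(a + b + c) * fst (P z) = a * fst (P p) + b * fst (P q) + c * fst (P r)" .
  have "(a + b + c) * snd (P z) = c' * ((a + b + c) * fst z) + d' * ((a + b + c) * snd z) + (a + b + c) * t'"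
    by (simp add: P case_prod_unfold algebra_simps)
  also have "\<dots> = a * snd (P p) + b * snd (P q) + c * snd (P r)"
    unfolding *(8,9) by (simp add: P case_prod_unfold algebra_simps)
  finally have 2: "(a + b + c) * snd (P z) = a * snd (P p) + b * snd (P q) + c * snd (P r)" .
  show "z \<in> P -` S"
    using lattice_convexD[OF assms(1) _ _ _ *(4-7) 1 2] *(1-3) by auto
qed

lemma toric_derivation_pull:
  assumes "toric_derivation S \<Lambda>" "unimod P"
  shows "toric_derivation (P -` S) (pull P \<Lambda>)"
  unfolding toric_derivation_def
proof (intro conjI allI ballI impI)
  show "finite (P -` S)"
    using assms unimod_inj[OF assms(2)] by (auto simp: toric_derivation_def intro: finite_vimageI)
  show "lattice_convex (P -` S)"
    using assms lattice_convex_vimage by (auto simp: toric_derivation_def)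
  fix \<alpha>
  show "affine_fun (pull P \<Lambda> \<alpha>)"
    using assms affine_fun_unimod unfolding pull_def toric_derivation_def by blast
  fix s assume "s \<in> P -` S" "s + \<alpha> \<notin> P -` S"
  then show "pull P \<Lambda> \<alpha> s = 0"
    using assms(1) unfolding pull_def toric_derivation_def vimage_eq unimod_add[OF assms(2)] by blast
qed

lemma eigenvector_pull:
  assumes "eigenvector S \<Lambda> f \<mu>" "unimod P"
  shows "eigenvector (P -` S) (pull P \<Lambda>) (\<lambda>z. f (P z)) \<mu>"
proof -
  have inj: "inj_on P (P -` S)"
    using unimod_inj[OF assms(2)] by (auto simp: inj_on_def)
  have im: "P ` (P -` S) = S"
    by (rule unimod_image_vimage[OF assms(2)])
  have "\<mu> * f (P s) = (\<Sum>n\<in>P -` S. f (P n) * pull P \<Lambda> (s - n) n)" if "s \<in> P -` S" for s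
  proof -
    have "\<mu> * f (P s) = (\<Sum>n\<in>P ` (P -` S). f n * \<Lambda> (P s - n) n)"
      using assms(1) that unfolding im eigenvector_def by auto
    also have "\<dots> = (\<Sum>n\<in>P -` S. f (P n) * \<Lambda> (P s - P n) (P n))"
      using inj by (subst sum.reindex) auto
    finally show ?thesis
      by (simp add: pull_def unimod_diff[OF assms(2)])
  qed
  moreover have "\<exists>s\<in>P -` S. f (P s) \<noteq> 0"
  proof -
    obtain s where "s \<in> S" "f s \<noteq> 0"
      using assms(1) unfolding eigenvector_def by blast
    then show ?thesis using im by (metis imageE)
  qed
  moreover have "f (P s) = 0" if "s \<notin> P -` S" for s
    using assms(1) that unfolding eigenvector_def vimage_eq by blast
  ultimately show ?thesis
    unfolding eigenvector_def by blast
qed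

lemma affine_spectrum_pull:
  assumes "affine_spectrum (P -` S) (pull P \<Lambda>)" "unimod P"
  shows "affine_spectrum S \<Lambda>"
proof -
  obtain u where u: "affine_fun u"
    "\<And>f \<mu>. eigenvector (P -` S) (pull P \<Lambda>) f \<mu> \<Longrightarrow> (\<exists>s\<in>P -` S. \<mu> = u s)"
    using assms(1) unfolding affine_spectrum_def by blast
  obtain Q where Q: "unimod Q" "\<And>z. P (Q z) = z" "\<And>z. Q (P z) = z"
    using unimod_inverse[OF assms(2)] by blast
  have "\<exists>s\<in>S. \<mu> = u (Q s)" if eig: "eigenvector S \<Lambda> f \<mu>" for f \<mu>
  proof -
    obtain s where "P s \<in> S" "\<mu> = u s"
      using u(2)[OF eigenvector_pull[OF eig assms(2)]] unfolding vimage_eq by blast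
    then show ?thesis
      using Q(3) by (intro bexI[of _ "P s"]) auto
  qed
  then show ?thesis
    unfolding affine_spectrum_def using affine_fun_unimod[OF u(1) Q(1)] by blast
qed

lemma simplex_like_pull:
  assumes "simplex_like (P -` S)" "unimod P"
  shows "simplex_like S"
proof -
  obtain Q d where "unimod Q" "d \<ge> 0" "P -` S = Q ` standard_simplex d"
    using assms(1) unfolding simplex_like_def by blast
  then have "S = (P \<circ> Q) ` standard_simplex d"
    using unimod_image_vimage[OF assms(2), of S] by (simp add: image_comp)
  then show ?thesis
    unfolding simplex_like_def using unimod_comp[OF assms(2) \<open>unimod Q\<close>] \<open>d \<ge> 0\<close> by blast
qed

section \<open>A one-variable eigenvalue problem\<close>

text \<open>The action of an element of \<open>gl\<^sub>2\<close> on binary forms of degree \<open>d\<close>, written for the dehomogenized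
polynomial \<open>F\<close> of degree at most \<open>d\<close>. This is what a toric derivation does on one lattice line in the
direction of a pair of opposite roots, \<open>r\<close> and \<open>t\<close> being the coefficients of the two root vectors.\<close>

definition quadratic_op :: "'k::field_char_0 \<Rightarrow> 'k \<Rightarrow> 'k \<Rightarrow> nat \<Rightarrow> 'k \<Rightarrow> 'k poly \<Rightarrow> 'k poly" where
  "quadratic_op r p t d c F = [:c, t * of_nat d:] * F + [:r, p, - t:] * pderiv F"

lemma coeff_quadratic_op:
  "poly.coeff (quadratic_op r p t d c F) k = (c + p * of_nat k) * poly.coeff F k
     + r * of_nat (Suc k) * poly.coeff F (Suc k)
     + (if k = 0 then 0 else t * (of_nat d - of_nat (k - 1)) * poly.coeff F (k - 1))"
  by (cases k; cases "k - 1") (auto simp: quadratic_op_def coeff_pCons' coeff_pderiv algebra_simps)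

text \<open>The factor \<open>t * (d - d)\<close> stops the raising part at degree \<open>d\<close>.\<close>

lemma coeff_quadratic_op_above:
  assumes "degree F \<le> d" "k > d"
  shows "poly.coeff (quadratic_op r p t d c F) k = 0"
proof (cases k)
  case (Suc k')
  have "poly.coeff F k = 0" "poly.coeff F (Suc k) = 0"
    using assms by (auto intro: coeff_eq_0)
  moreover have "k' = d \<or> poly.coeff F k' = 0"
    using assms Suc by (cases "k' = d") (auto intro: coeff_eq_0)
  ultimately show ?thesis
    using Suc by (auto simp: coeff_quadratic_op)
qed (use assms in simp)

text \<open>Moving a root of the quadratic to the origin removes the lowering part, so the operator becomes
triangular with respect to the order of vanishing.\<close>

lemma quadratic_op_translate:
  assumes "r + p * y - t * y\<^sup>2 = 0"
  shows "pcompose (quadratic_op r p t d c F) [:y, 1:]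
      = quadratic_op 0 (p - 2 * t * y) t d (c + t * of_nat d * y) (pcompose F [:y, 1:])"
proof -
  have 1: "pcompose [:r, p, - t:] [:y, 1:] = [:0, p - 2 * t * y, - t:]"
    using assms by (simp add: pcompose_pCons power2_eq_square algebra_simps)
  have 2: "pcompose [:c, t * of_nat d:] [:y, 1:] = [:c + t * of_nat d * y, t * of_nat d:]"
    by (simp add: pcompose_pCons algebra_simps)
  have 3: "pderiv (pcompose F [:y, 1:]) = pcompose (pderiv F) [:y, 1:]"
    by (simp add: pderiv_pcompose pderiv_pCons)
  show ?thesis
    unfolding quadratic_op_def 3 by (simp only: pcompose_add pcompose_mult 1 2)
qed

text \<open>The value \<open>y = 0\<close> in the degenerate cases lets one formula for the eigenvalues cover all cases: for
\<open>t = 0\<close> the operator is triangular with respect to the degree, and for \<open>r = 0\<close> zero is a root of the quadratic.\<close>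

lemma quadratic_root_exists:
  fixes r p t :: "'k::{alg_closed_field, field_char_0}"
  obtains y where "t = 0 \<Longrightarrow> y = 0" "r = 0 \<Longrightarrow> y = 0" "t \<noteq> 0 \<Longrightarrow> r + p * y - t * y\<^sup>2 = 0"
proof (cases "t = 0 \<or> r = 0")
  case True
  then show ?thesis
    by (intro that[of 0]) auto
next
  case False
  then have "degree [:r, p, - t:] > 0"
    by simp
  then obtain y where "poly [:r, p, - t:] y = 0"
    using alg_closed_imp_poly_has_root by blast
  then have "r + p * y - t * y\<^sup>2 = 0"
    by (simp add: power2_eq_square algebra_simps)
  with False show ?thesis
    by (intro that[of y]) auto
qed

text \<open>Leading terms turn the operator into multiplication by a scalar. For a whole family of polynomials at
once, \<open>\<Theta>\<close> takes the coefficient of \<open>(Y - y)\<^sup>\<kappa>\<close>, where \<open>\<kappa>\<close> is the least order of vanishing at \<open>y\<close> in the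
family; if \<open>t = 0\<close>, it takes the coefficient of the highest power instead. A linear functional, rather than a statement
about eigenvalues, is needed for rectangles, where the members of the family are coupled.\<close>

lemma quadratic_op_symbol:
  fixes F :: "'i \<Rightarrow> 'k::field_char_0 poly"
  assumes y: "t = 0 \<Longrightarrow> y = 0" "t \<noteq> 0 \<Longrightarrow> r + p * y - t * y\<^sup>2 = 0"
    and I: "finite I" "\<exists>i\<in>I. F i \<noteq> 0" and deg: "\<And>i. i \<in> I \<Longrightarrow> degree (F i) \<le> d"
  shows "\<exists>\<kappa>\<le>d. \<exists>\<Theta>. (\<forall>P Q. \<Theta> (P + Q) = \<Theta> P + \<Theta> Q) \<and> (\<forall>a P. \<Theta> (smult a P) = a * \<Theta> P) \<and>
    (\<exists>i\<in>I. \<Theta> (F i) \<noteq> 0) \<and> (\<forall>i\<in>I. \<Theta> (quadratic_op r p t d c (F i))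
        = (c + t * of_nat d * y + of_nat \<kappa> * (p - 2 * t * y)) * \<Theta> (F i))"
proof (cases "t = 0")
  case True
  define J where "J = {i \<in> I. F i \<noteq> 0}"
  define \<kappa> where "\<kappa> = Max (degree ` F ` J)"
  have J: "finite (degree ` F ` J)" "degree ` F ` J \<noteq> {}"
    using I unfolding J_def by auto
  obtain i0 where i0: "i0 \<in> J" "degree (F i0) = \<kappa>"
    using Max_in[OF J] unfolding \<kappa>_def by auto
  have le: "degree (F i) \<le> \<kappa>" if "i \<in> I" for i
  proof (cases "F i = 0")
    case False
    with that have "i \<in> J" unfolding J_def by auto
    then show ?thesis unfolding \<kappa>_def using J by auto
  qed auto
  have top: "poly.coeff (F i) (Suc \<kappa>) = 0" if "i \<in> I" for i
    using le[OF that] by (intro coeff_eq_0) auto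
  have "\<kappa> \<le> d"
    using i0 deg[of i0] unfolding J_def by auto
  moreover have "\<exists>i\<in>I. poly.coeff (F i) \<kappa> \<noteq> 0"
    using i0 unfolding J_def by (auto intro!: bexI[of _ i0])
  moreover have "\<forall>i\<in>I. poly.coeff (quadratic_op r p t d c (F i)) \<kappa>
      = (c + t * of_nat d * y + of_nat \<kappa> * (p - 2 * t * y)) * poly.coeff (F i) \<kappa>"
    using True y(1) top by (simp add: coeff_quadratic_op algebra_simps)
  ultimately show ?thesis
    by (intro exI[of _ \<kappa>] conjI exI[of _ "\<lambda>P. poly.coeff P \<kappa>"]) auto
next
  case False
  define G where "G i = pcompose (F i) [:y, 1:]" for i
  have G0: "G i = 0 \<longleftrightarrow> F i = 0" for i
    unfolding G_def by (subst pcompose_eq_0_iff) auto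
  have dG: "degree (G i) = degree (F i)" for i
    unfolding G_def by (simp add: degree_pcompose)
  define \<kappa> where "\<kappa> = (LEAST k. \<exists>i\<in>I. poly.coeff (G i) k \<noteq> 0)"
  have "\<exists>k. \<exists>i\<in>I. poly.coeff (G i) k \<noteq> 0"
    using I(2) G0 by (metis leading_coeff_0_iff)
  then have ex: "\<exists>i\<in>I. poly.coeff (G i) \<kappa> \<noteq> 0"
    unfolding \<kappa>_def by (rule LeastI_ex)
  have low: "poly.coeff (G i) k = 0" if "k < \<kappa>" "i \<in> I" for i k
    using not_less_Least[OF that(1)[unfolded \<kappa>_def]] that(2) by blast
  have "\<kappa> \<le> d"
    using ex deg dG by (metis le_degree order_trans)
  moreover have "\<exists>i\<in>I. poly.coeff (pcompose (F i) [:y, 1:]) \<kappa> \<noteq> 0"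
    using ex unfolding G_def .
  moreover have "\<forall>i\<in>I. poly.coeff (pcompose (quadratic_op r p t d c (F i)) [:y, 1:]) \<kappa>
      = (c + t * of_nat d * y + of_nat \<kappa> * (p - 2 * t * y)) * poly.coeff (pcompose (F i) [:y, 1:]) \<kappa>"
  proof
    fix i assume i: "i \<in> I"
    have "poly.coeff (pcompose (quadratic_op r p t d c (F i)) [:y, 1:]) \<kappa>
        = (c + t * of_nat d * y + (p - 2 * t * y) * of_nat \<kappa>) * poly.coeff (G i) \<kappa>"
      unfolding quadratic_op_translate[OF y(2)[OF False]] coeff_quadratic_op
      using low[OF _ i] by (cases \<kappa>) (auto simp: G_def)
    then show "poly.coeff (pcompose (quadratic_op r p t d c (F i)) [:y, 1:]) \<kappa>
        = (c + t * of_nat d * y + of_nat \<kappa> * (p - 2 * t * y)) * poly.coeff (pcompose (F i) [:y, 1:]) \<kappa>"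
      by (simp add: G_def algebra_simps)
  qed
  ultimately show ?thesis
    by (intro exI[of _ \<kappa>] conjI exI[of _ "\<lambda>P. poly.coeff (pcompose P [:y, 1:]) \<kappa>"])
      (auto simp: pcompose_add pcompose_smult)
qed

corollary quadratic_op_eigenvalue:
  fixes F :: "'k::field_char_0 poly"
  assumes "t = 0 \<Longrightarrow> y = 0" "t \<noteq> 0 \<Longrightarrow> r + p * y - t * y\<^sup>2 = 0"
    and "F \<noteq> 0" "degree F \<le> d" and eig: "smult \<mu> F = quadratic_op r p t d c F"
  obtains \<kappa> where "\<kappa> \<le> d" "\<mu> = c + t * of_nat d * y + of_nat \<kappa> * (p - 2 * t * y)"
proof -
  obtain \<kappa> \<Theta> where "\<kappa> \<le> d" and \<Theta>: "\<And>a P. \<Theta> (smult a P) = a * \<Theta> P" "\<Theta> F \<noteq> 0"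
    "\<Theta> (quadratic_op r p t d c F) = (c + t * of_nat d * y + of_nat \<kappa> * (p - 2 * t * y)) * \<Theta> F"
    using quadratic_op_symbol[of t y r p "{()}" "\<lambda>_. F" d c] assms by auto
  moreover have "\<mu> * \<Theta> F = (c + t * of_nat d * y + of_nat \<kappa> * (p - 2 * t * y)) * \<Theta> F"
    using \<Theta>(1)[of \<mu> F] \<Theta>(3) unfolding eig by metis
  ultimately show ?thesis
    using that by auto
qed

section \<open>Spectra of toric derivations\<close>

text \<open>Only the shifts that actually occur contribute to the eigenvector equation at \<open>s\<close>.\<close>

lemma eigenvector_sum_roots:
  fixes S :: "(int \<times> int) set" and f :: "int \<times> int \<Rightarrow> 'k::comm_ring_1"
  assumes "finite S" "finite R" "\<And>n. n \<notin> S \<Longrightarrow> f n = 0"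
    and "\<And>n. n \<in> S \<Longrightarrow> s - n \<notin> R \<Longrightarrow> f n * \<Lambda> (s - n) n = 0"
  shows "(\<Sum>n\<in>S. f n * \<Lambda> (s - n) n) = (\<Sum>\<alpha>\<in>R. f (s - \<alpha>) * \<Lambda> \<alpha> (s - \<alpha>))"
proof -
  have "(\<Sum>n\<in>S. f n * \<Lambda> (s - n) n) = (\<Sum>n\<in>(\<lambda>\<alpha>. s - \<alpha>) ` R. f n * \<Lambda> (s - n) n)"
  proof (rule sum.mono_neutral_cong)
    fix n assume "n \<in> S - (\<lambda>\<alpha>. s - \<alpha>) ` R"
    moreover have "s - (s - n) = n"
      by (simp add: prod_eq_iff)
    ultimately have "n \<in> S" "s - n \<notin> R"
      by (metis DiffD1, metis DiffD2 image_eqI)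
    then show "f n * \<Lambda> (s - n) n = 0" using assms(4) by blast
  qed (use assms in auto)
  also have "\<dots> = (\<Sum>\<alpha>\<in>R. f (s - \<alpha>) * \<Lambda> \<alpha> (s - \<alpha>))"
    by (subst sum.reindex) (auto simp: inj_on_def)
  finally show ?thesis .
qed

definition poly_upto :: "nat \<Rightarrow> (nat \<Rightarrow> 'k::comm_ring_1) \<Rightarrow> 'k poly" where
  "poly_upto d g = (\<Sum>k\<le>d. monom (g k) k)"

lemma coeff_poly_upto: "poly.coeff (poly_upto d g) k = (if k \<le> d then g k else 0)"
  by (simp add: poly_upto_def coeff_sum)

lemma degree_poly_upto: "degree (poly_upto d g) \<le> d"
  by (rule degree_le) (simp add: coeff_poly_upto)

text \<open>A longer vertical shift would push the two extreme points of a column out of \<open>S\<close>, so the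
coefficient would not depend on the height and would vanish on the whole column.\<close>

lemma toric_derivation_vertical_root:
  assumes D: "toric_derivation S \<Lambda>" and s: "s \<in> S" "\<Lambda> (0, c) s \<noteq> 0"
  shows "\<bar>c\<bar> \<le> 1"
proof (rule ccontr)
  assume c: "\<not> \<bar>c\<bar> \<le> 1"
  obtain i j where ij: "s = (i, j)" by (cases s)
  have fin: "finite S" and conv: "lattice_convex S"
    and zero: "\<And>s. s \<in> S \<Longrightarrow> s + (0, c) \<notin> S \<Longrightarrow> \<Lambda> (0, c) s = 0"
    using D unfolding toric_derivation_def by blast+
  obtain a b e where ab: "\<And>x y. \<Lambda> (0, c) (x, y) = a + b * of_int x + e * of_int y"
    using D unfolding toric_derivation_def affine_fun_def by blast
  have sc: "(i, j + c) \<in> S"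
    using zero[OF s(1)] s(2) ij by auto
  define J where "J = {y. (i, y) \<in> S}"
  have J: "finite J"
    unfolding J_def using finite_vimageI[OF fin, of "\<lambda>y. (i, y)"] by (simp add: inj_on_def vimage_def)
  have jJ: "j \<in> J" "j + c \<in> J"
    using s(1) ij sc unfolding J_def by auto
  have "\<exists>y1 y2. y1 \<noteq> y2 \<and> (i, y1) \<in> S \<and> (i, y2) \<in> S \<and> (i, y1 + c) \<notin> S \<and> (i, y2 + c) \<notin> S"
  proof (cases "c > 0")
    case True
    have M: "Max J \<in> J" "\<And>y. y \<in> J \<Longrightarrow> y \<le> Max J"
      using J jJ by (auto intro: Max_in)
    then have "(i, Max J - 1) \<in> S"
      using lattice_convex_column[OF conv, of i j "Max J" "Max J - 1"] M(2)[OF jJ(2)] True jJ(1)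
      unfolding J_def by auto
    moreover have "(i, Max J + c) \<notin> S" "(i, Max J - 1 + c) \<notin> S"
      using M(2)[of "Max J + c"] M(2)[of "Max J - 1 + c"] True c unfolding J_def by auto
    ultimately show ?thesis
      using M(1) unfolding J_def by (intro exI[of _ "Max J"] exI[of _ "Max J - 1"]) (auto simp: J_def)
  next
    case False
    have M: "Min J \<in> J" "\<And>y. y \<in> J \<Longrightarrow> Min J \<le> y"
      using J jJ by (auto intro: Min_in)
    then have "(i, Min J + 1) \<in> S"
      using lattice_convex_column[OF conv, of i "Min J" j "Min J + 1"] M(2)[OF jJ(2)] False c jJ(1)
      unfolding J_def by auto
    moreover have "(i, Min J + c) \<notin> S" "(i, Min J + 1 + c) \<notin> S"
      using M(2)[of "Min J + c"] M(2)[of "Min J + 1 + c"] False c unfolding J_def by auto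
    ultimately show ?thesis
      using M(1) unfolding J_def by (intro exI[of _ "Min J"] exI[of _ "Min J + 1"]) (auto simp: J_def)
  qed
  then obtain y1 y2 where "y1 \<noteq> y2" "\<Lambda> (0, c) (i, y1) = 0" "\<Lambda> (0, c) (i, y2) = 0"
    using zero by fastforce
  then have y: "a + b * of_int i + e * of_int y1 = 0" "a + b * of_int i + e * of_int y2 = 0" "y1 \<noteq> y2"
    by (simp_all add: ab)
  have "e * of_int (y1 - y2) = (a + b * of_int i + e * of_int y1) - (a + b * of_int i + e * of_int y2)"
    by (simp add: algebra_simps)
  then have "e = 0"
    using y by simp
  then show False
    using s(2) y(1) by (simp add: ij ab)
qed

text \<open>No term moves to the left, so the first column on which an eigenvector is nonzero satisfies an
eigenvector equation of its own. There the only roots are \<open>(0, \<plusminus>1)\<close>, with coefficients proportional to the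
distance from the ends of the column, and the column carries an instance of \<open>quadratic_op\<close>.\<close>

lemma affine_spectrum_half_plane:
  fixes \<Lambda> :: "int \<times> int \<Rightarrow> int \<times> int \<Rightarrow> 'k::{alg_closed_field, field_char_0}"
  assumes D: "toric_derivation S \<Lambda>"
    and half: "\<And>\<alpha> s. fst \<alpha> < 0 \<Longrightarrow> s \<in> S \<Longrightarrow> \<Lambda> \<alpha> s = 0"
  shows "affine_spectrum S \<Lambda>"
proof -
  have fin: "finite S" and conv: "lattice_convex S"
    and aff: "\<And>\<alpha>. affine_fun (\<Lambda> \<alpha>)"
    and zero: "\<And>\<alpha> s. s \<in> S \<Longrightarrow> s + \<alpha> \<notin> S \<Longrightarrow> \<Lambda> \<alpha> s = 0"
    using D unfolding toric_derivation_def by blast+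
  obtain a0 a1 a2 where L0: "\<And>x y. \<Lambda> (0, 0) (x, y) = a0 + a1 * of_int x + a2 * of_int y"
    using aff unfolding affine_fun_def by blast
  obtain r0 r1 r where Lm: "\<And>x y. \<Lambda> (0, -1) (x, y) = r0 + r1 * of_int x + r * of_int y"
    using aff unfolding affine_fun_def by blast
  obtain t0 t1 t' where "\<And>x y. \<Lambda> (0, 1) (x, y) = t0 + t1 * of_int x + t' * of_int y"
    using aff unfolding affine_fun_def by blast
  then have "\<And>x y. \<Lambda> (0, 1) (x, y) = t0 + t1 * of_int x - (- t') * of_int y"
    by simp
  then obtain t where Lp: "\<And>x y. \<Lambda> (0, 1) (x, y) = t0 + t1 * of_int x - t * of_int y"
    by blast
  define lo where "lo i = Min {y. (i, y) \<in> S}" for i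
  define hi where "hi i = Max {y. (i, y) \<in> S}" for i
  have finJ: "finite {y. (i, y) \<in> S}" for i
    using finite_vimageI[OF fin, of "\<lambda>y. (i, y)"] by (simp add: inj_on_def vimage_def)
  have lohi: "(i, lo i) \<in> S" "(i, hi i) \<in> S" "lo i \<le> j" "j \<le> hi i" if "(i, j) \<in> S" for i j
    using Min_in[OF finJ, of i] Max_in[OF finJ, of i] Min_le[OF finJ, of j i] Max_ge[OF finJ, of j i] that
    unfolding lo_def hi_def by auto
  have col: "(i, y) \<in> S \<longleftrightarrow> lo i \<le> y \<and> y \<le> hi i" if "(i, j) \<in> S" for i j y
    using lohi[of i y] lattice_convex_column[OF conv lohi(1,2)[OF that]] by blast
  have Lm': "\<Lambda> (0, -1) (i, j) = r * of_int (j - lo i)" if "(i, j) \<in> S" for i j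
  proof -
    have "(i, lo i) + (0, -1) \<notin> S"
      using col[OF that] by simp
    then have "\<Lambda> (0, -1) (i, lo i) = 0"
      using zero lohi(1)[OF that] by blast
    then show ?thesis
      by (simp add: Lm algebra_simps add_eq_0_iff)
  qed
  have Lp': "\<Lambda> (0, 1) (i, j) = t * of_int (hi i - j)" if "(i, j) \<in> S" for i j
  proof -
    have "(i, hi i) + (0, 1) \<notin> S"
      using col[OF that] by simp
    then have "\<Lambda> (0, 1) (i, hi i) = 0"
      using zero lohi(2)[OF that] by blast
    then show ?thesis
      by (simp add: Lp algebra_simps)
  qed
  obtain y0 where y0: "t = 0 \<Longrightarrow> y0 = 0" "r = 0 \<Longrightarrow> y0 = 0" "t \<noteq> 0 \<Longrightarrow> r + a2 * y0 - t * y0\<^sup>2 = 0"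
    using quadratic_root_exists[of t r a2] by blast
  \<comment> \<open>The last two summands add up to \<open>y0 * t * (lo i + hi i - 2 * j)\<close>: the correction of the diagonal part by
the eigenvalue formula for \<open>quadratic_op\<close>. Written with \<open>\<Lambda>\<close> it is visibly affine. For \<open>r = 0\<close> the division by
zero is harmless since then \<open>y0 = 0\<close>.\<close>
  define u where "u s = \<Lambda> (0, 0) s + (y0 * \<Lambda> (0, 1) s + (- (y0 * t / r)) * \<Lambda> (0, -1) s)" for s
  have "affine_fun u"
    unfolding u_def
    by (rule affine_fun_add[OF aff affine_fun_add[OF affine_fun_scale[OF aff] affine_fun_scale[OF aff]]])
  moreover have "\<exists>s\<in>S. \<mu> = u s" if "eigenvector S \<Lambda> f \<mu>" for f \<mu>
  proof -
    have f0: "\<And>s. s \<notin> S \<Longrightarrow> f s = 0" and fne: "\<exists>s\<in>S. f s \<noteq> 0"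
      and eig: "\<And>s. s \<in> S \<Longrightarrow> \<mu> * f s = (\<Sum>n\<in>S. f n * \<Lambda> (s - n) n)"
      using that unfolding eigenvector_def by blast+
    define X where "X = fst ` {s \<in> S. f s \<noteq> 0}"
    define i where "i = Min X"
    have X: "finite X" "X \<noteq> {}"
      using fin fne unfolding X_def by auto
    have "i \<in> X"
      unfolding i_def using X by (rule Min_in)
    then obtain j0 where j0: "(i, j0) \<in> S" "f (i, j0) \<noteq> 0"
      unfolding X_def by force
    have imin: "f n = 0" if "fst n < i" for n
    proof (rule ccontr)
      assume "f n \<noteq> 0"
      then have "fst n \<in> X"
        unfolding X_def using f0 by blast
      then show False
        using Min_le[OF X(1), of "fst n"] that unfolding i_def by simp
    qed
    define d where "d = nat (hi i - lo i)"
    have d: "int d = hi i - lo i"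
      using lohi(3,4)[OF j0(1)] unfolding d_def by simp
    have inS: "(i, lo i + int k) \<in> S \<longleftrightarrow> k \<le> d" for k
      unfolding col[OF j0(1)] using d by linarith
    define F where "F = poly_upto d (\<lambda>k. f (i, lo i + int k))"
    have cF: "poly.coeff F k = f (i, lo i + int k)" for k
      using f0[of "(i, lo i + int k)"] inS[of k] unfolding F_def coeff_poly_upto by presburger
    have "poly.coeff F (nat (j0 - lo i)) \<noteq> 0"
      using j0(2) lohi(3)[OF j0(1)] by (simp add: cF)
    then have F0: "F \<noteq> 0" by auto
    define c where "c = a0 + a1 * of_int i + a2 * of_int (lo i)"
    have degF: "degree F \<le> d"
      unfolding F_def by (rule degree_poly_upto)
    have eqF: "smult \<mu> F = quadratic_op r a2 t d c F"
    proof (rule poly_eqI)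
      fix k
      show "poly.coeff (smult \<mu> F) k = poly.coeff (quadratic_op r a2 t d c F) k"
      proof (cases "k \<le> d")
        case True
        let ?s = "(i, lo i + int k)"
        have s: "?s \<in> S" using True inS by simp
        have "\<mu> * f ?s = (\<Sum>\<alpha>\<in>{(0, 0), (0, 1), (0, -1)}. f (?s - \<alpha>) * \<Lambda> \<alpha> (?s - \<alpha>))"
          unfolding eig[OF s]
        proof (rule eigenvector_sum_roots)
          fix n assume n: "n \<in> S" "?s - n \<notin> {(0, 0), (0, 1), (0, - 1)}"
          obtain x y where xy: "n = (x, y)" by (cases n)
          consider "x < i" | "x > i" | "x = i" by linarith
          then show "f n * \<Lambda> (?s - n) n = 0"
          proof cases
            case 1
            then show ?thesis using imin[of n] xy by simp
          next
            case 2
            then show ?thesis using half[of "?s - n" n] n xy by simp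
          next
            case 3
            then have "\<not> \<bar>lo i + int k - y\<bar> \<le> 1"
              using n(2) xy by auto
            then show ?thesis
              using toric_derivation_vertical_root[OF D n(1)] 3 xy by force
          qed
        qed (use fin f0 in auto)
        also have "\<dots> = f ?s * \<Lambda> (0, 0) ?s + f (i, lo i + int k - 1) * \<Lambda> (0, 1) (i, lo i + int k - 1)
            + f (i, lo i + int k + 1) * \<Lambda> (0, -1) (i, lo i + int k + 1)"
          by simp
        also have "f (i, lo i + int k - 1) * \<Lambda> (0, 1) (i, lo i + int k - 1)
            = f (i, lo i + int k - 1) * (t * of_int (hi i - (lo i + int k - 1)))"
          using Lp' f0 by (cases "(i, lo i + int k - 1) \<in> S") auto
        also have "f (i, lo i + int k + 1) * \<Lambda> (0, -1) (i, lo i + int k + 1)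
            = f (i, lo i + int k + 1) * (r * of_int (lo i + int k + 1 - lo i))"
          using Lm' f0 by (cases "(i, lo i + int k + 1) \<in> S") auto
        finally have *: "\<mu> * f ?s = f ?s * \<Lambda> (0, 0) ?s
            + f (i, lo i + int k - 1) * (t * of_int (hi i - (lo i + int k - 1)))
            + f (i, lo i + int k + 1) * (r * of_int (int k + 1))"
          by (simp add: algebra_simps)
        have hid: "hi i = lo i + int d" using d by simp
        show ?thesis
        proof (cases k)
          case 0
          have "f (i, lo i - 1) = 0"
            using f0 col[OF j0(1)] by simp
          then show ?thesis
            using * 0 by (simp add: coeff_quadratic_op cF L0 c_def algebra_simps)
        next
          case (Suc k')
          then show ?thesis
            using * by (simp add: coeff_quadratic_op cF L0 c_def hid algebra_simps)
        qed
      next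
        case False
        moreover have "poly.coeff F k = 0"
          using False by (simp add: F_def coeff_poly_upto)
        ultimately show ?thesis
          using coeff_quadratic_op_above[OF degF, of k] by simp
      qed
    qed
    obtain \<kappa> where \<kappa>: "\<kappa> \<le> d"
      and \<mu>: "\<mu> = c + t * of_nat d * y0 + of_nat \<kappa> * (a2 - 2 * t * y0)"
      using quadratic_op_eigenvalue[OF y0(1) y0(3) F0 degF eqF] by blast
    let ?s = "(i, lo i + int \<kappa>)"
    have s: "?s \<in> S" using \<kappa> inS by simp
    have "u ?s = \<Lambda> (0, 0) ?s + y0 * t * of_int (hi i - (lo i + int \<kappa>)) - (y0 * t / r) * (r * of_int (int \<kappa>))"
      using Lp'[OF s] Lm'[OF s] by (simp add: u_def)
    also have "\<dots> = \<Lambda> (0, 0) ?s + y0 * t * of_int (int d - 2 * int \<kappa>)"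
    proof -
      have "hi i = lo i + int d" using d by simp
      then show ?thesis
        using y0(2) by (cases "r = 0") (simp_all add: algebra_simps)
    qed
    also have "\<dots> = \<mu>"
      unfolding \<mu> c_def by (simp add: L0 algebra_simps)
    finally show ?thesis
      using s by auto
  qed
  ultimately show ?thesis
    unfolding affine_spectrum_def by blast
qed


text \<open>The roots are \<open>(\<plusminus>1, 0)\<close> and \<open>(0, \<plusminus>1)\<close>, so that the operator is the sum of one \<open>quadratic_op\<close> in \<open>x\<close> and one in
\<open>y\<close>. Applying the functional of \<open>quadratic_op_symbol\<close> to all columns at once leaves a one-variable
problem in \<open>x\<close>.\<close>

lemma affine_spectrum_rectangle:
  fixes \<Lambda> :: "int \<times> int \<Rightarrow> int \<times> int \<Rightarrow> 'k::{alg_closed_field, field_char_0}"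
  assumes D: "toric_derivation S \<Lambda>"
    and S: "S = {0..int w} \<times> {0..int h}" and w: "w \<ge> 1" and h: "h \<ge> 1"
  shows "affine_spectrum S \<Lambda>"
proof -
  have fin: "finite S" and aff: "\<And>\<alpha>. affine_fun (\<Lambda> \<alpha>)"
    and zero: "\<And>\<alpha> s. s \<in> S \<Longrightarrow> s + \<alpha> \<notin> S \<Longrightarrow> \<Lambda> \<alpha> s = 0"
    using D unfolding toric_derivation_def by blast+
  have vanish: "\<Lambda> \<alpha> s = 0"
    if "p \<in> S" "q \<in> S" "r \<in> S" "p + \<alpha> \<notin> S" "q + \<alpha> \<notin> S" "r + \<alpha> \<notin> S" "cross p q r \<noteq> 0" for \<alpha> p q r s
    using affine_fun_eq_0[OF aff zero zero zero] that by blast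
  have roots: "\<alpha> \<in> {(0, 0), (0, 1), (0, -1), (1, 0), (-1, 0)}" if "\<Lambda> \<alpha> s \<noteq> 0" for \<alpha> s
  proof (rule ccontr)
    assume n: "\<alpha> \<notin> {(0, 0), (0, 1), (0, -1), (1, 0), (-1, 0)}"
    obtain a b where ab: "\<alpha> = (a, b)" by (cases \<alpha>)
    have "a \<ge> 2 \<or> a \<le> -2 \<or> b \<ge> 2 \<or> b \<le> -2 \<or> (a = 1 \<or> a = -1) \<and> (b = 1 \<or> b = -1)"
      using n unfolding ab by simp presburger
    then consider "a \<ge> 2" | "a \<le> -2" | "b \<ge> 2" | "b \<le> -2" | "a = 1" "b = 1" | "a = 1" "b = -1"
      | "a = -1" "b = 1" | "a = -1" "b = -1"
      by blast
    then show False
    proof cases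
      case 1
      have "\<Lambda> \<alpha> s = 0"
        by (rule vanish[of "(int w, 0)" "(int w, 1)" "(int w - 1, 0)" \<alpha>]) (use 1 w h in \<open>simp_all add: S ab cross_def\<close>)
      with that show False by simp
    next
      case 2
      have "\<Lambda> \<alpha> s = 0"
        by (rule vanish[of "(0, 0)" "(0, 1)" "(1, 0)" \<alpha>]) (use 2 w h in \<open>simp_all add: S ab cross_def\<close>)
      with that show False by simp
    next
      case 3
      have "\<Lambda> \<alpha> s = 0"
        by (rule vanish[of "(0, int h)" "(1, int h)" "(0, int h - 1)" \<alpha>]) (use 3 w h in \<open>simp_all add: S ab cross_def\<close>)
      with that show False by simp
    next
      case 4
      have "\<Lambda> \<alpha> s = 0"
        by (rule vanish[of "(0, 0)" "(0, 1)" "(1, 0)" \<alpha>]) (use 4 w h in \<open>simp_all add: S ab cross_def\<close>)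
      with that show False by simp
    next
      case 5
      have "\<Lambda> \<alpha> s = 0"
        by (rule vanish[of "(int w, int h)" "(int w - 1, int h)" "(int w, int h - 1)" \<alpha>]) (use 5 w h in \<open>simp_all add: S ab cross_def\<close>)
      with that show False by simp
    next
      case 6
      have "\<Lambda> \<alpha> s = 0"
        by (rule vanish[of "(int w, 0)" "(int w - 1, 0)" "(int w, 1)" \<alpha>]) (use 6 w h in \<open>simp_all add: S ab cross_def\<close>)
      with that show False by simp
    next
      case 7
      have "\<Lambda> \<alpha> s = 0"
        by (rule vanish[of "(0, int h)" "(1, int h)" "(0, int h - 1)" \<alpha>]) (use 7 w h in \<open>simp_all add: S ab cross_def\<close>)
      with that show False by simp
    next
      case 8
      have "\<Lambda> \<alpha> s = 0"
        by (rule vanish[of "(0, 0)" "(1, 0)" "(0, 1)" \<alpha>]) (use 8 w h in \<open>simp_all add: S ab cross_def\<close>)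
      with that show False by simp
    qed
  qed
  obtain a0 a1 a2 where L0: "\<And>x y. \<Lambda> (0, 0) (x, y) = a0 + a1 * of_int x + a2 * of_int y"
    using aff unfolding affine_fun_def by blast
  \<comment> \<open>The coefficient of a root is proportional to the distance from the edge that the root pushes out.\<close>
  have edge: "\<exists>c. \<forall>x y. \<Lambda> \<alpha> (x, y) = c * of_int (A * x + B * y + C)"
    if "p \<in> S" "q \<in> S" "p + \<alpha> \<notin> S" "q + \<alpha> \<notin> S" "A * fst p + B * snd p + C = 0"
      "A * fst q + B * snd q + C = 0" "cross p q r \<noteq> 0" "A * fst r + B * snd r + C = 1" for \<alpha> p q r A B C
  proof -
    define c where "c = \<Lambda> \<alpha> r"
    define g where "g z = \<Lambda> \<alpha> z + (- c) * of_int (A * fst z + B * snd z + C)" for z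
    have "affine_fun (\<lambda>z. of_int (A * fst z + B * snd z + C) :: 'k)"
      unfolding affine_fun_def
      by (rule exI[of _ "of_int C"], rule exI[of _ "of_int A"], rule exI[of _ "of_int B"]) (simp add: algebra_simps)
    then have "affine_fun g"
      unfolding g_def by (rule affine_fun_add[OF aff affine_fun_scale])
    moreover have "g p = 0" "g q = 0"
      using zero[OF that(1,3)] zero[OF that(2,4)] that(5,6) by (simp_all add: g_def)
    moreover have "g r = 0"
      using that(8) by (simp add: g_def c_def)
    ultimately have "g z = 0" for z
      using affine_fun_eq_0 that(7) by blast
    then have "\<Lambda> \<alpha> (x, y) = c * of_int (A * x + B * y + C)" for x y
      using g_def[of "(x, y)"] by simp
    then show ?thesis by blast
  qed
  obtain r where Lm: "\<And>x y. \<Lambda> (0, -1) (x, y) = r * of_int y"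
    using edge[of "(0, 0)" "(1, 0)" "(0, -1)" 0 1 0 "(0, 1)"] w h by (auto simp: S cross_def)
  obtain t where Lp: "\<And>x y. \<Lambda> (0, 1) (x, y) = t * of_int (int h - y)"
    using edge[of "(0, int h)" "(1, int h)" "(0, 1)" 0 "-1" "int h" "(0, int h - 1)"] w h
    by (auto simp: S cross_def)
  obtain r' where Lm': "\<And>x y. \<Lambda> (-1, 0) (x, y) = r' * of_int x"
    using edge[of "(0, 0)" "(0, 1)" "(-1, 0)" 1 0 0 "(1, 0)"] w h by (auto simp: S cross_def)
  obtain t' where Lp': "\<And>x y. \<Lambda> (1, 0) (x, y) = t' * of_int (int w - x)"
    using edge[of "(int w, 0)" "(int w, 1)" "(1, 0)" "-1" 0 "int w" "(int w - 1, 0)"] w h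
    by (auto simp: S cross_def)
  obtain y0 where y0: "t = 0 \<Longrightarrow> y0 = 0" "r = 0 \<Longrightarrow> y0 = 0" "t \<noteq> 0 \<Longrightarrow> r + a2 * y0 - t * y0\<^sup>2 = 0"
    using quadratic_root_exists[of t r a2] by blast
  obtain x0 where x0: "t' = 0 \<Longrightarrow> x0 = 0" "r' = 0 \<Longrightarrow> x0 = 0" "t' \<noteq> 0 \<Longrightarrow> r' + a1 * x0 - t' * x0\<^sup>2 = 0"
    using quadratic_root_exists[of t' r' a1] by blast
  define u where "u s = (a0 + t * of_nat h * y0 + t' * of_nat w * x0)
      + (a1 - 2 * t' * x0) * of_int (fst s) + (a2 - 2 * t * y0) * of_int (snd s)" for s
  have "affine_fun u"
    unfolding affine_fun_def
    by (rule exI[of _ "a0 + t * of_nat h * y0 + t' * of_nat w * x0"],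
        rule exI[of _ "a1 - 2 * t' * x0"], rule exI[of _ "a2 - 2 * t * y0"]) (simp add: u_def)
  moreover have "\<exists>s\<in>S. \<mu> = u s" if "eigenvector S \<Lambda> f \<mu>" for f \<mu>
  proof -
    have f0: "\<And>s. s \<notin> S \<Longrightarrow> f s = 0" and fne: "\<exists>s\<in>S. f s \<noteq> 0"
      and eig: "\<And>s. s \<in> S \<Longrightarrow> \<mu> * f s = (\<Sum>n\<in>S. f n * \<Lambda> (s - n) n)"
      using that unfolding eigenvector_def by blast+
    have rec: "\<mu> * f (x, y) = f (x, y) * (a0 + a1 * of_int x + a2 * of_int y)
        + f (x, y - 1) * (t * of_int (int h - (y - 1))) + f (x, y + 1) * (r * of_int (y + 1))
        + f (x - 1, y) * (t' * of_int (int w - (x - 1))) + f (x + 1, y) * (r' * of_int (x + 1))"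
      if "(x, y) \<in> S" for x y
    proof -
      have "\<mu> * f (x, y) = (\<Sum>\<alpha>\<in>{(0, 0), (0, 1), (0, -1), (1, 0), (-1, 0)}. f ((x, y) - \<alpha>) * \<Lambda> \<alpha> ((x, y) - \<alpha>))"
        unfolding eig[OF that]
      proof (rule eigenvector_sum_roots)
        fix n assume "(x, y) - n \<notin> {(0, 0), (0, 1), (0, - 1), (1, 0), (- 1, 0)}"
        then have "\<Lambda> ((x, y) - n) n = 0"
          using roots by blast
        then show "f n * \<Lambda> ((x, y) - n) n = 0" by simp
      qed (use fin f0 in blast)+
      then show ?thesis
        by (simp add: L0 Lm Lp Lm' Lp')
    qed
    define F where "F i = poly_upto h (\<lambda>k. f (int i, int k))" for i
    have cF: "poly.coeff (F i) k = f (int i, int k)" for i k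
      using f0[of "(int i, int k)"] by (auto simp: F_def coeff_poly_upto S)
    have degF: "degree (F i) \<le> h" for i
      unfolding F_def by (rule degree_poly_upto)
    have edge0: "f (x, -1) = 0" "f (-1, x) = 0" "f (x, int h + 1) = 0" "f (int w + 1, x) = 0" for x
      using f0 by (simp_all add: S)
    have Feq: "smult \<mu> (F i) = quadratic_op r a2 t h a0 (F i) + smult (a1 * of_nat i) (F i)
        + (if i = 0 then 0 else smult (t' * (of_nat w - of_nat (i - 1))) (F (i - 1)))
        + smult (r' * of_nat (Suc i)) (F (Suc i))" (is "_ = ?R") if "i \<le> w" for i
    proof (rule poly_eqI)
      fix k
      show "poly.coeff (smult \<mu> (F i)) k = poly.coeff ?R k"
      proof (cases "k \<le> h")
        case True
        have "(int i, int k) \<in> S" using True that by (simp add: S)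
        from rec[OF this] show ?thesis
          by (cases k; cases i) (simp_all add: coeff_quadratic_op cF edge0 algebra_simps)
      next
        case False
        then have "poly.coeff (F j) k = 0" for j
          by (simp add: F_def coeff_poly_upto)
        then show ?thesis
          using coeff_quadratic_op_above[OF degF, of k] False by simp
      qed
    qed
    have F0: "\<exists>i\<in>{..w}. F i \<noteq> 0"
    proof -
      obtain x y where "(x, y) \<in> S" "f (x, y) \<noteq> 0"
        using fne by auto
      then have "nat x \<in> {..w}" "poly.coeff (F (nat x)) (nat y) \<noteq> 0"
        by (auto simp: S cF)
      then show ?thesis
        by (metis coeff_0)
    qed
    obtain \<kappa> \<Theta> where \<kappa>: "\<kappa> \<le> h"
      and \<Theta>: "\<And>P Q. \<Theta> (P + Q) = \<Theta> P + \<Theta> Q" "\<And>a P. \<Theta> (smult a P) = a * \<Theta> P"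
      and \<Theta>0: "\<exists>i\<in>{..w}. \<Theta> (F i) \<noteq> 0"
      and \<Theta>q: "\<And>i. i \<in> {..w} \<Longrightarrow> \<Theta> (quadratic_op r a2 t h a0 (F i))
        = (a0 + t * of_nat h * y0 + of_nat \<kappa> * (a2 - 2 * t * y0)) * \<Theta> (F i)"
      using quadratic_op_symbol[OF y0(1) y0(3) finite_atMost F0 degF, of a0] by blast
    define \<theta> where "\<theta> = a0 + t * of_nat h * y0 + of_nat \<kappa> * (a2 - 2 * t * y0)"
    have Z: "\<Theta> 0 = 0"
      using \<Theta>(2)[of 0 0] by simp
    have "F (Suc w) = 0"
      by (rule poly_eqI) (use f0 in \<open>simp add: cF S\<close>)
    then have \<Theta>w: "\<Theta> (F (Suc w)) = 0"
      using Z by simp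
    define G where "G = poly_upto w (\<lambda>i. \<Theta> (F i))"
    have cG: "poly.coeff G i = \<Theta> (F i)" if "i \<le> Suc w" for i
      using that \<Theta>w by (cases "i = Suc w") (auto simp: G_def coeff_poly_upto)
    have degG: "degree G \<le> w"
      unfolding G_def by (rule degree_poly_upto)
    have "smult \<mu> G = quadratic_op r' a1 t' w \<theta> G"
    proof (rule poly_eqI)
      fix i
      show "poly.coeff (smult \<mu> G) i = poly.coeff (quadratic_op r' a1 t' w \<theta> G) i"
      proof (cases "i \<le> w")
        case True
        have "\<mu> * \<Theta> (F i) = \<Theta> (smult \<mu> (F i))"
          by (simp add: \<Theta>)
        also have "\<dots> = \<theta> * \<Theta> (F i) + a1 * of_nat i * \<Theta> (F i)
            + (if i = 0 then 0 else t' * (of_nat w - of_nat (i - 1)) * \<Theta> (F (i - 1)))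
            + r' * of_nat (Suc i) * \<Theta> (F (Suc i))"
          unfolding Feq[OF True] \<theta>_def using True by (simp only: \<Theta> \<Theta>q atMost_iff if_distrib[of \<Theta>] Z)
        finally show ?thesis
          using True by (simp add: coeff_quadratic_op cG algebra_simps)
      next
        case False
        then have "poly.coeff G i = 0"
          by (simp add: G_def coeff_poly_upto)
        then show ?thesis
          using coeff_quadratic_op_above[OF degG, of i] False by simp
      qed
    qed
    moreover have "G \<noteq> 0"
      using \<Theta>0 cG by (metis atMost_iff coeff_0 le_SucI)
    ultimately obtain \<kappa>' where \<kappa>': "\<kappa>' \<le> w" "\<mu> = \<theta> + t' * of_nat w * x0 + of_nat \<kappa>' * (a1 - 2 * t' * x0)"
      using quadratic_op_eigenvalue[OF x0(1) x0(3) _ degG] by blast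
    have "\<mu> = u (int \<kappa>', int \<kappa>)"
      by (simp add: \<kappa>'(2) u_def \<theta>_def algebra_simps)
    moreover have "(int \<kappa>', int \<kappa>) \<in> S"
      using \<kappa> \<kappa>' by (simp add: S)
    ultimately show ?thesis by blast
  qed
  ultimately show ?thesis
    unfolding affine_spectrum_def by blast
qed

section \<open>Shapes of lattice sets with roots\<close>

definition simplex_or_spectrum :: "(int \<times> int) set \<Rightarrow> (int \<times> int \<Rightarrow> int \<times> int \<Rightarrow> 'k::field_char_0) \<Rightarrow> bool" where
  "simplex_or_spectrum S \<Lambda> \<longleftrightarrow> simplex_like S \<or> affine_spectrum S \<Lambda>"

lemma simplex_or_spectrum_pull:
  assumes "simplex_or_spectrum (P -` S) (pull P \<Lambda>)" "unimod P"
  shows "simplex_or_spectrum S \<Lambda>"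
  using assms simplex_like_pull affine_spectrum_pull unfolding simplex_or_spectrum_def by blast

text \<open>Every \<open>S\<close> that has a root and does not lie on a line takes this shape in suitable coordinates: the root becomes \<open>(0, -1)\<close>, and the edge
that it crosses becomes the bottom row. The last condition excludes degenerate sets on a line.\<close>

definition under_graph :: "(int \<times> int) set \<Rightarrow> int \<Rightarrow> (int \<Rightarrow> int) \<Rightarrow> bool" where
  "under_graph S q h \<longleftrightarrow> q \<ge> 1 \<and> S = {(i, j). 0 \<le> i \<and> i \<le> q \<and> 0 \<le> j \<and> j \<le> h i} \<and>
     (\<forall>i. 0 \<le> i \<longrightarrow> i \<le> q \<longrightarrow> 0 \<le> h i) \<and> (\<exists>i. 0 \<le> i \<and> i \<le> q \<and> 1 \<le> h i)"

text \<open>The restriction that drives the classification: the points that a root pushes out of \<open>S\<close> are collinear.\<close>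

lemma toric_derivation_eq_0:
  assumes "toric_derivation S \<Lambda>" "p \<in> S" "q \<in> S" "r \<in> S" "p + \<alpha> \<notin> S" "q + \<alpha> \<notin> S" "r + \<alpha> \<notin> S"
    "cross p q r \<noteq> 0"
  shows "\<Lambda> \<alpha> s = 0"
proof -
  have "affine_fun (\<Lambda> \<alpha>)" "\<Lambda> \<alpha> p = 0" "\<Lambda> \<alpha> q = 0" "\<Lambda> \<alpha> r = 0"
    using assms unfolding toric_derivation_def by blast+
  then show ?thesis
    using affine_fun_eq_0 assms(8) by blast
qed

text \<open>A root pointing to the left pushes out the first column together with either the bottom row or all the top points
of the columns. If these are collinear, the first column is a single point and the height grows by exactly
\<open>1\<close> in each step, which gives the standard triangle. Otherwise all roots lie in the right half plane.\<close>

lemma under_graph_increasing: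
  fixes \<Lambda> :: "int \<times> int \<Rightarrow> int \<times> int \<Rightarrow> 'k::{alg_closed_field, field_char_0}"
  assumes D: "toric_derivation S \<Lambda>" and N: "under_graph S q h"
    and inc: "\<And>i. 0 \<le> i \<Longrightarrow> i < q \<Longrightarrow> h i + 1 \<le> h (i + 1)"
  shows "simplex_or_spectrum S \<Lambda>"
proof (cases "\<exists>\<alpha> s. fst \<alpha> < 0 \<and> s \<in> S \<and> \<Lambda> \<alpha> s \<noteq> 0")
  case False
  then have "affine_spectrum S \<Lambda>"
    by (intro affine_spectrum_half_plane[OF D]) blast
  then show ?thesis
    unfolding simplex_or_spectrum_def ..
next
  case True
  then obtain a b s where a: "a < 0" and s: "\<Lambda> (a, b) s \<noteq> 0"
    by auto
  have S: "(i, j) \<in> S \<longleftrightarrow> 0 \<le> i \<and> i \<le> q \<and> 0 \<le> j \<and> j \<le> h i" for i j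
    using N unfolding under_graph_def by auto
  have q: "q \<ge> 1"
    using N unfolding under_graph_def by auto
  have h: "0 \<le> h i" if "0 \<le> i" "i \<le> q" for i
    using N that unfolding under_graph_def by auto
  have mono: "h i < h k" if "0 \<le> i" "i < k" "k \<le> q" for i k
  proof -
    have "i + 1 \<le> k" using that by simp
    then have "k \<le> q \<longrightarrow> h i < h k"
    proof (induction k rule: int_ge_induct)
      case base
      then show ?case using inc[of i] that by simp
    next
      case (step k)
      then show ?case using inc[of k] that by auto
    qed
    then show ?thesis using that by simp
  qed
  have vanish: "False" if "p1 \<in> S" "p2 \<in> S" "p3 \<in> S" "p1 + (a, b) \<notin> S" "p2 + (a, b) \<notin> S" "p3 + (a, b) \<notin> S"
    "cross p1 p2 p3 \<noteq> 0" for p1 p2 p3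
    using toric_derivation_eq_0[OF D that] s by simp
  have "\<forall>i. 0 \<le> i \<longrightarrow> i \<le> q \<longrightarrow> h i = i"
  proof (cases "b \<ge> 0")
    case True
    have top: "(i, h i) + (a, b) \<notin> S" if "0 \<le> i" "i \<le> q" for i
      using mono[of "i + a" i] that a True by (auto simp: S)
    have h1: "h 1 \<ge> 1"
      using inc[of 0] h[of 0] q by simp
    have h0: "h 0 = 0"
    proof (rule ccontr)
      assume "h 0 \<noteq> 0"
      then have h0: "h 0 \<ge> 1" using h[of 0] q by simp
      have "(0, 0) \<in> S" "(0, 1) \<in> S" "(1, h 1) \<in> S" "(0, 0) + (a, b) \<notin> S" "(0, 1) + (a, b) \<notin> S"
        using a q h0 h1 by (simp_all add: S)
      moreover have "cross (0, 0) (0, 1) (1, h 1) \<noteq> 0"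
        by (simp add: cross_def)
      ultimately show False
        using vanish top[of 1] q by (meson zero_le_one)
    qed
    have h11: "h 1 = 1"
    proof (rule ccontr)
      assume "h 1 \<noteq> 1"
      then have h2: "h 1 \<ge> 2" using h1 by simp
      have mid: "(1, h 1 - 1) + (a, b) \<notin> S"
      proof (cases "a = -1")
        case a1: True
        then show ?thesis using h0 h2 True by (simp add: S)
      next
        case False
        then have "1 + a < 0" using a by simp
        then show ?thesis by (simp add: S)
      qed
      have "(0, 0) \<in> S" "(1, h 1) \<in> S" "(1, h 1 - 1) \<in> S" "(0, 0) + (a, b) \<notin> S"
        using a q h0 h2 by (simp_all add: S)
      moreover have "cross (0, 0) (1, h 1) (1, h 1 - 1) \<noteq> 0"
        by (simp add: cross_def)
      moreover have "(1, h 1) + (a, b) \<notin> S"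
        using top[of 1] q by simp
      ultimately show False
        using vanish mid by blast
    qed
    show ?thesis
    proof (intro allI impI, rule ccontr)
      fix i assume i: "0 \<le> i" "i \<le> q" "h i \<noteq> i"
      show False
      proof -
        have "(0, 0) \<in> S" "(1, 1) \<in> S" "(i, h i) \<in> S" "(0, 0) + (a, b) \<notin> S"
          using a q h0 h11 i(1,2) h[of i] by (simp_all add: S)
        moreover have "cross (0, 0) (1, 1) (i, h i) \<noteq> 0"
          using i(3) by (simp add: cross_def)
        moreover have "(1, 1) + (a, b) \<notin> S"
          using top[of 1] q unfolding h11 by simp
        ultimately show False
          using vanish top[OF i(1,2)] by blast
      qed
    qed
  next
    case False
    have stay: "(i + a, j + b) \<in> S" if "(i, j) \<in> S" "j \<ge> 1" for i j
    proof (rule ccontr)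
      assume leave: "(i + a, j + b) \<notin> S"
      have "(0, 0) \<in> S" "(1, 0) \<in> S" "(0, 0) + (a, b) \<notin> S" "(1, 0) + (a, b) \<notin> S"
        using a False q h[of 0] h[of 1] by (simp_all add: S)
      moreover have "cross (0, 0) (1, 0) (i, j) \<noteq> 0"
        using that(2) by (simp add: cross_def)
      moreover have "(i, j) + (a, b) \<notin> S"
        using leave by simp
      ultimately show False
        using vanish that(1) by blast
    qed
    have h0: "h 0 = 0"
    proof (rule ccontr)
      assume "h 0 \<noteq> 0"
      then have "(0, 1) \<in> S" using h[of 0] q by (simp add: S)
      then show False using stay[of 0 1] a by (simp add: S)
    qed
    have h1: "h 1 \<ge> 1"
      using inc[of 0] h0 q by simp
    have ab: "a = -1" "b = -1"
      using stay[of 1 1] h1 q a False by (auto simp: S)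
    \<comment> \<open>The root is \<open>(-1, -1)\<close> and keeps the top point of each column but the first inside \<open>S\<close>.\<close>
    have inc1: "h (i + 1) = h i + 1" if "0 \<le> i" "i < q" for i
    proof -
      have "(i, h (i + 1) - 1) \<in> S"
        using stay[of "i + 1" "h (i + 1)"] that h[of i] inc[of i] ab by (simp add: S)
      then show ?thesis
        using inc[of i] that by (simp add: S)
    qed
    show ?thesis
    proof (intro allI impI)
      fix i assume "0 \<le> i" "i \<le> q"
      then show "h i = i"
      proof (induction i rule: int_ge_induct)
        case (step i)
        then show ?case using inc1[of i] by simp
      qed (use h0 in simp)
    qed
  qed
  then have "S = standard_simplex q"
    by (auto simp: S standard_simplex_def)
  moreover have "unimod id"
    unfolding unimod_def
    by (rule exI[of _ 1], rule exI[of _ 0], rule exI[of _ 0], rule exI[of _ 1], rule exI[of _ 0],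
        rule exI[of _ 0]) auto
  ultimately have "simplex_like S"
    unfolding simplex_like_def using q by (intro exI[of _ id] exI[of _ q]) auto
  then show ?thesis
    unfolding simplex_or_spectrum_def ..
qed

text \<open>The root pushes out the last column and the points of maximal height. The last column must have two
points, for otherwise these points would span a triangle. Then all other columns are mapped into
\<open>S\<close>, which gives the growth of \<open>h\<close> and forces the horizontal component of the root to be \<open>1\<close>.\<close>

lemma under_graph_upright_root:
  assumes D: "toric_derivation S \<Lambda>" and N: "under_graph S q h"
    and \<alpha>: "0 < a" "0 < b" "\<Lambda> (a, b) s \<noteq> 0" and i: "0 \<le> i" "i < q"
  shows "h i + 1 \<le> h (i + 1)"
proof -
  have S: "(i, j) \<in> S \<longleftrightarrow> 0 \<le> i \<and> i \<le> q \<and> 0 \<le> j \<and> j \<le> h i" for i j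
    using N unfolding under_graph_def by auto
  have q: "q \<ge> 1"
    using N unfolding under_graph_def by auto
  have h: "0 \<le> h i" if "0 \<le> i" "i \<le> q" for i
    using N that unfolding under_graph_def by auto
  have vanish: "False" if "p1 \<in> S" "p2 \<in> S" "p3 \<in> S" "p1 + (a, b) \<notin> S" "p2 + (a, b) \<notin> S" "p3 + (a, b) \<notin> S"
    "cross p1 p2 p3 \<noteq> 0" for p1 p2 p3
    using toric_derivation_eq_0[OF D that] \<alpha>(3) by simp
  have hq: "h q \<ge> 1"
  proof (rule ccontr)
    assume "\<not> h q \<ge> 1"
    then have hq: "h q = 0" using h[of q] q by simp
    define m where "m = Max (h ` {0..q})"
    have fin: "finite (h ` {0..q})" "h ` {0..q} \<noteq> {}"
      using q by auto
    have "m \<in> h ` {0..q}"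
      unfolding m_def by (rule Max_in[OF fin])
    then obtain k where k: "0 \<le> k" "k \<le> q" "h k = m" by auto
    have max: "h i \<le> m" if "0 \<le> i" "i \<le> q" for i
      unfolding m_def using that by (intro Max_ge[OF fin(1)]) auto
    have m: "m \<ge> 1"
      using N max unfolding under_graph_def by force
    have 1: "(k, h k) + (a, b) \<notin> S"
      using max[of "k + a"] k \<alpha> by (auto simp: S)
    have 2: "(q, 0) + (a, b) \<notin> S"
      using \<alpha> by (simp add: S)
    have 3: "(q - 1, 0) + (a, b) \<notin> S"
      using \<alpha> hq by (cases "a = 1") (simp_all add: S)
    show False
    proof -
      have "(q, 0) \<in> S" "(q - 1, 0) \<in> S" "(k, h k) \<in> S"
        using k q h[of q] h[of "q - 1"] h[of k] by (simp_all add: S)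
      moreover have "cross (q, 0) (q - 1, 0) (k, h k) \<noteq> 0"
        using m k(3) by (simp add: cross_def)
      ultimately show False
        using vanish 1 2 3 by blast
    qed
  qed
  have stay: "(i + a, j + b) \<in> S" if "(i, j) \<in> S" "i < q" for i j
  proof (rule ccontr)
    assume leave: "(i + a, j + b) \<notin> S"
    have out: "(q, 0) + (a, b) \<notin> S" "(q, 1) + (a, b) \<notin> S"
      using \<alpha> by (simp_all add: S)
    show False
    proof -
      have "(q, 0) \<in> S" "(q, 1) \<in> S" "(i, j) + (a, b) \<notin> S"
        using hq q leave by (simp_all add: S)
      moreover have "cross (q, 0) (q, 1) (i, j) \<noteq> 0"
        using that(2) by (simp add: cross_def)
      ultimately show False
        using vanish out that(1) by blast
    qed
  qed
  have "a = 1"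
    using stay[of "q - 1" 0] q h[of "q - 1"] \<alpha> by (simp add: S)
  then show ?thesis
    using stay[of i "h i"] i h[of i] \<alpha> by (simp add: S)
qed

text \<open>The root pushes out the top points of all columns.\<close>

lemma under_graph_vertical_root:
  assumes D: "toric_derivation S \<Lambda>" and N: "under_graph S q h"
    and b: "0 < b" and s: "s \<in> S" "\<Lambda> (0, b) s \<noteq> 0" and i: "0 \<le> i" "i \<le> q"
  shows "h i = h 0 + (h 1 - h 0) * i"
proof -
  have S: "(i, j) \<in> S \<longleftrightarrow> 0 \<le> i \<and> i \<le> q \<and> 0 \<le> j \<and> j \<le> h i" for i j
    using N unfolding under_graph_def by auto
  have q: "q \<ge> 1"
    using N unfolding under_graph_def by auto
  have h: "0 \<le> h i" if "0 \<le> i" "i \<le> q" for i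
    using N that unfolding under_graph_def by auto
  have "(k, h k) \<in> S" "(k, h k) + (0, b) \<notin> S" if "0 \<le> k" "k \<le> q" for k
    using that h[of k] b by (simp_all add: S)
  note top = this
  have "cross (0, h 0) (1, h 1) (i, h i) = 0"
  proof (rule ccontr)
    assume nz: "cross (0, h 0) (1, h 1) (i, h i) \<noteq> 0"
    have "0 \<le> q" "1 \<le> q"
      using q by simp_all
    note out = top(1)[OF order_refl this(1)] top(1)[OF zero_le_one this(2)] top(1)[OF i]
      top(2)[OF order_refl this(1)] top(2)[OF zero_le_one this(2)] top(2)[OF i]
    have "\<Lambda> (0, b) s = 0"
      by (rule toric_derivation_eq_0[OF D out nz])
    then show False
      using s(2) by simp
  qed
  then show ?thesis
    by (simp add: cross_def)
qed

lemma unimod_reflection: "unimod (\<lambda>(x, y). (q - x, y))"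
  unfolding unimod_def
  by (rule exI[of _ "-1"], rule exI[of _ 0], rule exI[of _ 0], rule exI[of _ 1], rule exI[of _ q],
      rule exI[of _ 0]) auto

lemma unimod_rotation: "unimod (\<lambda>(x, y). (y, - x))"
  unfolding unimod_def
  by (rule exI[of _ 0], rule exI[of _ 1], rule exI[of _ "-1"], rule exI[of _ 0], rule exI[of _ 0],
      rule exI[of _ 0]) auto

lemma under_graph_reflection:
  assumes "under_graph S q h"
  shows "under_graph ((\<lambda>(x, y). (q - x, y)) -` S) q (\<lambda>i. h (q - i))"
proof -
  have S: "S = {(i, j). 0 \<le> i \<and> i \<le> q \<and> 0 \<le> j \<and> j \<le> h i}" and q: "q \<ge> 1"
    and h: "\<And>i. 0 \<le> i \<Longrightarrow> i \<le> q \<Longrightarrow> 0 \<le> h i"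
    using assms unfolding under_graph_def by blast+
  obtain i where i: "0 \<le> i" "i \<le> q" "1 \<le> h i"
    using assms unfolding under_graph_def by blast
  have "(\<lambda>(x, y). (q - x, y)) -` S = {(i, j). 0 \<le> i \<and> i \<le> q \<and> 0 \<le> j \<and> j \<le> h (q - i)}"
    unfolding S by auto
  moreover have "\<exists>i. 0 \<le> i \<and> i \<le> q \<and> 1 \<le> h (q - i)"
    by (rule exI[of _ "q - i"]) (use i in simp)
  ultimately show ?thesis
    unfolding under_graph_def using q h by simp
qed

lemma under_graph_decreasing:
  fixes \<Lambda> :: "int \<times> int \<Rightarrow> int \<times> int \<Rightarrow> 'k::{alg_closed_field, field_char_0}"
  assumes D: "toric_derivation S \<Lambda>" and N: "under_graph S q h"
    and dec: "\<And>i. 0 \<le> i \<Longrightarrow> i < q \<Longrightarrow> h (i + 1) + 1 \<le> h i"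
  shows "simplex_or_spectrum S \<Lambda>"
proof (rule simplex_or_spectrum_pull[OF under_graph_increasing unimod_reflection])
  show "toric_derivation ((\<lambda>(x, y). (q - x, y)) -` S) (pull (\<lambda>(x, y). (q - x, y)) \<Lambda>)"
    by (rule toric_derivation_pull[OF D unimod_reflection])
  show "under_graph ((\<lambda>(x, y). (q - x, y)) -` S) q (\<lambda>i. h (q - i))"
    by (rule under_graph_reflection[OF N])
  fix i assume "0 \<le> i" "i < q"
  then show "h (q - i) + 1 \<le> h (q - (i + 1))"
    using dec[of "q - (i + 1)"] by (simp add: algebra_simps)
qed

text \<open>If no root points upwards, the roots lie in a half plane. Roots pointing up and to a side make \<open>h\<close> strictly monotone, and
vertical ones make it affine; the only remaining possibility is a constant \<open>h\<close>, that is, a rectangle.\<close>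

lemma under_graph_simplex_or_spectrum:
  fixes \<Lambda> :: "int \<times> int \<Rightarrow> int \<times> int \<Rightarrow> 'k::{alg_closed_field, field_char_0}"
  assumes D: "toric_derivation S \<Lambda>" and N: "under_graph S q h"
  shows "simplex_or_spectrum S \<Lambda>"
proof -
  have S: "S = {(i, j). 0 \<le> i \<and> i \<le> q \<and> 0 \<le> j \<and> j \<le> h i}"
    and q: "q \<ge> 1"
    using N unfolding under_graph_def by blast+
  show ?thesis
  proof (cases "\<exists>a b s. s \<in> S \<and> \<Lambda> (a, b) s \<noteq> 0 \<and> b > 0")
    case False
    then have down: "\<Lambda> (a, b) s = 0" if "s \<in> S" "b > 0" for a b s
      using that by metis
    let ?P = "\<lambda>(x, y). (y, - x) :: int \<times> int"
    have "affine_spectrum (?P -` S) (pull ?P \<Lambda>)"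
    proof (rule affine_spectrum_half_plane)
      show "toric_derivation (?P -` S) (pull ?P \<Lambda>)"
        by (rule toric_derivation_pull[OF D unimod_rotation])
      fix \<alpha> s :: "int \<times> int" assume "fst \<alpha> < 0" "s \<in> ?P -` S"
      then have "\<Lambda> (snd \<alpha>, - fst \<alpha>) (?P s) = 0"
        by (intro down) auto
      moreover have "?P \<alpha> - ?P 0 = (snd \<alpha>, - fst \<alpha>)"
        by (simp add: case_prod_unfold)
      ultimately show "pull ?P \<Lambda> \<alpha> s = 0"
        unfolding pull_def by simp
    qed
    then have "affine_spectrum S \<Lambda>"
      by (rule affine_spectrum_pull[OF _ unimod_rotation])
    then show ?thesis
      unfolding simplex_or_spectrum_def ..
  next
    case True
    then obtain a b s where up: "s \<in> S" "\<Lambda> (a, b) s \<noteq> 0" "b > 0"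
      by blast
    consider "a > 0" | "a < 0" | "a = 0" by linarith
    then show ?thesis
    proof cases
      case 1
      show ?thesis
        by (rule under_graph_increasing[OF D N under_graph_upright_root[OF D N 1 up(3,2)]])
    next
      case 2
      let ?P = "\<lambda>(x, y). (q - x, y) :: int \<times> int"
      have D': "toric_derivation (?P -` S) (pull ?P \<Lambda>)"
        by (rule toric_derivation_pull[OF D unimod_reflection])
      have "?P (- a, b) - ?P 0 = (a, b)" "?P (?P s) = s"
        by (simp_all add: case_prod_unfold)
      then have root: "pull ?P \<Lambda> (- a, b) (?P s) \<noteq> 0"
        using up(2) unfolding pull_def by simp
      have "- a > 0" using 2 by simp
      then have "simplex_or_spectrum (?P -` S) (pull ?P \<Lambda>)"
        by (rule under_graph_increasing[OF D' under_graph_reflection[OF N]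
              under_graph_upright_root[OF D' under_graph_reflection[OF N] _ up(3) root]])
      then show ?thesis
        by (rule simplex_or_spectrum_pull[OF _ unimod_reflection])
    next
      case 3
      have h: "h i = h 0 + (h 1 - h 0) * i" if "0 \<le> i" "i \<le> q" for i
        using under_graph_vertical_root[OF D N up(3,1)] up(2) 3 that by blast
      consider "h 1 > h 0" | "h 1 < h 0" | "h 1 = h 0" by linarith
      then show ?thesis
      proof cases
        case 1
        show ?thesis
        proof (rule under_graph_increasing[OF D N])
          fix i assume "0 \<le> i" "i < q"
          then show "h i + 1 \<le> h (i + 1)"
            using h[of i] h[of "i + 1"] 1 by (simp add: algebra_simps)
        qed
      next
        case 2
        show ?thesis
        proof (rule under_graph_decreasing[OF D N])
          fix i assume "0 \<le> i" "i < q"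
          then show "h (i + 1) + 1 \<le> h i"
            using h[of i] h[of "i + 1"] 2 by (simp add: algebra_simps)
        qed
      next
        case eq: 3
        have h0: "h i = h 0" if "0 \<le> i" "i \<le> q" for i
          using h[OF that] eq by simp
        obtain k where "0 \<le> k" "k \<le> q" "1 \<le> h k"
          using N unfolding under_graph_def by blast
        then have "h 0 \<ge> 1"
          using h0[of k] by simp
        moreover have "S = {0..int (nat q)} \<times> {0..int (nat (h 0))}"
        proof -
          have "(i, j) \<in> S \<longleftrightarrow> (i, j) \<in> {0..q} \<times> {0..h 0}" for i j
            unfolding S using h0[of i] by auto
          then show ?thesis
            using q calculation by (simp add: set_eq_iff)
        qed
        moreover have "nat q \<ge> 1" "nat (h 0) \<ge> 1"
          using q calculation(1) by simp_all
        ultimately have "affine_spectrum S \<Lambda>"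
          using affine_spectrum_rectangle[OF D] by blast
        then show ?thesis
          unfolding simplex_or_spectrum_def ..
      qed
    qed
  qed
qed

text \<open>The root \<open>(0, -1)\<close> pushes out the lowest point of each column, so these points lie on a line. The slope of the line is
integral because two neighbouring columns are nonempty, and a shear makes it horizontal.\<close>

lemma simplex_or_spectrum_of_downward_root:
  fixes \<Lambda> :: "int \<times> int \<Rightarrow> int \<times> int \<Rightarrow> 'k::{alg_closed_field, field_char_0}"
  assumes D: "toric_derivation S \<Lambda>" and root: "(i0, j0) \<in> S" "\<Lambda> (0, -1) (i0, j0) \<noteq> 0"
    and nc: "p \<in> S" "q \<in> S" "r \<in> S" "cross p q r \<noteq> 0"
  shows "simplex_or_spectrum S \<Lambda>"
proof -
  have fin: "finite S" and conv: "lattice_convex S"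
    and zero: "\<And>\<alpha> s. s \<in> S \<Longrightarrow> s + \<alpha> \<notin> S \<Longrightarrow> \<Lambda> \<alpha> s = 0"
    using D unfolding toric_derivation_def by blast+
  obtain c0 c1 c where L: "\<And>x y. \<Lambda> (0, -1) (x, y) = c0 + c1 * of_int x + c * of_int y"
    using D unfolding toric_derivation_def affine_fun_def by blast
  define lo where "lo i = Min {y. (i, y) \<in> S}" for i
  have finJ: "finite {y. (i, y) \<in> S}" for i
    using finite_vimageI[OF fin, of "\<lambda>y. (i, y)"] by (simp add: inj_on_def vimage_def)
  have lo: "(i, lo i) \<in> S" "lo i \<le> j" if "(i, j) \<in> S" for i j
    using Min_in[OF finJ, of i] Min_le[OF finJ, of j i] that unfolding lo_def by auto
  have L_lo: "c0 + c1 * of_int i + c * of_int (lo i) = 0" if "(i, j) \<in> S" for i j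
  proof -
    have "(i, lo i - 1) \<notin> S"
      using lo(2)[of i "lo i - 1"] by auto
    then show ?thesis
      using zero[OF lo(1)[OF that], of "(0, -1)"] L by simp
  qed
  have "\<Lambda> (0, -1) (i0, j0) = c * of_int (j0 - lo i0)"
    using L_lo[OF root(1)] by (simp add: L algebra_simps add_eq_0_iff)
  then have c: "c \<noteq> 0" and "j0 \<noteq> lo i0"
    using root(2) by auto
  then have s1: "(i0, lo i0) \<in> S" "(i0, lo i0 + 1) \<in> S"
    using lo[OF root(1)] lattice_convex_column[OF conv lo(1)[OF root(1)] root(1), of "lo i0 + 1"] by auto
  have "\<exists>z\<in>{p, q, r}. fst z \<noteq> i0"
    using nc(4) unfolding cross_def by auto
  then obtain i' j' where i': "(i', j') \<in> S" "i' \<noteq> i0"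
    using nc(1-3) by (metis insertE prod.collapse singletonD)
  \<comment> \<open>The column next to a column with two points has a lattice point: the triangle over the two
    points meets it in a segment that contains \<open>D\<close> consecutive multiples of \<open>1 / D\<close>.\<close>
  define D where "D = \<bar>i' - i0\<bar>"
  define \<epsilon> where "\<epsilon> = sgn (i' - i0)"
  have D1: "D \<ge> 1" and D\<epsilon>: "D * \<epsilon> = i' - i0" and \<epsilon>: "\<epsilon> * \<epsilon> = 1"
    using i'(2) unfolding D_def \<epsilon>_def by (auto simp: sgn_if)
  define y where "y = (lo i0 - lo i') mod D"
  have y: "0 \<le> y" "y \<le> D - 1"
    using D1 unfolding y_def by auto
  have "D dvd (lo i0 - lo i') - y"
    unfolding y_def by (simp add: dvd_minus_mod)
  then obtain e where e: "lo i0 - lo i' - y = D * e" by blast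
  have "(i0 + \<epsilon>, lo i0 - e) \<in> S"
  proof (rule lattice_convexD[OF conv s1 lo(1)[OF i'(1)], of "D - 1 - y" y 1])
    have "(D - 1 - y + y + 1) * (i0 + \<epsilon>) = D * i0 + D * \<epsilon>"
      by (simp add: algebra_simps)
    then show "(D - 1 - y + y + 1) * fst (i0 + \<epsilon>, lo i0 - e)
        = (D - 1 - y) * fst (i0, lo i0) + y * fst (i0, lo i0 + 1) + 1 * fst (i', lo i')"
      unfolding D\<epsilon> by (simp add: algebra_simps)
    show "(D - 1 - y + y + 1) * snd (i0 + \<epsilon>, lo i0 - e)
        = (D - 1 - y) * snd (i0, lo i0) + y * snd (i0, lo i0 + 1) + 1 * snd (i', lo i')"
      using e by (simp add: algebra_simps)
  qed (use y D1 in auto)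
  note L_next = L_lo[OF this]
  define m where "m = (lo (i0 + \<epsilon>) - lo i0) * \<epsilon>"
  have "c1 * of_int \<epsilon> = - (c * of_int (lo (i0 + \<epsilon>) - lo i0))"
  proof -
    have "c1 * of_int \<epsilon> + c * of_int (lo (i0 + \<epsilon>) - lo i0) = (c0 + c1 * of_int (i0 + \<epsilon>)
        + c * of_int (lo (i0 + \<epsilon>))) - (c0 + c1 * of_int i0 + c * of_int (lo i0))"
      by (simp add: algebra_simps)
    then show ?thesis
      unfolding L_next L_lo[OF root(1)] by (simp add: eq_neg_iff_add_eq_0)
  qed
  then have "c1 * of_int (\<epsilon> * \<epsilon>) = - (c * of_int m)"
    unfolding m_def of_int_mult by (simp add: mult.assoc[symmetric])
  then have c1: "c1 = - (c * of_int m)"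
    unfolding \<epsilon> by simp
  have lo_affine: "lo i - m * i = lo i0 - m * i0" if "(i, j) \<in> S" for i j
  proof -
    have "c0 + c * of_int (lo i - m * i) = 0" "c0 + c * of_int (lo i0 - m * i0) = 0"
      using L_lo[OF that] L_lo[OF root(1)] unfolding c1 by (simp_all add: algebra_simps)
    then have "c * of_int (lo i - m * i) = c * of_int (lo i0 - m * i0)"
      by (metis add_left_cancel)
    then have "(of_int (lo i - m * i) :: 'k) = of_int (lo i0 - m * i0)"
      using c mult_left_cancel by blast
    then show ?thesis
      unfolding of_int_eq_iff .
  qed
  define k where "k = lo i0 - m * i0"
  define a where "a = Min (fst ` S)"
  define b where "b = Max (fst ` S)"
  define P where "P = (\<lambda>(x, y). (x + a, m * x + y + (m * a + k)))"
  have P: "unimod P"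
    unfolding unimod_def P_def
    by (rule exI[of _ 1], rule exI[of _ 0], rule exI[of _ m], rule exI[of _ 1], rule exI[of _ a],
        rule exI[of _ "m * a + k"]) auto
  let ?S = "P -` S"
  have D': "toric_derivation ?S (pull P \<Lambda>)"
    by (rule toric_derivation_pull[OF D P])
  then have fin': "finite ?S" and conv': "lattice_convex ?S"
    unfolding toric_derivation_def by blast+
  have mem: "(x, y) \<in> ?S \<longleftrightarrow> (x + a, m * (x + a) + k + y) \<in> S" for x y
    by (simp add: P_def algebra_simps)
  have bottom: "lo i = m * i + k" if "(i, j) \<in> S" for i j
    using lo_affine[OF that] unfolding k_def by simp
  have finX: "finite (fst ` S)" "fst ` S \<noteq> {}"
    using fin root(1) by auto
  have "a \<in> fst ` S" "b \<in> fst ` S"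
    unfolding a_def b_def using finX by auto
  then obtain ja jb where ja: "(a, ja) \<in> S" and jb: "(b, jb) \<in> S" by auto
  have ab: "a \<le> i" "i \<le> b" if "(i, j) \<in> S" for i j
  proof -
    have "i \<in> fst ` S" using that by force
    then show "a \<le> i" "i \<le> b"
      unfolding a_def b_def using finX by auto
  qed
  have corners: "(0, 0) \<in> ?S" "(b - a, 0) \<in> ?S"
    using lo(1)[OF ja] lo(1)[OF jb] unfolding mem bottom[OF ja] bottom[OF jb] by simp_all
  have row: "(x, 0) \<in> ?S" if "0 \<le> x" "x \<le> b - a" for x
    by (rule lattice_convex_row[OF conv' corners that])
  define h where "h x = Max {y. (x, y) \<in> ?S}" for x
  have finC: "finite {y. (x, y) \<in> ?S}" for x
    using finite_vimageI[OF fin', of "\<lambda>y. (x, y)"] by (simp add: inj_on_def vimage_def)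
  have h: "(x, h x) \<in> ?S" "y \<le> h x" if "(x, y) \<in> ?S" for x y
    using Max_in[OF finC, of x] Max_ge[OF finC, of y x] that unfolding h_def by auto
  have S': "(x, y) \<in> ?S \<longleftrightarrow> 0 \<le> x \<and> x \<le> b - a \<and> 0 \<le> y \<and> y \<le> h x" for x y
  proof
    assume xy: "(x, y) \<in> ?S"
    then have "(x + a, m * (x + a) + k + y) \<in> S"
      unfolding mem .
    then have "a \<le> x + a" "x + a \<le> b" "m * (x + a) + k \<le> m * (x + a) + k + y"
      using ab lo(2) bottom by metis+
    then show "0 \<le> x \<and> x \<le> b - a \<and> 0 \<le> y \<and> y \<le> h x"
      using h(2)[OF xy] by simp
  next
    assume xy: "0 \<le> x \<and> x \<le> b - a \<and> 0 \<le> y \<and> y \<le> h x"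
    then have "(x, 0) \<in> ?S"
      using row by blast
    then show "(x, y) \<in> ?S"
      using lattice_convex_column[OF conv' _ h(1), of x 0 0 y] xy by blast
  qed
  have "under_graph ?S (b - a) h"
    unfolding under_graph_def
  proof (intro conjI allI impI)
    show "1 \<le> b - a"
      using ab[OF root(1)] ab[OF i'(1)] i'(2) by linarith
    show "?S = {(i, j). 0 \<le> i \<and> i \<le> b - a \<and> 0 \<le> j \<and> j \<le> h i}"
      using S' by (simp add: set_eq_iff)
    fix i assume "0 \<le> i" "i \<le> b - a"
    then show "0 \<le> h i"
      by (rule h(2)[OF row])
  next
    have "(i0 - a, 1) \<in> ?S"
      unfolding mem using s1(2) bottom[OF root(1)] by (simp add: algebra_simps)
    then have "0 \<le> i0 - a \<and> i0 - a \<le> b - a \<and> 1 \<le> h (i0 - a)"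
      unfolding S' by blast
    then show "\<exists>i\<ge>0. i \<le> b - a \<and> 1 \<le> h i"
      by blast
  qed
  then have "simplex_or_spectrum ?S (pull P \<Lambda>)"
    by (rule under_graph_simplex_or_spectrum[OF D'])
  then show ?thesis
    by (rule simplex_or_spectrum_pull[OF _ P])
qed

text \<open>A root is a positive multiple of a primitive vector, which becomes \<open>(0, -1)\<close> in suitable
coordinates; the multiple is \<open>1\<close> by \<open>toric_derivation_vertical_root\<close>.\<close>

lemma toric_derivation_simplex_or_spectrum:
  fixes \<Lambda> :: "int \<times> int \<Rightarrow> int \<times> int \<Rightarrow> 'k::{alg_closed_field, field_char_0}"
  assumes D: "toric_derivation S \<Lambda>"
    and nc: "p \<in> S" "q \<in> S" "r \<in> S" "cross p q r \<noteq> 0"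
  shows "simplex_or_spectrum S \<Lambda>"
proof (cases "\<exists>a b s. (a, b) \<noteq> (0, 0) \<and> s \<in> S \<and> \<Lambda> (a, b) s \<noteq> 0")
  case False
  have "affine_spectrum S \<Lambda>"
  proof (rule affine_spectrum_half_plane[OF D])
    fix \<alpha> s :: "int \<times> int" assume *: "fst \<alpha> < 0" "s \<in> S"
    obtain a b where ab: "\<alpha> = (a, b)" by (cases \<alpha>)
    then have "(a, b) \<noteq> (0, 0)" using * by auto
    then show "\<Lambda> \<alpha> s = 0"
      using False *(2) unfolding ab by blast
  qed
  then show ?thesis
    unfolding simplex_or_spectrum_def ..
next
  case True
  then obtain a b s where ab: "(a, b) \<noteq> (0, 0)" and s: "s \<in> S" "\<Lambda> (a, b) s \<noteq> 0"
    by blast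
  define g where "g = gcd a b"
  have g: "g > 0"
    using ab unfolding g_def by auto
  obtain a' b' where a': "a = a' * g" and b': "b = b' * g" and "coprime a' b'"
    using gcd_coprime_exists[of a b] g unfolding g_def by auto
  then obtain u v where uv: "u * a' + v * b' = 1"
    using bezout_int[of a' b'] by auto
  \<comment> \<open>The linear part sends \<open>(0, -1)\<close> to the primitive vector \<open>(a', b')\<close>.\<close>
  define P where "P = (\<lambda>(x, y). (- v * x + - a' * y + 0, u * x + - b' * y + 0))"
  have P: "unimod P"
    unfolding unimod_def P_def
    by (rule exI[of _ "- v"], rule exI[of _ "- a'"], rule exI[of _ u], rule exI[of _ "- b'"],
        rule exI[of _ 0], rule exI[of _ 0]) (use uv in \<open>simp add: algebra_simps\<close>)
  obtain Q where Q: "unimod Q" "\<And>z. P (Q z) = z" "\<And>z. Q (P z) = z"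
    using unimod_inverse[OF P] by blast
  let ?S = "P -` S"
  have D': "toric_derivation ?S (pull P \<Lambda>)"
    by (rule toric_derivation_pull[OF D P])
  have "P (0, - g) - P 0 = (a, b)"
    unfolding P_def a' b' by (simp add: zero_prod_def)
  then have root: "Q s \<in> ?S" "pull P \<Lambda> (0, - g) (Q s) \<noteq> 0"
    using s Q(2) unfolding pull_def by simp_all
  have "\<bar>- g\<bar> \<le> 1"
    by (rule toric_derivation_vertical_root[OF D' root])
  then have "g = 1" using g by simp
  moreover obtain i j where "Q s = (i, j)" by (cases "Q s")
  ultimately have root': "(i, j) \<in> ?S" "pull P \<Lambda> (0, -1) (i, j) \<noteq> 0"
    using root by simp_all
  have "\<bar>cross (Q p) (Q q) (Q r)\<bar> = \<bar>cross p q r\<bar>"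
    by (rule cross_unimod[OF Q(1)])
  then have "cross (Q p) (Q q) (Q r) \<noteq> 0"
    using nc(4) by auto
  moreover have "Q p \<in> ?S" "Q q \<in> ?S" "Q r \<in> ?S"
    using nc(1-3) Q(2) by simp_all
  ultimately have "simplex_or_spectrum ?S (pull P \<Lambda>)"
    using simplex_or_spectrum_of_downward_root[OF D' root'] by blast
  then show ?thesis
    by (rule simplex_or_spectrum_pull[OF _ P])
qed

section \<open>Differentiating the binomial equations\<close>

text \<open>The binomial equations of the affine cone over the toric surface, one for each affine relation with integral coefficients between the
exponents.\<close>

definition satisfies_binomials :: "('n::finite \<Rightarrow> int \<times> int) \<Rightarrow> 'k::comm_ring_1 ^ 'n \<Rightarrow> bool" where
  "satisfies_binomials e v \<longleftrightarrow> (\<forall>a b :: 'n \<Rightarrow> nat. sum a UNIV = sum b UNIV \<longrightarrow>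
     (\<Sum>i\<in>UNIV. int (a i) * fst (e i)) = (\<Sum>i\<in>UNIV. int (b i) * fst (e i)) \<longrightarrow>
     (\<Sum>i\<in>UNIV. int (a i) * snd (e i)) = (\<Sum>i\<in>UNIV. int (b i) * snd (e i)) \<longrightarrow>
     (\<Prod>i\<in>UNIV. v $ i ^ a i) = (\<Prod>i\<in>UNIV. v $ i ^ b i))"

definition monomials :: "('n::finite \<Rightarrow> int \<times> int) \<Rightarrow> 'k::field \<Rightarrow> 'k \<Rightarrow> 'k ^ 'n" where
  "monomials e x y = (\<chi> i. x powi fst (e i) * y powi snd (e i))"

lemma poly_eq_0_punctured:
  fixes p :: "'k::field_char_0 poly"
  assumes "\<And>t. t \<noteq> 0 \<Longrightarrow> poly p t = 0"
  shows "p = 0"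
proof (rule ccontr)
  assume "p \<noteq> 0"
  then have "finite {t. poly p t = 0}"
    by (rule poly_roots_finite)
  moreover have "- {0} \<subseteq> {t. poly p t = 0}"
    using assms by auto
  ultimately have "finite (- {0 :: 'k})"
    by (rule rev_finite_subset)
  then have "finite (UNIV :: 'k set)"
    by (metis finite_compl finite.emptyI finite_insert)
  then show False
    using infinite_UNIV_char_0 by blast
qed

text \<open>Substituting \<open>(t, t\<^sup>K)\<close> with a large \<open>K\<close> sends distinct exponents to distinct powers of \<open>t\<close>, so that
the claim follows from the fact that a nonzero polynomial has finitely many roots.\<close>

lemma laurent_monomials_independent:
  fixes c :: "'i \<Rightarrow> 'k::field_char_0" and u :: "'i \<Rightarrow> int \<times> int"
  assumes fin: "finite I"
    and zero: "\<And>x y. x \<noteq> 0 \<Longrightarrow> y \<noteq> 0 \<Longrightarrow> (\<Sum>i\<in>I. c i * (x powi fst (u i) * y powi snd (u i))) = 0"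
  shows "(\<Sum>i | i \<in> I \<and> u i = w. c i) = 0"
proof (cases "\<exists>i0\<in>I. u i0 = w")
  case False
  then have *: "{i. i \<in> I \<and> u i = w} = {}" by blast
  show ?thesis unfolding * by simp
next
  case True
  then obtain i0 where i0: "i0 \<in> I" "u i0 = w" by blast
  define B where "B = Max ((\<lambda>i. max \<bar>fst (u i)\<bar> \<bar>snd (u i)\<bar>) ` I)"
  have B: "max \<bar>fst (u i)\<bar> \<bar>snd (u i)\<bar> \<le> B" if "i \<in> I" for i
    unfolding B_def using fin that by (intro Max_ge) auto
  have B': "\<bar>fst (u i)\<bar> \<le> B" "\<bar>snd (u i)\<bar> \<le> B" if "i \<in> I" for i
    using B[OF that] by auto
  have B0: "B \<ge> 0"
    using B'(1)[OF i0(1)] by linarith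
  define K where "K = 2 * B + 1"
  define N where "N i = (fst (u i) + B) + K * (snd (u i) + B)" for i
  have N0: "N i \<ge> 0" if "i \<in> I" for i
  proof -
    have "0 \<le> fst (u i) + B" "0 \<le> snd (u i) + B"
      using B'[OF that] by linarith+
    then show ?thesis
      unfolding N_def K_def using B0 by simp
  qed
  \<comment> \<open>The shift by \<open>B\<close> in both coordinates makes all exponents nonnegative.\<close>
  define p where "p = (\<Sum>i\<in>I. monom (c i) (nat (N i)))"
  have "p = 0"
  proof (rule poly_eq_0_punctured)
    fix t :: 'k assume t: "t \<noteq> 0"
    have "c i * t ^ nat (N i) = t powi (B + K * B) * (c i * (t powi fst (u i) * (t powi K) powi snd (u i)))"
      if "i \<in> I" for i
    proof -
      have "N i = (B + K * B) + (fst (u i) + K * snd (u i))"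
        by (simp add: N_def algebra_simps)
      then have "t powi N i = t powi (B + K * B) * (t powi fst (u i) * (t powi K) powi snd (u i))"
        using t by (simp add: power_int_add power_int_mult)
      moreover have "t ^ nat (N i) = t powi N i"
        using N0[OF that] by (simp add: power_int_def)
      ultimately show ?thesis by simp
    qed
    then have "poly p t = (\<Sum>i\<in>I. t powi (B + K * B) * (c i * (t powi fst (u i) * (t powi K) powi snd (u i))))"
      unfolding p_def poly_sum poly_monom by (rule sum.cong[OF refl])
    also have "\<dots> = 0"
      using zero[of t "t powi K"] t by (simp add: sum_distrib_left[symmetric])
    finally show "poly p t = 0" .
  qed
  then have "poly.coeff p (nat (N i0)) = 0"
    by simp
  moreover have "poly.coeff p (nat (N i0)) = (\<Sum>i\<in>I. if u i = w then c i else 0)"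
    unfolding p_def coeff_sum
  proof (rule sum.cong[OF refl])
    fix i assume i: "i \<in> I"
    have "nat (N i) = nat (N i0) \<longleftrightarrow> u i = w"
    proof
      assume "nat (N i) = nat (N i0)"
      then have "N i = N i0"
        using N0[OF i] N0[OF i0(1)] by simp
      then have eq: "fst (u i) - fst w = K * (snd w - snd (u i))"
        unfolding N_def i0(2) by (simp add: algebra_simps)
      have "\<bar>fst (u i) - fst w\<bar> < K"
        using B'(1)[OF i] B'(1)[OF i0(1)] unfolding i0(2) K_def by linarith
      then have "K * \<bar>snd w - snd (u i)\<bar> < K * 1"
        unfolding eq abs_mult using B0 unfolding K_def by simp
      then have "\<bar>snd w - snd (u i)\<bar> < 1"
        by (rule mult_left_less_imp_less) (use B0 in \<open>simp add: K_def\<close>)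
      then have "snd (u i) = snd w" by simp
      moreover from this have "fst (u i) = fst w" using eq by simp
      ultimately show "u i = w" by (simp add: prod_eq_iff)
    next
      assume "u i = w"
      then show "nat (N i) = nat (N i0)"
        unfolding N_def i0(2) by simp
    qed
    then show "poly.coeff (monom (c i) (nat (N i))) (nat (N i0)) = (if u i = w then c i else 0)"
      by simp
  qed
  moreover have "\<dots> = (\<Sum>i | i \<in> I \<and> u i = w. c i)"
    using fin by (simp add: sum.If_cases Int_def)
  ultimately show ?thesis by simp
qed

lemma logarithmic_derivative_prod:
  fixes F :: "'i \<Rightarrow> 'k::field_char_0 poly"
  assumes "finite A" "\<And>i. i \<in> A \<Longrightarrow> poly (F i) x \<noteq> 0"
  shows "poly (pderiv (\<Prod>i\<in>A. F i ^ a i)) x =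
    (\<Prod>i\<in>A. poly (F i) x ^ a i) * (\<Sum>i\<in>A. of_nat (a i) * (poly (pderiv (F i)) x / poly (F i) x))"
  using assms
proof (induction A rule: finite_induct)
  case (insert i A)
  have "poly (pderiv (F i ^ a i)) x = poly (F i) x ^ a i * (of_nat (a i) * (poly (pderiv (F i)) x / poly (F i) x))"
  proof (cases "a i")
    case (Suc n)
    have "poly (pderiv (F i ^ Suc n)) x = of_nat (Suc n) * poly (F i) x ^ n * poly (pderiv (F i)) x"
      by (simp only: pderiv_power_Suc poly_mult poly_smult poly_power)
    then show ?thesis
      using insert.prems[of i] unfolding Suc by (simp add: field_simps)
  qed simp
  then show ?case
    using insert by (simp add: pderiv_mult poly_prod algebra_simps)
qed simp

lemma pderiv_sum_distrib: "pderiv (\<Sum>i\<in>I. f i) = (\<Sum>i\<in>I. pderiv (f i))"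
  by (induction I rule: infinite_finite_induct) (simp_all add: pderiv_add)

lemma sum_UNIV_pairs:
  "(\<Sum>z\<in>UNIV. f z) = (\<Sum>n\<in>UNIV. \<Sum>k\<in>UNIV. f (n :: 'n::finite, k :: 'm::finite))"
  unfolding sum.cartesian_product UNIV_Times_UNIV by (simp add: case_prod_unfold)

lemma sum_of_int_delta:
  fixes w :: "'n::finite \<Rightarrow> 'r::comm_ring_1"
  shows "(\<Sum>i\<in>UNIV. of_int (d * (if i = a then 1 else 0)) * w i) = of_int d * w a"
proof -
  have "(\<Sum>i\<in>UNIV. of_int (d * (if i = a then 1 else 0)) * w i) = (\<Sum>i\<in>UNIV. if i = a then of_int d * w i else 0)"
    by (rule sum.cong) auto
  then show ?thesis by simp
qed

text \<open>Relative to a triangle with \<open>D = cross p q r\<close>, each \<open>D * e j\<close> is an integral combination of the three vertices.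
Applying the hypothesis to this relation shows that \<open>g\<close> is the interpolation of its values at the vertices.\<close>

lemma affine_extension:
  fixes e :: "'n::finite \<Rightarrow> int \<times> int" and g :: "'n \<Rightarrow> 'k::field_char_0"
  assumes rel: "\<And>c :: 'n \<Rightarrow> int. sum c UNIV = 0 \<Longrightarrow> (\<Sum>i\<in>UNIV. c i * fst (e i)) = 0 \<Longrightarrow>
      (\<Sum>i\<in>UNIV. c i * snd (e i)) = 0 \<Longrightarrow> (\<Sum>i\<in>UNIV. of_int (c i) * g i) = 0"
    and nc: "cross (e i0) (e i1) (e i2) \<noteq> 0"
  shows "\<exists>G. affine_fun G \<and> (\<forall>i. G (e i) = g i)"
proof -
  define p q r where "p = e i0" and "q = e i1" and "r = e i2"
  define D where "D = cross p q r"
  have D: "D \<noteq> 0"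
    using nc unfolding D_def p_def q_def r_def .
  define G where "G z = g i0 + ((g i1 - g i0) / of_int D * of_int (cross p z r)
      + (g i2 - g i0) / of_int D * of_int (cross p q z))" for z
  have "affine_fun G"
    unfolding G_def
    by (rule affine_fun_add[OF affine_fun_const affine_fun_add[OF
          affine_fun_scale[OF affine_fun_cross(1)] affine_fun_scale[OF affine_fun_cross(2)]]])
  moreover have "G (e j) = g j" for j
  proof -
    define l1 l2 where "l1 = cross p (e j) r" and "l2 = cross p q (e j)"
    define c where "c i = D * (if i = j then 1 else 0) - (D - l1 - l2) * (if i = i0 then 1 else 0)
        - l1 * (if i = i1 then 1 else 0) - l2 * (if i = i2 then 1 else 0)" for i
    have c: "(\<Sum>i\<in>UNIV. of_int (c i) * w i)
        = of_int D * w j - of_int (D - l1 - l2) * w i0 - of_int l1 * w i1 - of_int l2 * w i2"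
      for w :: "'n \<Rightarrow> 'r::comm_ring_1"
      by (simp only: c_def of_int_diff left_diff_distrib sum_subtractf sum_of_int_delta)
    have c_int: "(\<Sum>i\<in>UNIV. c i * w i) = D * w j - (D - l1 - l2) * w i0 - l1 * w i1 - l2 * w i2"
      for w :: "'n \<Rightarrow> int"
      using c[of w] by (simp only: of_int_eq_id id_apply)
    have "(\<Sum>i\<in>UNIV. of_int (c i) * g i) = 0"
    proof (rule rel)
      show "sum c UNIV = 0"
        using c_int[of "\<lambda>_. 1"] by simp
      show "(\<Sum>i\<in>UNIV. c i * fst (e i)) = 0"
        unfolding c_int by (simp add: p_def[symmetric] q_def[symmetric] r_def[symmetric] D_def l1_def l2_def cross_def algebra_simps)
      show "(\<Sum>i\<in>UNIV. c i * snd (e i)) = 0"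
        unfolding c_int by (simp add: p_def[symmetric] q_def[symmetric] r_def[symmetric] D_def l1_def l2_def cross_def algebra_simps)
    qed
    then have "of_int D * g j = of_int (D - l1 - l2) * g i0 + of_int l1 * g i1 + of_int l2 * g i2"
      unfolding c by (simp add: algebra_simps)
    moreover have "of_int D * G (e j) = of_int (D - l1 - l2) * g i0 + of_int l1 * g i1 + of_int l2 * g i2"
      using D unfolding G_def l1_def[symmetric] l2_def[symmetric] by (simp add: field_simps)
    ultimately have "of_int D * G (e j) = of_int D * g j" by simp
    then show ?thesis using D by simp
  qed
  ultimately show ?thesis by blast
qed


text \<open>The binomial equations hold along the curve \<open>t \<mapsto> W diag(t\<^sup>L) M\<close> through the identity. Their logarithmic
derivatives at \<open>t = 1\<close> say that \<open>n \<mapsto> (A x)\<^sub>n / x\<^sub>n\<close>, with \<open>A = W diag(L) M\<close> and \<open>x\<close> the vector of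
monomials, respects all affine relations between the exponents; comparing coefficients of Laurent
monomials separates the contributions of the individual shifts \<open>\<alpha>\<close>. Since \<open>M A = diag(L) M\<close>, the
rows of \<open>M\<close> are eigenvectors.\<close>

lemma toric_derivation_of_binomials:
  fixes e :: "'n::finite \<Rightarrow> int \<times> int" and M W :: "'k::field_char_0 ^ 'n ^ 'n" and L :: "'n \<Rightarrow> nat"
  assumes inj: "inj e" and conv: "lattice_convex (range e)"
    and nc: "cross (e i0) (e i1) (e i2) \<noteq> 0"
    and inv: "W ** M = mat 1"
    and bin: "\<And>x y t. x \<noteq> 0 \<Longrightarrow> y \<noteq> 0 \<Longrightarrow> t \<noteq> 0 \<Longrightarrow>
      satisfies_binomials e (W *v (\<chi> m. t ^ L m * (M *v monomials e x y) $ m))"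
  shows "\<exists>\<Lambda>. toric_derivation (range e) \<Lambda> \<and>
    (\<forall>m. eigenvector (range e) \<Lambda> (\<lambda>s. if s \<in> range e then M $ m $ inv e s else 0) (of_nat (L m)))"
proof -
  define A where "A n k = (\<Sum>m\<in>UNIV. W $ n $ m * of_nat (L m) * M $ m $ k)" for n k
  define g where "g \<alpha> n = (\<Sum>k\<in>UNIV. if e k = e n + \<alpha> then A n k else 0)" for \<alpha> n
  have WM: "(\<Sum>m\<in>UNIV. W $ n $ m * M $ m $ k) = (if n = k then 1 else 0)" for n k
    using inv by (simp add: matrix_matrix_mult_def mat_def vec_eq_iff)
  have MW: "(\<Sum>n\<in>UNIV. M $ m $ n * W $ n $ k) = (if m = k then 1 else 0)" for m k
  proof -
    have "M ** W = mat 1"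
      using inv matrix_left_right_inverse by blast
    then show ?thesis
      by (simp add: matrix_matrix_mult_def mat_def vec_eq_iff)
  qed
  have relation: "(\<Sum>n\<in>UNIV. of_int (c n) * g \<alpha> n) = 0"
    if c: "sum c UNIV = 0" "(\<Sum>i\<in>UNIV. c i * fst (e i)) = 0" "(\<Sum>i\<in>UNIV. c i * snd (e i)) = 0"
    for c :: "'n \<Rightarrow> int" and \<alpha>
  proof -
    \<comment> \<open>The binomial that belongs to the integral relation \<open>c\<close> has its positive part on one side and its negative part on
the other.\<close>
    define a b where "a i = nat (c i)" and "b i = nat (- c i)" for i
    have ab: "int (a i) - int (b i) = c i" for i
      unfolding a_def b_def by simp
    have split: "(\<Sum>i\<in>UNIV. int (a i) * w i) = (\<Sum>i\<in>UNIV. int (b i) * w i)"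
      if "(\<Sum>i\<in>UNIV. c i * w i) = 0" for w :: "'n \<Rightarrow> int"
      using that unfolding ab[symmetric] by (simp add: left_diff_distrib sum_subtractf)
    have sab: "sum a UNIV = sum b UNIV"
      using split[of "\<lambda>_. 1"] c(1) by (simp flip: of_nat_sum)
    have pointwise: "(\<Sum>n\<in>UNIV. of_int (c n) *
        ((\<Sum>k\<in>UNIV. A n k * (x powi fst (e k) * y powi snd (e k))) / (x powi fst (e n) * y powi snd (e n)))) = 0"
      if x: "x \<noteq> 0" and y: "y \<noteq> 0" for x y :: 'k
    proof -
      define \<phi> where "\<phi> = monomials e x y"
      have \<phi>: "\<phi> $ n = x powi fst (e n) * y powi snd (e n)" for n
        by (simp add: \<phi>_def monomials_def)
      have \<phi>0: "\<phi> $ n \<noteq> 0" for n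
        using x y by (simp add: \<phi>)
      define F where "F n = (\<Sum>m\<in>UNIV. monom (W $ n $ m * (M *v \<phi>) $ m) (L m))" for n
      have F: "poly (F n) t = (W *v (\<chi> m. t ^ L m * (M *v \<phi>) $ m)) $ n" for n t
        unfolding F_def poly_sum poly_monom matrix_vector_mult_def by (simp add: algebra_simps)
      have "(\<Prod>n\<in>UNIV. F n ^ a n) - (\<Prod>n\<in>UNIV. F n ^ b n) = 0"
      proof (rule poly_eq_0_punctured)
        fix t :: 'k assume "t \<noteq> 0"
        then have "satisfies_binomials e (W *v (\<chi> m. t ^ L m * (M *v \<phi>) $ m))"
          unfolding \<phi>_def using bin x y by blast
        then have "(\<Prod>n\<in>UNIV. poly (F n) t ^ a n) = (\<Prod>n\<in>UNIV. poly (F n) t ^ b n)"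
          unfolding satisfies_binomials_def F using sab split[OF c(2)] split[OF c(3)] by blast
        then show "poly ((\<Prod>n\<in>UNIV. F n ^ a n) - (\<Prod>n\<in>UNIV. F n ^ b n)) t = 0"
          by (simp only: poly_diff poly_prod poly_power right_minus_eq)
      qed
      then have FF: "(\<Prod>n\<in>UNIV. F n ^ a n) = (\<Prod>n\<in>UNIV. F n ^ b n)" by simp
      have "W *v (M *v \<phi>) = \<phi>"
        by (simp add: matrix_vector_mul_assoc inv)
      then have F1: "poly (F n) 1 = \<phi> $ n" for n
        unfolding F by (simp add: vec_lambda_eta)
      have dF: "poly (pderiv (F n)) 1 = (\<Sum>k\<in>UNIV. A n k * \<phi> $ k)" for n
      proof -
        have "poly (pderiv (F n)) 1 = (\<Sum>m\<in>UNIV. of_nat (L m) * (W $ n $ m * (M *v \<phi>) $ m))"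
          unfolding F_def by (simp add: pderiv_sum_distrib pderiv_monom poly_sum poly_monom)
        also have "\<dots> = (\<Sum>m\<in>UNIV. \<Sum>k\<in>UNIV. W $ n $ m * of_nat (L m) * M $ m $ k * \<phi> $ k)"
          unfolding matrix_vector_mult_def by (simp add: sum_distrib_left mult_ac)
        also have "\<dots> = (\<Sum>k\<in>UNIV. \<Sum>m\<in>UNIV. W $ n $ m * of_nat (L m) * M $ m $ k * \<phi> $ k)"
          by (rule sum.swap)
        finally show ?thesis
          by (simp add: A_def sum_distrib_right)
      qed
      define d where "d n = (\<Sum>k\<in>UNIV. A n k * \<phi> $ k) / \<phi> $ n" for n
      have F1': "poly (F n) 1 \<noteq> 0" for n
        using \<phi>0 F1 by simp
      have log: "poly (pderiv (\<Prod>n\<in>UNIV. F n ^ r n)) 1 = (\<Prod>n\<in>UNIV. \<phi> $ n ^ r n) * (\<Sum>n\<in>UNIV. of_nat (r n) * d n)" for r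
        using logarithmic_derivative_prod[of UNIV F 1 r] F1' by (simp add: d_def F1 dF)
      have "(\<Prod>n\<in>UNIV. \<phi> $ n ^ a n) = (\<Prod>n\<in>UNIV. \<phi> $ n ^ b n)"
        using arg_cong[OF FF, of "\<lambda>p. poly p 1"] by (simp add: poly_prod F1)
      moreover have "(\<Prod>n\<in>UNIV. \<phi> $ n ^ a n) * (\<Sum>n\<in>UNIV. of_nat (a n) * d n)
          = (\<Prod>n\<in>UNIV. \<phi> $ n ^ b n) * (\<Sum>n\<in>UNIV. of_nat (b n) * d n)"
        unfolding log[symmetric] FF ..
      ultimately have eq: "(\<Prod>n\<in>UNIV. \<phi> $ n ^ b n) * (\<Sum>n\<in>UNIV. of_nat (a n) * d n)
          = (\<Prod>n\<in>UNIV. \<phi> $ n ^ b n) * (\<Sum>n\<in>UNIV. of_nat (b n) * d n)"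
        by (simp only:)
      have "(\<Prod>n\<in>UNIV. \<phi> $ n ^ b n) \<noteq> 0"
        using \<phi>0 by simp
      then have "(\<Sum>n\<in>UNIV. of_nat (a n) * d n) = (\<Sum>n\<in>UNIV. of_nat (b n) * d n)"
        by (rule iffD1[OF mult_left_cancel eq])
      then have "(\<Sum>n\<in>UNIV. of_int (int (a n) - int (b n)) * d n) = 0"
        by (simp add: left_diff_distrib sum_subtractf)
      then show ?thesis
        unfolding ab d_def \<phi> .
    qed
    define u where "u = (\<lambda>(n, k). e k - e n)"
    define w where "w = (\<lambda>(n, k). of_int (c n) * A n k)"
    have "(\<Sum>z\<in>UNIV. w z * (x powi fst (u z) * y powi snd (u z))) = 0" if "x \<noteq> 0" "y \<noteq> 0" for x y
    proof -
      have "w (n, k) * (x powi fst (u (n, k)) * y powi snd (u (n, k))) =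
          of_int (c n) * (A n k * (x powi fst (e k) * y powi snd (e k)) / (x powi fst (e n) * y powi snd (e n)))" for n k
      proof -
        have "x powi (fst (e k) - fst (e n)) = x powi fst (e k) / x powi fst (e n)"
          using that by (intro power_int_diff) blast
        moreover have "y powi (snd (e k) - snd (e n)) = y powi snd (e k) / y powi snd (e n)"
          using that by (intro power_int_diff) blast
        ultimately show ?thesis
          by (simp only: u_def w_def prod.case fst_diff snd_diff times_divide_eq_right times_divide_eq_left
                divide_divide_eq_left mult.assoc)
      qed
      note term_eq = this
      have "(\<Sum>z\<in>UNIV. w z * (x powi fst (u z) * y powi snd (u z))) =
        (\<Sum>n\<in>UNIV. \<Sum>k\<in>UNIV. of_int (c n) * (A n k * (x powi fst (e k) * y powi snd (e k)) / (x powi fst (e n) * y powi snd (e n))))"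
        unfolding sum_UNIV_pairs term_eq ..
      also have "\<dots> = (\<Sum>n\<in>UNIV. of_int (c n) *
        ((\<Sum>k\<in>UNIV. A n k * (x powi fst (e k) * y powi snd (e k))) / (x powi fst (e n) * y powi snd (e n))))"
        by (simp only: sum_distrib_left sum_divide_distrib)
      finally show ?thesis
        using pointwise[OF that] by simp
    qed
    then have "(\<Sum>z | z \<in> UNIV \<and> u z = \<alpha>. w z) = 0"
      by (rule laurent_monomials_independent[OF finite_class.finite_UNIV])
    then have "(\<Sum>z\<in>UNIV. if u z = \<alpha> then w z else 0) = 0"
      by (simp add: sum.If_cases)
    then have "(\<Sum>n\<in>UNIV. \<Sum>k\<in>UNIV. if u (n, k) = \<alpha> then w (n, k) else 0) = 0"
      unfolding sum_UNIV_pairs .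
    moreover have "(\<Sum>k\<in>UNIV. if u (n, k) = \<alpha> then w (n, k) else 0) = of_int (c n) * g \<alpha> n" for n
    proof -
      have "e k - e n = \<alpha> \<longleftrightarrow> e k = e n + \<alpha>" for k
        by (auto simp: algebra_simps)
      then show ?thesis
        unfolding g_def sum_distrib_left by (intro sum.cong) (simp_all add: u_def w_def)
    qed
    ultimately show ?thesis by simp
  qed
  have "\<forall>\<alpha>. \<exists>G. affine_fun G \<and> (\<forall>i. G (e i) = g \<alpha> i)"
    using affine_extension[OF relation nc] by blast
  then obtain \<Lambda> where \<Lambda>: "\<And>\<alpha>. affine_fun (\<Lambda> \<alpha>)" "\<And>\<alpha> i. \<Lambda> \<alpha> (e i) = g \<alpha> i"
    by metis
  have "toric_derivation (range e) \<Lambda>"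
    unfolding toric_derivation_def
  proof (intro conjI allI ballI impI)
    fix \<alpha> s assume "s \<in> range e" "s + \<alpha> \<notin> range e"
    then obtain n where n: "s = e n" "\<And>k. e k \<noteq> e n + \<alpha>"
      by (metis imageE rangeI)
    then show "\<Lambda> \<alpha> s = 0"
      by (simp add: \<Lambda> g_def)
  qed (use conv \<Lambda> in auto)
  moreover have "eigenvector (range e) \<Lambda> (\<lambda>s. if s \<in> range e then M $ m $ inv e s else 0) (of_nat (L m))" for m
    unfolding eigenvector_def
  proof (intro conjI allI impI ballI)
    show "\<exists>s\<in>range e. (if s \<in> range e then M $ m $ inv e s else 0) \<noteq> 0"
    proof (rule ccontr)
      assume "\<not> ?thesis"
      then have "M $ m $ k = 0" for k
        using inj by auto
      then show False
        using MW[of m m] by simp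
    qed
    fix s assume "s \<in> range e"
    then obtain k where k: "s = e k" by blast
    have \<Lambda>A: "\<Lambda> (e k - e n) (e n) = A n k" for n
    proof -
      have "\<Lambda> (e k - e n) (e n) = (\<Sum>k'\<in>UNIV. if k' = k then A n k' else 0)"
        unfolding \<Lambda> g_def by (rule sum.cong) (use inj in \<open>auto simp: inj_eq\<close>)
      then show ?thesis by simp
    qed
    have "(\<Sum>n\<in>range e. (if n \<in> range e then M $ m $ inv e n else 0) * \<Lambda> (s - n) n) = (\<Sum>n\<in>UNIV. M $ m $ n * A n k)"
      using inj by (subst sum.reindex) (simp_all add: k \<Lambda>A)
    also have "\<dots> = (\<Sum>n\<in>UNIV. \<Sum>m'\<in>UNIV. M $ m $ n * W $ n $ m' * (of_nat (L m') * M $ m' $ k))"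
      by (simp add: A_def sum_distrib_left mult.assoc)
    also have "\<dots> = (\<Sum>m'\<in>UNIV. \<Sum>n\<in>UNIV. M $ m $ n * W $ n $ m' * (of_nat (L m') * M $ m' $ k))"
      by (rule sum.swap)
    also have "\<dots> = (\<Sum>m'\<in>UNIV. (if m = m' then 1 else 0) * (of_nat (L m') * M $ m' $ k))"
      by (simp only: sum_distrib_right[symmetric] MW)
    also have "\<dots> = (\<Sum>m'\<in>UNIV. if m = m' then of_nat (L m') * M $ m' $ k else 0)"
      by (rule sum.cong) auto
    finally show "of_nat (L m) * (if s \<in> range e then M $ m $ inv e s else 0) =
        (\<Sum>n\<in>range e. (if n \<in> range e then M $ m $ inv e n else 0) * \<Lambda> (s - n) n)"
      using inj by (simp add: k)
  qed simp
  ultimately show ?thesis by blast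
qed

section \<open>Recovering lattice points from spectra\<close>

text \<open>A lattice triangle whose doubled area \<open>D\<close> exceeds \<open>1\<close> contains a lattice point other than its vertices:
the parallelogram over it contains a lattice point that is not a corner, and the point reflection of the
parallelogram moves it into the triangle if necessary. The point splits off a triangle of smaller positive area.\<close>

lemma lattice_convex_smaller_triangle:
  assumes conv: "lattice_convex S" and S: "p \<in> S" "q \<in> S" "r \<in> S" and big: "cross p q r \<ge> 2"
  shows "\<exists>s\<in>S. (0 < cross p s r \<and> cross p s r < cross p q r) \<or> (0 < cross p q s \<and> cross p q s < cross p q r)"
proof -
  define D where "D = cross p q r"
  define u1 u2 v1 v2 where "u1 = fst q - fst p" and "u2 = snd q - snd p"
    and "v1 = fst r - fst p" and "v2 = snd r - snd p"
  have D: "D = u1 * v2 - u2 * v1" and D2: "D \<ge> 2"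
    using big unfolding D_def u1_def u2_def v1_def v2_def cross_def by simp_all
  \<comment> \<open>Since \<open>D \<noteq> \<plusminus>1\<close>, one of the two unit vectors is not an integral combination of the edge vectors.\<close>
  have "\<exists>z1 z2. \<not> (D dvd z1 * v2 - z2 * v1 \<and> D dvd u1 * z2 - u2 * z1)"
  proof (rule ccontr)
    assume "\<not> ?thesis"
    then have *: "D dvd z1 * v2 - z2 * v1" "D dvd u1 * z2 - u2 * z1" for z1 z2
      by blast+
    have "D dvd v2" "D dvd v1" "D dvd u1" "D dvd u2"
      using *(1)[of 1 0] *(1)[of 0 1] *(2)[of 0 1] *(2)[of 1 0] by simp_all
    then have "D * D dvd D"
      using dvd_diff[OF mult_dvd_mono[OF \<open>D dvd u1\<close> \<open>D dvd v2\<close>] mult_dvd_mono[OF \<open>D dvd u2\<close> \<open>D dvd v1\<close>]]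
      unfolding D[symmetric] by blast
    then have "D * D \<le> D"
      using D2 by (intro zdvd_imp_le) auto
    then have "D \<le> 1"
      using D2 by simp
    then show False using D2 by simp
  qed
  then obtain z1 z2 where z: "\<not> (D dvd z1 * v2 - z2 * v1 \<and> D dvd u1 * z2 - u2 * z1)"
    by blast
  define a b where "a = (z1 * v2 - z2 * v1) mod D" and "b = (u1 * z2 - u2 * z1) mod D"
  have ab: "0 \<le> a" "a < D" "0 \<le> b" "b < D" "a \<noteq> 0 \<or> b \<noteq> 0"
    using D2 z unfolding a_def b_def by (auto simp: dvd_eq_mod_eq_0)
  define k l where "k = (z1 * v2 - z2 * v1) div D" and "l = (u1 * z2 - u2 * z1) div D"
  have kl: "a = z1 * v2 - z2 * v1 - D * k" "b = u1 * z2 - u2 * z1 - D * l"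
    unfolding a_def b_def k_def l_def by (simp_all add: minus_mult_div_eq_mod)
  define w1 w2 where "w1 = z1 - k * u1 - l * v1" and "w2 = z2 - k * u2 - l * v2"
  have w: "D * w1 = a * u1 + b * v1" "D * w2 = a * u2 + b * v2"
    unfolding kl w1_def w2_def by (simp_all add: D algebra_simps)
  have "\<exists>a b w1 w2. 0 \<le> a \<and> a < D \<and> 0 \<le> b \<and> b < D \<and> (a \<noteq> 0 \<or> b \<noteq> 0) \<and> a + b \<le> D \<and>
      D * w1 = a * u1 + b * v1 \<and> D * w2 = a * u2 + b * v2"
  proof (cases "a + b \<le> D")
    case True
    then show ?thesis using ab w by blast
  next
    case False
    \<comment> \<open>The point lies in the other half of the parallelogram; reflect it in the centre.\<close>
    have "D * (u1 + v1 - w1) = (D - a) * u1 + (D - b) * v1" "D * (u2 + v2 - w2) = (D - a) * u2 + (D - b) * v2"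
      using w by (simp_all add: algebra_simps)
    moreover have "0 \<le> D - a" "D - a < D" "0 \<le> D - b" "D - b < D" "D - a \<noteq> 0" "D - a + (D - b) \<le> D"
      using False ab by simp_all
    ultimately show ?thesis by blast
  qed
  then obtain a b w1 w2 where ab: "0 \<le> a" "a < D" "0 \<le> b" "b < D" "a \<noteq> 0 \<or> b \<noteq> 0" "a + b \<le> D"
    and w: "D * w1 = a * u1 + b * v1" "D * w2 = a * u2 + b * v2"
    by blast
  define s where "s = (fst p + w1, snd p + w2)"
  have "s \<in> S"
  proof (rule lattice_convexD[OF conv S, of "D - a - b" a b])
    show "(D - a - b + a + b) * fst s = (D - a - b) * fst p + a * fst q + b * fst r"
      using w(1) by (simp add: s_def u1_def v1_def algebra_simps)
    show "(D - a - b + a + b) * snd s = (D - a - b) * snd p + a * snd q + b * snd r"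
      using w(2) by (simp add: s_def u2_def v2_def algebra_simps)
  qed (use ab D2 in auto)
  moreover have "D * cross p s r = D * a"
  proof -
    have "D * cross p s r = (D * w1) * v2 - (D * w2) * v1"
      by (simp add: s_def cross_def v1_def v2_def algebra_simps)
    also have "\<dots> = D * a"
      unfolding w by (simp add: D algebra_simps)
    finally show ?thesis .
  qed
  then have "cross p s r = a"
    using D2 by simp
  moreover have "D * cross p q s = D * b"
  proof -
    have "D * cross p q s = u1 * (D * w2) - u2 * (D * w1)"
      by (simp add: s_def cross_def u1_def u2_def algebra_simps)
    also have "\<dots> = D * b"
      unfolding w by (simp add: D algebra_simps)
    finally show ?thesis .
  qed
  then have "cross p q s = b"
    using D2 by simp
  ultimately show ?thesis
    using ab unfolding D_def[symmetric] by (intro bexI[of _ s]) auto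
qed

lemma lattice_convex_unimodular_triangle:
  assumes conv: "lattice_convex S" and "p \<in> S" "q \<in> S" "r \<in> S" "cross p q r \<noteq> 0"
  obtains p' q' r' where "p' \<in> S" "q' \<in> S" "r' \<in> S" "cross p' q' r' = 1"
proof -
  have swap: "cross p r q = - cross p q r" for p q r
    by (simp add: cross_def algebra_simps)
  have reduce: "\<exists>p\<in>S. \<exists>q\<in>S. \<exists>r\<in>S. cross p q r = 1" if "p \<in> S" "q \<in> S" "r \<in> S" "0 < cross p q r" for p q r
    using that
  proof (induction "nat (cross p q r)" arbitrary: p q r rule: less_induct)
    case less
    show ?case
    proof (cases "cross p q r = 1")
      case True
      then show ?thesis using less.prems by blast
    next
      case False
      then obtain s where s: "s \<in> S"
        "(0 < cross p s r \<and> cross p s r < cross p q r) \<or> (0 < cross p q s \<and> cross p q s < cross p q r)"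
        using lattice_convex_smaller_triangle[OF conv less.prems(1-3)] less.prems(4) by force
      from s(2) show ?thesis
      proof
        assume *: "0 < cross p s r \<and> cross p s r < cross p q r"
        then have "nat (cross p s r) < nat (cross p q r)" by simp
        from less.hyps[OF this less.prems(1) s(1) less.prems(3)] * show ?thesis by blast
      next
        assume *: "0 < cross p q s \<and> cross p q s < cross p q r"
        then have "nat (cross p q s) < nat (cross p q r)" by simp
        from less.hyps[OF this less.prems(1,2) s(1)] * show ?thesis by blast
      qed
    qed
  qed
  have "0 < cross p q r \<or> 0 < cross p r q"
    using assms(5) swap[of p r q] by linarith
  then have "\<exists>p\<in>S. \<exists>q\<in>S. \<exists>r\<in>S. cross p q r = 1"
    using reduce[of p q r] reduce[of p r q] assms(2-4) by blast
  then show ?thesis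
    using that by blast
qed

lemma affine_fun_barycentric:
  assumes "affine_fun u" and "fst s = fst p + x * (fst q - fst p) + y * (fst r - fst p)"
    and "snd s = snd p + x * (snd q - snd p) + y * (snd r - snd p)"
  shows "u s = u p + of_int x * (u q - u p) + of_int y * (u r - u p)"
proof -
  obtain a b c where "\<And>x y. u (x, y) = a + b * of_int x + c * of_int y"
    using assms(1) unfolding affine_fun_def by blast
  then have u: "u z = a + b * of_int (fst z) + c * of_int (snd z)" for z
    by (metis prod.collapse)
  show ?thesis
    unfolding u assms(2,3) by (simp add: algebra_simps)
qed

lemma abs_bound_exists:
  fixes f :: "'n::finite \<Rightarrow> int"
  obtains B where "B \<ge> 0" "\<And>i. \<bar>f i\<bar> \<le> B"
proof (rule that[of "\<Sum>i\<in>UNIV. \<bar>f i\<bar>"])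
  show "\<bar>f i\<bar> \<le> (\<Sum>i\<in>UNIV. \<bar>f i\<bar>)" for i
    by (rule member_le_sum) auto
qed (simp add: sum_nonneg)

text \<open>A weight larger than all first coordinates in question separates lattice vectors.\<close>

lemma large_weight_eq_0:
  fixes x y K :: int
  assumes "x + K * y = 0" "\<bar>x\<bar> < K"
  shows "x = 0 \<and> y = 0"
proof -
  have K: "K > 0" using assms(2) by linarith
  have "x = - (K * y)" using assms(1) by simp
  then have "\<bar>x\<bar> = K * \<bar>y\<bar>"
    using K by (simp add: abs_mult)
  with K have "\<bar>y\<bar> < 1"
    using assms(2) by (metis mult.right_neutral mult_less_cancel_left_pos)
  then show ?thesis using assms(1) by simp
qed

text \<open>Choose \<open>L = x + K y + const\<close>. The affine relations between the points of \<open>range e\<close> and a unimodular triangle in it involve bounded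
integral coefficients. They carry over to the values of \<open>L\<close> on the corresponding points of
\<open>range e'\<close>, and from there to these points by \<open>large_weight_eq_0\<close>. Hence the correspondence is given by an integral
affine map, whose determinant is \<open>\<plusminus>1\<close> since its image contains a unimodular triangle as well.\<close>

lemma unimod_of_affine_spectrum:
  fixes e e' :: "'n::finite \<Rightarrow> int \<times> int"
  assumes inj: "inj e" "inj e'" and conv: "lattice_convex (range e)" "lattice_convex (range e')"
    and nc: "cross (e a0) (e a1) (e a2) \<noteq> 0" "cross (e' b0) (e' b1) (e' b2) \<noteq> 0"
    and spec: "\<And>(L :: 'n \<Rightarrow> nat) a b c. (\<And>m. int (L m) = a + b * fst (e' m) + c * snd (e' m)) \<Longrightarrow>
      \<exists>u :: int \<times> int \<Rightarrow> 'k::field_char_0. affine_fun u \<and> (\<forall>m. \<exists>s\<in>range e. of_nat (L m) = u s)"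
  shows "\<exists>Q. unimod Q \<and> Q ` range e = range e'"
proof -
  obtain s0 s1 s2 where "s0 \<in> range e" "s1 \<in> range e" "s2 \<in> range e" and cr: "cross s0 s1 s2 = 1"
    using lattice_convex_unimodular_triangle[OF conv(1) rangeI rangeI rangeI nc(1)] by blast
  then obtain i0 i1 i2 where i: "s0 = e i0" "s1 = e i1" "s2 = e i2" by blast
  define X Y where "X s = cross s0 s s2" and "Y s = cross s0 s1 s" for s
  have bary: "fst s = fst s0 + X s * (fst s1 - fst s0) + Y s * (fst s2 - fst s0)"
    "snd s = snd s0 + X s * (snd s1 - snd s0) + Y s * (snd s2 - snd s0)" for s
  proof -
    have "cross s0 s1 s2 * (fst s - fst s0) = X s * (fst s1 - fst s0) + Y s * (fst s2 - fst s0)"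
      "cross s0 s1 s2 * (snd s - snd s0) = X s * (snd s1 - snd s0) + Y s * (snd s2 - snd s0)"
      unfolding X_def Y_def cross_def by (simp_all add: algebra_simps)
    then show "fst s = fst s0 + X s * (fst s1 - fst s0) + Y s * (fst s2 - fst s0)"
      "snd s = snd s0 + X s * (snd s1 - snd s0) + Y s * (snd s2 - snd s0)"
      unfolding cr by simp_all
  qed
  obtain B1 where B1: "B1 \<ge> 0" "\<And>m. \<bar>fst (e' m)\<bar> \<le> B1"
    using abs_bound_exists[of "\<lambda>m. fst (e' m)"] by blast
  obtain B2 where B2: "B2 \<ge> 0" "\<And>m. \<bar>snd (e' m)\<bar> \<le> B2"
    using abs_bound_exists[of "\<lambda>m. snd (e' m)"] by blast
  obtain B3 where B3: "B3 \<ge> 0" "\<And>m. \<bar>X (e m)\<bar> \<le> B3"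
    using abs_bound_exists[of "\<lambda>m. X (e m)"] by blast
  obtain B4 where B4: "B4 \<ge> 0" "\<And>m. \<bar>Y (e m)\<bar> \<le> B4"
    using abs_bound_exists[of "\<lambda>m. Y (e m)"] by blast
  \<comment> \<open>\<open>K\<close> exceeds the first coordinates both of differences of points of \<open>range e'\<close> and of the defects
\<open>r1\<close> of the affine relations below.\<close>
  define K where "K = 2 * B1 + B3 * (2 * B1) + B4 * (2 * B1) + 1"
  have "0 \<le> B3 * (2 * B1)" "0 \<le> B4 * (2 * B1)"
    using B1(1) B3(1) B4(1) by simp_all
  then have K: "2 * B1 < K" "K > 0"
    unfolding K_def using B1(1) by linarith+
  define L where "L m = nat (B1 + K * B2 + 1 * fst (e' m) + K * snd (e' m))" for m
  have L: "int (L m) = (B1 + K * B2) + 1 * fst (e' m) + K * snd (e' m)" for m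
  proof -
    have "0 \<le> K * (B2 + snd (e' m))"
      using K B2(2)[of m] by (intro mult_nonneg_nonneg) linarith+
    moreover have "- B1 \<le> fst (e' m)"
      using B1(2)[of m] by linarith
    ultimately have "0 \<le> B1 + K * B2 + 1 * fst (e' m) + K * snd (e' m)"
      by (simp add: algebra_simps)
    then show ?thesis unfolding L_def by simp
  qed
  obtain u :: "int \<times> int \<Rightarrow> 'k" where u: "affine_fun u" "\<And>m. \<exists>s\<in>range e. of_nat (L m) = u s"
    using spec[OF L] by blast
  then have "\<forall>m. \<exists>i. of_nat (L m) = u (e i)" by blast
  then obtain v where v: "\<And>m. of_nat (L m) = u (e (v m))" by metis
  have "inj v"
  proof (rule injI)
    fix m m' assume "v m = v m'"
    then have "(of_nat (L m) :: 'k) = of_nat (L m')" by (simp add: v)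
    then have "int (L m) = int (L m')" by simp
    then have "(fst (e' m) - fst (e' m')) + K * (snd (e' m) - snd (e' m')) = 0"
      unfolding L by (simp add: algebra_simps)
    moreover have "\<bar>fst (e' m) - fst (e' m')\<bar> < K"
      using B1(2)[of m] B1(2)[of m'] K by linarith
    ultimately have "fst (e' m) - fst (e' m') = 0 \<and> snd (e' m) - snd (e' m') = 0"
      by (rule large_weight_eq_0)
    then have "e' m = e' m'" by (simp add: prod_eq_iff)
    then show "m = m'" using inj(2) by (simp add: inj_eq)
  qed
  then have bij: "bij v"
    by (simp add: bij_def finite_UNIV_inj_surj)
  define \<tau> where "\<tau> = inv v"
  have \<tau>: "bij \<tau>" and v\<tau>: "v (\<tau> i) = i" for i
    unfolding \<tau>_def using bij by (simp_all add: bij_imp_bij_inv bij_is_surj surj_f_inv_f)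
  have uL: "u (e i) = of_int (int (L (\<tau> i)))" for i
    using v[of "\<tau> i"] by (simp add: v\<tau>)
  define p0 p1 p2 where "p0 = e' (\<tau> i0)" and "p1 = e' (\<tau> i1)" and "p2 = e' (\<tau> i2)"
  define Q where "Q s = (fst p0 + X s * (fst p1 - fst p0) + Y s * (fst p2 - fst p0),
      snd p0 + X s * (snd p1 - snd p0) + Y s * (snd p2 - snd p0))" for s
  have Qe: "Q (e i) = e' (\<tau> i)" for i
  proof -
    define x y where "x = X (e i)" and "y = Y (e i)"
    have "u (e i) = u s0 + of_int x * (u s1 - u s0) + of_int y * (u s2 - u s0)"
      unfolding x_def y_def by (rule affine_fun_barycentric[OF u(1) bary])
    then have "(of_int (int (L (\<tau> i))) :: 'k) = of_int (int (L (\<tau> i0)) + x * (int (L (\<tau> i1)) - int (L (\<tau> i0)))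
        + y * (int (L (\<tau> i2)) - int (L (\<tau> i0))))"
      unfolding i uL by (simp only: of_int_add of_int_mult of_int_diff)
    then have LL: "int (L (\<tau> i)) = int (L (\<tau> i0)) + x * (int (L (\<tau> i1)) - int (L (\<tau> i0)))
        + y * (int (L (\<tau> i2)) - int (L (\<tau> i0)))"
      unfolding of_int_eq_iff .
    define r1 where "r1 = fst (e' (\<tau> i)) - fst p0 - x * (fst p1 - fst p0) - y * (fst p2 - fst p0)"
    define r2 where "r2 = snd (e' (\<tau> i)) - snd p0 - x * (snd p1 - snd p0) - y * (snd p2 - snd p0)"
    have "r1 + K * r2 = 0"
      using LL unfolding L r1_def r2_def p0_def p1_def p2_def by (simp add: algebra_simps)
    moreover have "\<bar>r1\<bar> < K"
    proof -
      have d: "\<bar>fst (e' m) - fst (e' m')\<bar> \<le> 2 * B1" for m m'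
        using B1(2)[of m] B1(2)[of m'] by linarith
      have "\<bar>x * (fst p1 - fst p0)\<bar> \<le> B3 * (2 * B1)"
        unfolding abs_mult x_def p0_def p1_def using B3 d by (intro mult_mono) auto
      moreover have "\<bar>y * (fst p2 - fst p0)\<bar> \<le> B4 * (2 * B1)"
        unfolding abs_mult y_def p0_def p2_def using B4 d by (intro mult_mono) auto
      moreover have "\<bar>fst (e' (\<tau> i)) - fst p0\<bar> \<le> 2 * B1"
        unfolding p0_def by (rule d)
      ultimately show ?thesis
        unfolding r1_def K_def by linarith
    qed
    ultimately have "r1 = 0" "r2 = 0"
      using large_weight_eq_0 by blast+
    then show ?thesis
      unfolding Q_def r1_def r2_def x_def y_def by (simp add: prod_eq_iff)
  qed
  have "range e' = range (\<lambda>i. e' (\<tau> i))"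
    using bij_is_surj[OF \<tau>] by (metis image_image)
  then have image: "Q ` range e = range e'"
    by (simp add: image_image Qe)
  define a b c d where "a = (snd s2 - snd s0) * (fst p1 - fst p0) - (snd s1 - snd s0) * (fst p2 - fst p0)"
    and "b = (fst s1 - fst s0) * (fst p2 - fst p0) - (fst s2 - fst s0) * (fst p1 - fst p0)"
    and "c = (snd s2 - snd s0) * (snd p1 - snd p0) - (snd s1 - snd s0) * (snd p2 - snd p0)"
    and "d = (fst s1 - fst s0) * (snd p2 - snd p0) - (fst s2 - fst s0) * (snd p1 - snd p0)"
  define s t where "s = fst p0 - a * fst s0 - b * snd s0" and "t = snd p0 - c * fst s0 - d * snd s0"
  have Q: "Q = (\<lambda>(x, y). (a * x + b * y + s, c * x + d * y + t))"
    unfolding fun_eq_iff Q_def X_def Y_def cross_def a_def b_def c_def d_def s_def t_def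
    by (simp add: algebra_simps)
  have det: "cross (Q p) (Q q) (Q r) = (a * d - b * c) * cross p q r" for p q r
    unfolding Q cross_def by (simp add: case_prod_unfold algebra_simps)
  obtain t0 t1 t2 where t: "t0 \<in> range e'" "t1 \<in> range e'" "t2 \<in> range e'" "cross t0 t1 t2 = 1"
    using lattice_convex_unimodular_triangle[OF conv(2) rangeI rangeI rangeI nc(2)] by blast
  then obtain q0 q1 q2 where "t0 = Q q0" "t1 = Q q1" "t2 = Q q2"
    unfolding image[symmetric] by blast
  then have "(a * d - b * c) * cross q0 q1 q2 = 1"
    using t(4) det by simp
  then have "a * d - b * c = 1 \<or> a * d - b * c = -1"
    using zmult_eq_1_iff by blast
  then have "unimod Q"
    unfolding unimod_def Q by blast
  then show ?thesis
    using image by blast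
qed

lemma card_standard_simplex_less:
  assumes "0 \<le> d" "d < d'"
  shows "card (standard_simplex d) < card (standard_simplex d')"
proof (rule psubset_card_mono)
  have "standard_simplex d' \<subseteq> {0..d'} \<times> {0..d'}"
    unfolding standard_simplex_def by auto
  then show "finite (standard_simplex d')"
    by (rule finite_subset) simp
  have "(d', 0) \<in> standard_simplex d'" "(d', 0) \<notin> standard_simplex d"
    using assms unfolding standard_simplex_def by auto
  moreover have "standard_simplex d \<subseteq> standard_simplex d'"
    using assms unfolding standard_simplex_def by auto
  ultimately show "standard_simplex d \<subset> standard_simplex d'" by blast
qed

text \<open>The size of a standard triangle is determined by its number of lattice points.\<close>

lemma simplex_like_unimod:
  assumes "simplex_like S" "simplex_like S'" and card: "card S = card S'"
  shows "\<exists>Q. unimod Q \<and> Q ` S = S'"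
proof -
  obtain P d where P: "unimod P" "d \<ge> 0" "S = P ` standard_simplex d"
    using assms(1)[unfolded simplex_like_def] by (elim exE conjE) (rule that)
  obtain P' d' where P': "unimod P'" "d' \<ge> 0" "S' = P' ` standard_simplex d'"
    using assms(2)[unfolded simplex_like_def] by (elim exE conjE) (rule that)
  have "card S = card (standard_simplex d)" "card S' = card (standard_simplex d')"
    unfolding P(3) P'(3)
    using card_image[OF inj_on_subset[OF unimod_inj[OF P(1)] subset_UNIV]]
      card_image[OF inj_on_subset[OF unimod_inj[OF P'(1)] subset_UNIV]] by blast+
  then have eq: "card (standard_simplex d) = card (standard_simplex d')"
    using card by simp
  have "d = d'"
  proof (rule ccontr)
    assume "d \<noteq> d'"
    then have "d < d' \<or> d' < d" by linarith
    then show False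
    proof
      assume "d < d'"
      from card_standard_simplex_less[OF P(2) this] eq show False by simp
    next
      assume "d' < d"
      from card_standard_simplex_less[OF P'(2) this] eq show False by simp
    qed
  qed
  obtain R where R: "unimod R" "\<And>z. P (R z) = z" "\<And>z. R (P z) = z"
    using unimod_inverse[OF P(1)] by blast
  have "(P' \<circ> R) ` S = S'"
    unfolding P(3) P'(3) \<open>d = d'\<close> by (simp add: image_image R(3))
  then show ?thesis
    using unimod_comp[OF P'(1) R(1)] by blast
qed

text \<open>For each admissible \<open>L\<close>, the eigenvalues \<open>L m\<close> of the associated toric derivation of \<open>range e\<close> are values
of an affine function on \<open>range e\<close>.\<close>

lemma unimod_of_binomials:
  fixes e e' :: "'n::finite \<Rightarrow> int \<times> int" and M W :: "'k::{alg_closed_field, field_char_0} ^ 'n ^ 'n"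
  assumes inj: "inj e" "inj e'" and conv: "lattice_convex (range e)" "lattice_convex (range e')"
    and nc: "cross (e a0) (e a1) (e a2) \<noteq> 0" "cross (e' b0) (e' b1) (e' b2) \<noteq> 0"
    and ns: "\<not> simplex_like (range e)" and inv: "W ** M = mat 1"
    and bin: "\<And>L a b c x y t. (\<And>m. int (L m) = a + b * fst (e' m) + c * snd (e' m)) \<Longrightarrow>
      x \<noteq> 0 \<Longrightarrow> y \<noteq> 0 \<Longrightarrow> t \<noteq> 0 \<Longrightarrow>
      satisfies_binomials e (W *v (\<chi> m. t ^ L m * (M *v monomials e x y) $ m))"
  shows "\<exists>Q. unimod Q \<and> Q ` range e = range e'"
proof (rule unimod_of_affine_spectrum[OF inj conv nc])
  fix L :: "'n \<Rightarrow> nat" and a b c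
  assume L: "\<And>m. int (L m) = a + b * fst (e' m) + c * snd (e' m)"
  obtain \<Lambda> where \<Lambda>: "toric_derivation (range e) \<Lambda>"
    and eig: "\<And>m. eigenvector (range e) \<Lambda> (\<lambda>s. if s \<in> range e then M $ m $ inv e s else 0) (of_nat (L m))"
    using toric_derivation_of_binomials[OF inj(1) conv(1) nc(1) inv bin[OF L]] by blast
  have "simplex_or_spectrum (range e) \<Lambda>"
    by (rule toric_derivation_simplex_or_spectrum[OF \<Lambda> rangeI rangeI rangeI nc(1)])
  then have "affine_spectrum (range e) \<Lambda>"
    using ns unfolding simplex_or_spectrum_def by blast
  then show "\<exists>u :: int \<times> int \<Rightarrow> 'k. affine_fun u \<and> (\<forall>m. \<exists>s\<in>range e. of_nat (L m) = u s)"
    unfolding affine_spectrum_def using eig by blast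
qed

section \<open>Points of the toric surface\<close>

lemma proj_class_surj:
  fixes z :: "('k::field, 'n::finite) proj_space"
  obtains w where "w \<noteq> 0" "z = proj_class w"
proof -
  have "proj_rel (rep_proj_space z) (rep_proj_space z)"
    by (rule Quotient3_rep_reflp[OF Quotient3_proj_space])
  moreover have "proj_class (rep_proj_space z) = z"
    by (rule Quotient3_abs_rep[OF Quotient3_proj_space])
  ultimately show ?thesis
    using that[of "rep_proj_space z"] unfolding proj_rel_def by simp
qed

lemma proj_class_mem_zeros:
  assumes hom: "\<And>p. p \<in> F \<Longrightarrow> \<exists>d. homogeneous d p" and v: "v \<noteq> 0"
  shows "proj_class v \<in> proj_zeros F \<longleftrightarrow> (\<forall>p\<in>F. eval_mpoly p v = 0)"
proof
  assume "proj_class v \<in> proj_zeros F"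
  then obtain w where w: "w \<noteq> 0" "\<And>p. p \<in> F \<Longrightarrow> eval_mpoly p w = 0" "proj_class v = proj_class w"
    unfolding proj_zeros_def by blast
  then obtain c where c: "c \<noteq> 0" "w = c *s v"
    using proj_class_eq_iff[OF v w(1)] by blast
  show "\<forall>p\<in>F. eval_mpoly p v = 0"
  proof
    fix p assume p: "p \<in> F"
    obtain d where "homogeneous d p"
      using hom[OF p] by blast
    from eval_mpoly_scale[OF this, of c v] show "eval_mpoly p v = 0"
      using w(2)[OF p] c by simp
  qed
next
  assume "\<forall>p\<in>F. eval_mpoly p v = 0"
  then show "proj_class v \<in> proj_zeros F"
    unfolding proj_zeros_def using v by blast
qed

text \<open>Homogeneity makes the vanishing of a polynomial independent of the representative, so membership in the closure can be tested with the
homogeneous polynomials that vanish on the set.\<close>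

lemma proj_class_mem_closure:
  assumes C: "\<And>w. w \<in> C \<Longrightarrow> w \<noteq> 0" and v: "v \<noteq> 0"
  shows "proj_class v \<in> zariski_closure (proj_class ` C) \<longleftrightarrow>
    (\<forall>d p. homogeneous d p \<longrightarrow> (\<forall>w\<in>C. eval_mpoly p w = 0) \<longrightarrow> eval_mpoly p v = 0)"
proof (intro iffI allI impI)
  fix d p
  assume cl: "proj_class v \<in> zariski_closure (proj_class ` C)" and p: "homogeneous d p"
    and zero: "\<forall>w\<in>C. eval_mpoly p w = 0"
  have hom: "\<exists>d. homogeneous d q" if "q \<in> {p}" for q
    using p that by blast
  have "zariski_closed (proj_zeros {p})"
    unfolding zariski_closed_def using p by blast
  moreover have "proj_class ` C \<subseteq> proj_zeros {p}"
  proof (rule image_subsetI)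
    fix w assume w: "w \<in> C"
    show "proj_class w \<in> proj_zeros {p}"
      using proj_class_mem_zeros[where F = "{p}", OF hom C[OF w]] zero w by blast
  qed
  ultimately have "proj_class v \<in> proj_zeros {p}"
    using cl hull_minimal[of "proj_class ` C" "proj_zeros {p}" zariski_closed]
    unfolding zariski_closure_def by blast
  then show "eval_mpoly p v = 0"
    using proj_class_mem_zeros[where F = "{p}", OF hom v] by blast
next
  assume vanish: "\<forall>d p. homogeneous d p \<longrightarrow> (\<forall>w\<in>C. eval_mpoly p w = 0) \<longrightarrow> eval_mpoly p v = 0"
  show "proj_class v \<in> zariski_closure (proj_class ` C)"
    unfolding zariski_closure_def hull_def
  proof (intro InterI)
    fix Z assume "Z \<in> {t. zariski_closed t \<and> proj_class ` C \<subseteq> t}"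
    then obtain F where F: "\<And>p. p \<in> F \<Longrightarrow> \<exists>d. homogeneous d p" "Z = proj_zeros F" "proj_class ` C \<subseteq> Z"
      unfolding zariski_closed_def by blast
    have "eval_mpoly p v = 0" if p: "p \<in> F" for p
    proof -
      obtain d where "homogeneous d p"
        using F(1)[OF p] by blast
      moreover have "eval_mpoly p w = 0" if "w \<in> C" for w
        using F(2,3) that p proj_class_mem_zeros[OF F(1) C[OF that]] by blast
      ultimately show ?thesis
        using vanish by blast
    qed
    then show "proj_class v \<in> Z"
      unfolding F(2) using proj_class_mem_zeros[OF F(1) v] by blast
  qed
qed

definition coords :: "int ^ 2 \<Rightarrow> int \<times> int" where
  "coords m = (m $ 1, m $ 2)"

lemma monomials_nonzero:
  assumes "x \<noteq> 0" "y \<noteq> 0"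
  shows "monomials e x y \<noteq> 0" "monomials e x y $ i \<noteq> 0"
proof -
  show nz: "monomials e x y $ i \<noteq> 0" for i
    using assms by (simp add: monomials_def)
  show "monomials e x y \<noteq> 0"
    using nz by (metis zero_index)
qed

lemma proj_class_mem_Tor:
  fixes v :: "'k::field ^ 'n::finite"
  assumes "v \<noteq> 0"
  shows "proj_class v \<in> Tor e \<longleftrightarrow> (\<forall>d p. homogeneous d p \<longrightarrow>
    (\<forall>x y. x \<noteq> 0 \<longrightarrow> y \<noteq> 0 \<longrightarrow> eval_mpoly p (monomials (coords \<circ> e) x y) = 0) \<longrightarrow> eval_mpoly p v = 0)"
proof -
  define C :: "('k ^ 'n) set" where "C = (\<lambda>z. monomials (coords \<circ> e) (fst z) (snd z)) ` torus"
  have "toric_map e z = proj_class (monomials (coords \<circ> e) (fst z) (snd z))" for z :: "'k \<times> 'k"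
    by (simp add: toric_map_def monomials_def coords_def case_prod_unfold)
  then have "Tor e = zariski_closure (proj_class ` C)"
    unfolding Tor_def C_def image_image by simp
  moreover have "w \<noteq> 0" if wC: "w \<in> C" for w
  proof -
    obtain z :: "'k \<times> 'k" where z: "z \<in> torus" "w = monomials (coords \<circ> e) (fst z) (snd z)"
      using wC unfolding C_def by blast
    then have "fst z \<noteq> 0" "snd z \<noteq> 0"
      unfolding torus_def by auto
    then show ?thesis
      unfolding z(2) by (rule monomials_nonzero(1))
  qed
  ultimately have "proj_class v \<in> Tor e \<longleftrightarrow>
      (\<forall>d p. homogeneous d p \<longrightarrow> (\<forall>w\<in>C. eval_mpoly p w = 0) \<longrightarrow> eval_mpoly p v = 0)"
    using proj_class_mem_closure[OF _ assms, of C] by simp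
  moreover have "(\<forall>w\<in>C. R w) \<longleftrightarrow> (\<forall>x y. x \<noteq> 0 \<longrightarrow> y \<noteq> 0 \<longrightarrow> R (monomials (coords \<circ> e) x y))" for R
    unfolding C_def torus_def by auto
  ultimately show ?thesis by simp
qed

definition exponent :: "('n::finite \<Rightarrow> nat) \<Rightarrow> 'n \<Rightarrow>\<^sub>0 nat" where
  "exponent a = Poly_Mapping.Abs_poly_mapping a"

lemma lookup_exponent: "poly_mapping.lookup (exponent a) = a"
  unfolding exponent_def by simp

lemma power_int_sum_exponents:
  fixes x :: "'k::field"
  assumes "x \<noteq> 0" "finite I"
  shows "(\<Prod>i\<in>I. (x powi f i) ^ a i) = x powi (\<Sum>i\<in>I. int (a i) * f i)"
  using assms(2)
proof (induction I rule: finite_induct)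
  case (insert i I)
  have "(x powi f i) ^ a i = x powi (int (a i) * f i)"
    by (simp add: power_int_mult mult.commute[of "int (a i)"])
  then show ?case
    using insert assms(1) by (simp add: power_int_add)
qed simp

text \<open>The difference of the two monomials is homogeneous and vanishes on the image of the torus.\<close>

lemma satisfies_binomials_Tor:
  fixes v :: "'k::field ^ 'n::finite"
  assumes v: "v \<noteq> 0" "proj_class v \<in> Tor e"
  shows "satisfies_binomials (coords \<circ> e) v"
  unfolding satisfies_binomials_def
proof (intro allI impI)
  fix a b :: "'n \<Rightarrow> nat"
  assume deg: "sum a UNIV = sum b UNIV"
    and ab: "(\<Sum>i\<in>UNIV. int (a i) * fst ((coords \<circ> e) i)) = (\<Sum>i\<in>UNIV. int (b i) * fst ((coords \<circ> e) i))"
      "(\<Sum>i\<in>UNIV. int (a i) * snd ((coords \<circ> e) i)) = (\<Sum>i\<in>UNIV. int (b i) * snd ((coords \<circ> e) i))"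
  show "(\<Prod>i\<in>UNIV. v $ i ^ a i) = (\<Prod>i\<in>UNIV. v $ i ^ b i)"
  proof (cases "a = b")
    case False
    define p :: "('k, 'n) mpoly" where
      "p = Poly_Mapping.single (exponent a) 1 - Poly_Mapping.single (exponent b) 1"
    have ne: "exponent a \<noteq> exponent b"
      using False by (metis lookup_exponent)
    have look: "poly_mapping.lookup p m = (if m = exponent a then 1 else if m = exponent b then -1 else 0)" for m
      using ne by (simp add: p_def lookup_minus lookup_single when_def)
    have keys: "Poly_Mapping.keys p = {exponent a, exponent b}"
      by (auto simp: in_keys_iff look split: if_splits)
    have eval: "eval_mpoly p w = (\<Prod>i\<in>UNIV. w $ i ^ a i) - (\<Prod>i\<in>UNIV. w $ i ^ b i)" for w
      unfolding eval_mpoly_def keys using ne by (simp add: look lookup_exponent)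
    have "homogeneous (sum a UNIV) p"
      unfolding homogeneous_def keys by (simp add: lookup_exponent deg)
    moreover have "eval_mpoly p (monomials (coords \<circ> e) x y) = 0" if "x \<noteq> 0" "y \<noteq> 0" for x y
    proof -
      have "(\<Prod>i\<in>UNIV. monomials (coords \<circ> e) x y $ i ^ c i) =
          x powi (\<Sum>i\<in>UNIV. int (c i) * fst ((coords \<circ> e) i)) * y powi (\<Sum>i\<in>UNIV. int (c i) * snd ((coords \<circ> e) i))" for c
        unfolding monomials_def
        by (simp add: power_mult_distrib prod.distrib power_int_sum_exponents[OF that(1)] power_int_sum_exponents[OF that(2)])
      then show ?thesis
        unfolding eval ab[symmetric] by (simp only: ab right_minus_eq)
    qed
    ultimately have "eval_mpoly p v = 0"
      using proj_class_mem_Tor[OF v(1), of e] v(2) by blast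
    then show ?thesis
      unfolding eval by simp
  qed simp
qed

text \<open>The action rescales the coefficients of homogeneous polynomials and preserves the image of the torus,
where it is the substitution \<open>(x, y) \<mapsto> (x t\<^sup>b, y t\<^sup>c)\<close> up to the scalar \<open>t\<^sup>a\<close>. Hence it preserves the Zariski closure.\<close>

lemma Tor_torus_action:
  fixes v :: "'k::field ^ 'n::finite"
  assumes v: "v \<noteq> 0" "proj_class v \<in> Tor e" and t: "t \<noteq> 0"
    and L: "\<And>m. int (L m) = a + b * fst ((coords \<circ> e) m) + c * snd ((coords \<circ> e) m)"
  shows "(\<chi> m. t ^ L m * v $ m) \<noteq> 0" "proj_class (\<chi> m. t ^ L m * v $ m) \<in> Tor e"
proof -
  let ?D = "\<lambda>v. (\<chi> m. t ^ L m * v $ m) :: 'k ^ 'n"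
  show D0: "?D v \<noteq> 0"
    using v(1) t by (simp add: vec_eq_iff)
  have "eval_mpoly p (?D v) = 0"
    if p: "homogeneous d p" and zero: "\<And>x y. x \<noteq> 0 \<Longrightarrow> y \<noteq> 0 \<Longrightarrow> eval_mpoly p (monomials (coords \<circ> e) x y) = 0"
    for d and p :: "('k, 'n) mpoly"
  proof -
    define q where "q = Poly_Mapping.mapp (\<lambda>m c. (\<Prod>i\<in>UNIV. (t ^ L i) ^ poly_mapping.lookup m i) * c) p"
    have look: "poly_mapping.lookup q m = (\<Prod>i\<in>UNIV. (t ^ L i) ^ poly_mapping.lookup m i) * poly_mapping.lookup p m" for m
      unfolding q_def by (simp add: lookup_mapp in_keys_iff when_def)
    have keys: "Poly_Mapping.keys q = Poly_Mapping.keys p"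
      using t by (auto simp: in_keys_iff look split: if_splits)
    have eval: "eval_mpoly q w = eval_mpoly p (?D w)" for w
      unfolding eval_mpoly_def keys look
      by (rule sum.cong) (simp_all add: power_mult_distrib prod.distrib mult_ac)
    have "homogeneous d q"
      using p unfolding homogeneous_def keys .
    moreover have "eval_mpoly q (monomials (coords \<circ> e) x y) = 0" if xy: "x \<noteq> 0" "y \<noteq> 0" for x y
    proof -
      have "?D (monomials (coords \<circ> e) x y) = t powi a *s monomials (coords \<circ> e) (x * t powi b) (y * t powi c)"
      proof -
        have "t ^ L m = t powi a * ((t powi b) powi fst ((coords \<circ> e) m) * (t powi c) powi snd ((coords \<circ> e) m))" for m
        proof -
          have "t ^ L m = t powi int (L m)" by simp
          also have "\<dots> = t powi a * ((t powi b) powi fst ((coords \<circ> e) m) * (t powi c) powi snd ((coords \<circ> e) m))"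
            unfolding L using t by (simp add: power_int_add power_int_mult mult.assoc)
          finally show ?thesis .
        qed
        then show ?thesis
          by (simp add: vec_eq_iff monomials_def power_int_mult_distrib mult_ac)
      qed
      moreover have "eval_mpoly p (monomials (coords \<circ> e) (x * t powi b) (y * t powi c)) = 0"
        using xy t by (intro zero) simp_all
      ultimately show ?thesis
        unfolding eval using eval_mpoly_scale[OF p] by simp
    qed
    ultimately have "eval_mpoly q v = 0"
      using proj_class_mem_Tor[OF v(1), of e] v(2) by blast
    then show ?thesis
      unfolding eval .
  qed
  then show "proj_class (?D v) \<in> Tor e"
    using proj_class_mem_Tor[OF D0, of e] by blast
qed

lemma monomials_mem_Tor:
  fixes x y :: "'k::field"
  assumes "x \<noteq> 0" "y \<noteq> 0"
  shows "proj_class (monomials (coords \<circ> e) x y) \<in> Tor e"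
  using proj_class_mem_Tor[OF monomials_nonzero(1)[OF assms], of "coords \<circ> e" e] assms by blast

lemma matrix_left_inverse_nonzero:
  fixes M W :: "'k::field ^ 'n::finite ^ 'n"
  assumes "W ** M = mat 1" "v \<noteq> 0"
  shows "M *v v \<noteq> 0"
proof
  assume "M *v v = 0"
  then have "(W ** M) *v v = 0"
    by (simp flip: matrix_vector_mul_assoc)
  then show False
    using assms by simp
qed

text \<open>\<open>M\<close> moves to the surface of \<open>e'\<close>, the torus acts there, and \<open>W\<close> moves back to the surface of \<open>e\<close>.\<close>

lemma transported_torus_binomials:
  fixes M W :: "'k::field ^ 'n::finite ^ 'n"
  assumes MW: "M ** W = mat 1" and WM: "W ** M = mat 1"
    and iff: "\<And>v. v \<noteq> 0 \<Longrightarrow> proj_class v \<in> Tor e \<longleftrightarrow> proj_class (M *v v) \<in> Tor e'"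
    and L: "\<And>m. int (L m) = a + b * fst ((coords \<circ> e') m) + c * snd ((coords \<circ> e') m)"
    and xyt: "x \<noteq> 0" "y \<noteq> 0" "t \<noteq> 0"
  shows "satisfies_binomials (coords \<circ> e) (W *v (\<chi> m. t ^ L m * (M *v monomials (coords \<circ> e) x y) $ m))"
proof -
  define \<phi> where "\<phi> = monomials (coords \<circ> e) x y"
  have \<phi>: "\<phi> \<noteq> 0" "proj_class \<phi> \<in> Tor e"
    unfolding \<phi>_def using monomials_nonzero(1) monomials_mem_Tor xyt by blast+
  have M0: "M *v v \<noteq> 0" if "v \<noteq> 0" for v
    by (rule matrix_left_inverse_nonzero[OF WM that])
  have W0: "W *v v \<noteq> 0" if "v \<noteq> 0" for v
    by (rule matrix_left_inverse_nonzero[OF MW that])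
  define w where "w = (\<chi> m. t ^ L m * (M *v \<phi>) $ m)"
  have w: "w \<noteq> 0" "proj_class w \<in> Tor e'"
    unfolding w_def using Tor_torus_action[OF M0[OF \<phi>(1)] _ xyt(3) L] iff[OF \<phi>(1)] \<phi>(2) by blast+
  have "M *v (W *v w) = w"
    by (simp add: matrix_vector_mul_assoc MW)
  then have "proj_class (W *v w) \<in> Tor e"
    using iff[OF W0[OF w(1)]] w(2) by simp
  then show ?thesis
    using satisfies_binomials_Tor W0[OF w(1)] unfolding w_def \<phi>_def by blast
qed

text \<open>A projective transformation is injective, so it identifies membership in the two surfaces, and the inverse matrix
gives the symmetric statement.\<close>

lemma projective_transformation_Tor:
  fixes g :: "('k::field, 'n::finite) proj_space \<Rightarrow> ('k, 'n) proj_space"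
  assumes "projective_transformation g" "g ` Tor e = Tor e'"
  obtains M W :: "'k ^ 'n ^ 'n" where "M ** W = mat 1" "W ** M = mat 1"
    "\<And>v. v \<noteq> 0 \<Longrightarrow> proj_class v \<in> Tor e \<longleftrightarrow> proj_class (M *v v) \<in> Tor e'"
    "\<And>v. v \<noteq> 0 \<Longrightarrow> proj_class v \<in> Tor e' \<longleftrightarrow> proj_class (W *v v) \<in> Tor e"
proof -
  obtain M where "invertible M" and g: "\<And>v. v \<noteq> 0 \<Longrightarrow> g (proj_class v) = proj_class (M *v v)"
    using assms(1) unfolding projective_transformation_def by blast
  then obtain W where MW: "M ** W = mat 1" and WM: "W ** M = mat 1"
    unfolding invertible_def by blast
  have M0: "M *v v \<noteq> 0" if "v \<noteq> 0" for v
    by (rule matrix_left_inverse_nonzero[OF WM that])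
  have W0: "W *v v \<noteq> 0" if "v \<noteq> 0" for v
    by (rule matrix_left_inverse_nonzero[OF MW that])
  have iff: "proj_class v \<in> Tor e \<longleftrightarrow> proj_class (M *v v) \<in> Tor e'" if v: "v \<noteq> 0" for v
  proof
    assume "proj_class v \<in> Tor e"
    then have "g (proj_class v) \<in> g ` Tor e"
      by (rule imageI)
    then show "proj_class (M *v v) \<in> Tor e'"
      unfolding g[OF v] assms(2) .
  next
    assume "proj_class (M *v v) \<in> Tor e'"
    then obtain z where z: "z \<in> Tor e" "proj_class (M *v v) = g z"
      unfolding assms(2)[symmetric] by (elim imageE) (rule that)
    obtain w where w: "w \<noteq> 0" "z = proj_class w"
      using proj_class_surj by blast
    have "proj_class (M *v v) = proj_class (M *v w)"
      using z(2) g[OF w(1)] w(2) by simp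
    then obtain k where k: "k \<noteq> 0" "M *v w = k *s (M *v v)"
      using proj_class_eq_iff[OF M0[OF v] M0[OF w(1)]] by blast
    have "w = W *v (M *v w)"
      by (simp add: matrix_vector_mul_assoc WM)
    also have "\<dots> = k *s (W *v (M *v v))"
      unfolding k(2) by (rule vector_scalar_commute)
    also have "\<dots> = k *s v"
      by (simp add: matrix_vector_mul_assoc WM)
    finally have "proj_class v = proj_class w"
      using proj_class_eq_iff[OF v w(1)] k(1) by blast
    then show "proj_class v \<in> Tor e"
      using z(1) w(2) by simp
  qed
  show ?thesis
  proof (rule that[OF MW WM])
    fix v :: "'k ^ 'n" assume v: "v \<noteq> 0"
    show "proj_class v \<in> Tor e \<longleftrightarrow> proj_class (M *v v) \<in> Tor e'"
      by (rule iff[OF v])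
    show "proj_class v \<in> Tor e' \<longleftrightarrow> proj_class (W *v v) \<in> Tor e"
      using iff[OF W0[OF v]] by (simp add: matrix_vector_mul_assoc MW)
  qed
qed

section \<open>Lattice points of lattice polygons\<close>

lemma coords_inj: "inj coords"
  by (rule injI) (simp add: coords_def vec_eq_iff forall_2)

lemma coords_surj:
  obtains m where "coords m = z"
proof -
  have "coords (vector [fst z, snd z]) = z"
    by (simp add: coords_def)
  then show ?thesis using that by blast
qed

lemma real_vec_nth [simp]: "real_vec m $ i = real_of_int (m $ i)"
  by (simp add: real_vec_def)

lemma lattice_polygon_eq_hull:
  assumes "lattice_polygon \<Delta>"
  shows "\<Delta> = convex hull (real_vec ` lattice_points \<Delta>)"
proof -
  obtain S where S: "\<Delta> = convex hull (real_vec ` S)"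
    using assms unfolding lattice_polygon_def by blast
  have "real_vec ` S \<subseteq> real_vec ` lattice_points \<Delta>"
    unfolding lattice_points_def S using hull_subset[of "real_vec ` S" convex] by blast
  then have "\<Delta> \<subseteq> convex hull (real_vec ` lattice_points \<Delta>)"
    by (subst S) (rule hull_mono)
  moreover have "convex hull (real_vec ` lattice_points \<Delta>) \<subseteq> \<Delta>"
  proof (rule hull_minimal)
    show "real_vec ` lattice_points \<Delta> \<subseteq> \<Delta>"
      unfolding lattice_points_def by blast
    show "convex \<Delta>"
      unfolding S by (rule convex_convex_hull)
  qed
  ultimately show ?thesis by blast
qed

lemma lattice_convex_lattice_points:
  assumes "convex \<Delta>"
  shows "lattice_convex (coords ` lattice_points \<Delta>)"
  unfolding lattice_convex_def
proof (intro ballI allI impI)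
  fix p q r z and a b c :: int
  assume "p \<in> coords ` lattice_points \<Delta>" "q \<in> coords ` lattice_points \<Delta>" "r \<in> coords ` lattice_points \<Delta>"
  then obtain p' q' r' where p': "p = coords p'" "real_vec p' \<in> \<Delta>" and q': "q = coords q'" "real_vec q' \<in> \<Delta>"
    and r': "r = coords r'" "real_vec r' \<in> \<Delta>"
    unfolding lattice_points_def by blast
  obtain z' where z': "coords z' = z"
    using coords_surj by blast
  assume abc: "0 \<le> a" "0 \<le> b" "0 \<le> c" "0 < a + b + c"
    and z: "(a + b + c) * fst z = a * fst p + b * fst q + c * fst r"
    "(a + b + c) * snd z = a * snd p + b * snd q + c * snd r"
  define n where "n = real_of_int (a + b + c)"
  have n: "n > 0"
    unfolding n_def using abc(4) by simp
  have "n * real_of_int (z' $ i) = real_of_int a * real_of_int (p' $ i) + real_of_int b * real_of_int (q' $ i)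
      + real_of_int c * real_of_int (r' $ i)" for i
  proof -
    have "\<forall>i. (a + b + c) * z' $ i = a * p' $ i + b * q' $ i + c * r' $ i"
      using z unfolding z'[symmetric] p' q' r' coords_def forall_2 by simp
    then have "(a + b + c) * z' $ i = a * p' $ i + b * q' $ i + c * r' $ i" ..
    then have "real_of_int ((a + b + c) * z' $ i) = real_of_int (a * p' $ i + b * q' $ i + c * r' $ i)"
      by (rule arg_cong)
    then show ?thesis
      unfolding n_def by simp
  qed
  then have "real_vec z' = (real_of_int a / n) *\<^sub>R real_vec p' + (real_of_int b / n) *\<^sub>R real_vec q'
      + (real_of_int c / n) *\<^sub>R real_vec r'"
    using n by (simp add: vec_eq_iff field_simps)
  moreover have "0 \<le> real_of_int a / n" "0 \<le> real_of_int b / n" "0 \<le> real_of_int c / n"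
    using abc n by simp_all
  moreover have "real_of_int a / n + real_of_int b / n + real_of_int c / n = 1"
    using n unfolding add_divide_distrib[symmetric] n_def by simp
  ultimately have "real_vec z' \<in> convex hull {real_vec p', real_vec q', real_vec r'}"
    unfolding convex_hull_3 by blast
  moreover have "convex hull {real_vec p', real_vec q', real_vec r'} \<subseteq> \<Delta>"
    using p' q' r' assms by (intro hull_minimal) auto
  ultimately show "z \<in> coords ` lattice_points \<Delta>"
    unfolding lattice_points_def z'[symmetric] by blast
qed

lemma collinear_of_cross_eq_0:
  assumes "cross (coords p) (coords q) (coords r) = 0"
  shows "collinear {real_vec p, real_vec q, real_vec r}"
proof (cases "p = r")
  case True
  then show ?thesis
    unfolding collinear_3_expand by simp
next
  case False
  define u where "u i = real_of_int (r $ i - p $ i)" for i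
  define v where "v i = real_of_int (q $ i - p $ i)" for i
  have "real_of_int ((q $ 1 - p $ 1) * (r $ 2 - p $ 2) - (q $ 2 - p $ 2) * (r $ 1 - p $ 1)) = 0"
    using assms unfolding cross_def coords_def by simp
  then have uv: "v 1 * u 2 = v 2 * u 1"
    unfolding u_def v_def by (simp add: algebra_simps)
  have "p $ 1 \<noteq> r $ 1 \<or> p $ 2 \<noteq> r $ 2"
    using False by (simp add: vec_eq_iff forall_2)
  then have "u 1 \<noteq> 0 \<or> u 2 \<noteq> 0"
    unfolding u_def by auto
  then have "\<exists>k. \<forall>i. v i = k * u i"
  proof
    assume "u 1 \<noteq> 0"
    then have "\<forall>i. v i = (v 1 / u 1) * u i"
      using uv unfolding forall_2 by (simp add: field_simps)
    then show ?thesis by blast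
  next
    assume "u 2 \<noteq> 0"
    then have "\<forall>i. v i = (v 2 / u 2) * u i"
      using uv unfolding forall_2 by (simp add: field_simps)
    then show ?thesis by blast
  qed
  then obtain k where k: "\<And>i. v i = k * u i" by blast
  have "real_vec q = (1 - k) *\<^sub>R real_vec p + (1 - (1 - k)) *\<^sub>R real_vec r"
    using k by (simp add: vec_eq_iff u_def v_def algebra_simps)
  then show ?thesis
    unfolding collinear_3_expand by blast
qed

text \<open>The hull of the lattice points has dimension \<open>2\<close>, so they contain an affine basis of three points.\<close>

lemma lattice_polygon_noncollinear:
  assumes "lattice_polygon \<Delta>" "aff_dim \<Delta> = 2"
  obtains p q r where "p \<in> lattice_points \<Delta>" "q \<in> lattice_points \<Delta>" "r \<in> lattice_points \<Delta>"
    "cross (coords p) (coords q) (coords r) \<noteq> 0"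
proof -
  let ?V = "real_vec ` lattice_points \<Delta>"
  have "aff_dim ?V = 2"
    using assms(2) aff_dim_convex_hull[of ?V]
    unfolding lattice_polygon_eq_hull[OF assms(1), symmetric] by simp
  obtain B where B: "B \<subseteq> ?V" "\<not> affine_dependent B" "affine hull ?V = affine hull B"
    using affine_basis_exists by blast
  have "of_nat (card B) = aff_dim ?V + 1"
    using aff_dim_unique[of B ?V] B(2,3) by simp
  then have "card B = 3"
    using \<open>aff_dim ?V = 2\<close> by linarith
  then obtain x y z where xyz: "B = {x, y, z}" "x \<noteq> y" "y \<noteq> z" "x \<noteq> z"
    unfolding card_3_iff by blast
  then have "x \<in> ?V" "y \<in> ?V" "z \<in> ?V"
    using B(1) by simp_all
  then obtain p q r where pqr: "p \<in> lattice_points \<Delta>" "q \<in> lattice_points \<Delta>" "r \<in> lattice_points \<Delta>"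
    "x = real_vec p" "y = real_vec q" "z = real_vec r"
    by (elim imageE) (rule that)
  have "\<not> collinear {x, y, z}"
    using B(2) xyz(2-4) unfolding collinear_3_eq_affine_dependent xyz(1) by simp
  then have "cross (coords p) (coords q) (coords r) \<noteq> 0"
    using collinear_of_cross_eq_0[of p q r] unfolding pqr(4-6) by blast
  then show ?thesis
    by (rule that[OF pqr(1-3)])
qed

text \<open>A lattice polygon is the convex hull of its lattice points, and affine maps commute with convex hulls.\<close>

lemma unimodularly_equivalent_of_unimod:
  assumes \<Delta>: "lattice_polygon \<Delta>" and \<Delta>': "lattice_polygon \<Delta>'"
    and Q: "unimod Q" "Q ` coords ` lattice_points \<Delta> = coords ` lattice_points \<Delta>'"
  shows "unimodularly_equivalent \<Delta> \<Delta>'"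
proof -
  obtain a b c d s t where D: "a * d - b * c = 1 \<or> a * d - b * c = -1"
    and Q_eq: "Q = (\<lambda>(x, y). (a * x + b * y + s, c * x + d * y + t))"
    using Q(1) unfolding unimod_def by blast
  define D where "D = a * d - b * c"
  have DD: "D * D = 1"
    using D unfolding D_def by auto
  define A :: "int^2^2" where "A = vector [vector [a, b], vector [c, d]]"
  define A' :: "int^2^2" where "A' = vector [vector [D * d, - (D * b)], vector [- (D * c), D * a]]"
  have "D * d * a - D * b * c = D * D" "a * (D * d) - b * (D * c) = D * D" "D * a * d - D * c * b = D * D"
    "d * (D * a) - c * (D * b) = D * D"
    unfolding D_def by (simp_all add: algebra_simps)
  then have "D * d * a - D * b * c = 1" "a * (D * d) - b * (D * c) = 1" "D * a * d - D * c * b = 1"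
    "d * (D * a) - c * (D * b) = 1"
    unfolding DD .
  then have "A ** A' = mat 1" "A' ** A = mat 1"
    unfolding A_def A'_def by (simp_all add: vec_eq_iff forall_2 matrix_matrix_mult_def sum_2 mat_def algebra_simps)
  then have inv: "invertible A"
    unfolding invertible_def by blast
  define w :: "int^2" where "w = vector [s, t]"
  define T where "T x = map_matrix real_of_int A *v x + real_vec w" for x
  have T_eq: "T ` X = (\<lambda>y. real_vec w + y) ` (\<lambda>x. map_matrix real_of_int A *v x) ` X" for X
    unfolding T_def image_image by (simp add: add.commute)
  have T_hull: "T ` (convex hull X) = convex hull (T ` X)" for X
    unfolding T_eq convex_hull_translation
    by (simp only: convex_hull_linear_image[OF matrix_vector_mul_linear])
  have T_vec: "T (real_vec m) = real_vec m'" if "coords m' = Q (coords m)" for m m'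
  proof -
    have "m' $ 1 = a * m $ 1 + b * m $ 2 + s" "m' $ 2 = c * m $ 1 + d * m $ 2 + t"
      using that unfolding Q_eq coords_def by simp_all
    then show ?thesis
      unfolding T_def A_def w_def
      by (simp add: vec_eq_iff forall_2 matrix_vector_mult_def sum_2 map_matrix_def)
  qed
  have "T ` real_vec ` lattice_points \<Delta> = real_vec ` lattice_points \<Delta>'"
  proof (intro set_eqI iffI)
    fix y assume "y \<in> T ` real_vec ` lattice_points \<Delta>"
    then obtain m where m: "m \<in> lattice_points \<Delta>" "y = T (real_vec m)" by blast
    then have "Q (coords m) \<in> coords ` lattice_points \<Delta>'"
      using Q(2) by blast
    then obtain m' where "m' \<in> lattice_points \<Delta>'" "coords m' = Q (coords m)"
      by (metis imageE)
    then show "y \<in> real_vec ` lattice_points \<Delta>'"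
      using T_vec m(2) by blast
  next
    fix y assume "y \<in> real_vec ` lattice_points \<Delta>'"
    then obtain m' where m': "m' \<in> lattice_points \<Delta>'" "y = real_vec m'" by blast
    then have "coords m' \<in> Q ` coords ` lattice_points \<Delta>"
      using Q(2) by blast
    then obtain m where m: "m \<in> lattice_points \<Delta>" "coords m' = Q (coords m)" by blast
    have "y = T (real_vec m)"
      unfolding m'(2) by (rule T_vec[OF m(2), symmetric])
    then show "y \<in> T ` real_vec ` lattice_points \<Delta>"
      using m(1) by blast
  qed
  then have "T ` \<Delta> = \<Delta>'"
    using lattice_polygon_eq_hull[OF \<Delta>] lattice_polygon_eq_hull[OF \<Delta>'] T_hull[of "real_vec ` lattice_points \<Delta>"]
    by metis
  then show ?thesis
    unfolding unimodularly_equivalent_def T_def using inv by blast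
qed

section \<open>The polygon of a toric surface\<close>

theorem theorem4:
  fixes \<Delta> \<Delta>' :: "(real^2) set"
    and N :: nat
    and e e' :: "'n::finite \<Rightarrow> int^2"
    and g :: "('k::{alg_closed_field, field_char_0}, 'n) proj_space \<Rightarrow> ('k, 'n) proj_space"
  assumes "lattice_polygon \<Delta>" and "aff_dim \<Delta> = 2"
    and "lattice_polygon \<Delta>'" and "aff_dim \<Delta>' = 2"
    and "card (lattice_points \<Delta>) - 1 = N"
    and "card (lattice_points \<Delta>') - 1 = N"
    and "CARD('n) = N + 1"
    and "lattice_point_ordering \<Delta> e"
    and "lattice_point_ordering \<Delta>' e'"
    and "projective_transformation g"
    and "g ` Tor e = Tor e'"
  shows "unimodularly_equivalent \<Delta> \<Delta>'"
proof -
  have range_e: "range (coords \<circ> e) = coords ` lattice_points \<Delta>" and inj_e: "inj (coords \<circ> e)"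
    using assms(8) inj_compose[OF coords_inj, of e]
    unfolding lattice_point_ordering_def bij_betw_def by (simp_all only: image_comp[symmetric])
  have range_e': "range (coords \<circ> e') = coords ` lattice_points \<Delta>'" and inj_e': "inj (coords \<circ> e')"
    using assms(9) inj_compose[OF coords_inj, of e']
    unfolding lattice_point_ordering_def bij_betw_def by (simp_all only: image_comp[symmetric])
  have convex: "convex D" if "lattice_polygon D" for D
    using lattice_polygon_eq_hull[OF that] convex_convex_hull by metis
  have conv_e: "lattice_convex (range (coords \<circ> e))" "lattice_convex (range (coords \<circ> e'))"
    unfolding range_e range_e'
    by (rule lattice_convex_lattice_points[OF convex[OF assms(1)]],
        rule lattice_convex_lattice_points[OF convex[OF assms(3)]])
  have nc: "\<exists>a0 a1 a2. cross ((coords \<circ> f) a0) ((coords \<circ> f) a1) ((coords \<circ> f) a2) \<noteq> 0"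
    if D: "lattice_polygon D" "aff_dim D = 2" "range (coords \<circ> f) = coords ` lattice_points D"
    for D and f :: "'n \<Rightarrow> int^2"
  proof -
    obtain p q r where pqr: "p \<in> lattice_points D" "q \<in> lattice_points D" "r \<in> lattice_points D"
      and cross: "cross (coords p) (coords q) (coords r) \<noteq> 0"
      using lattice_polygon_noncollinear[OF D(1,2)] by blast
    have "coords p \<in> range (coords \<circ> f)" "coords q \<in> range (coords \<circ> f)" "coords r \<in> range (coords \<circ> f)"
      unfolding D(3) using pqr by simp_all
    then show ?thesis
      using cross by (elim rangeE) metis
  qed
  obtain a0 a1 a2 where a: "cross ((coords \<circ> e) a0) ((coords \<circ> e) a1) ((coords \<circ> e) a2) \<noteq> 0"
    using nc[OF assms(1,2) range_e] by blast
  obtain b0 b1 b2 where b: "cross ((coords \<circ> e') b0) ((coords \<circ> e') b1) ((coords \<circ> e') b2) \<noteq> 0"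
    using nc[OF assms(3,4) range_e'] by blast
  obtain M W :: "'k ^ 'n ^ 'n" where MW: "M ** W = mat 1" and WM: "W ** M = mat 1"
    and M: "\<And>v. v \<noteq> 0 \<Longrightarrow> proj_class v \<in> Tor e \<longleftrightarrow> proj_class (M *v v) \<in> Tor e'"
    and W: "\<And>v. v \<noteq> 0 \<Longrightarrow> proj_class v \<in> Tor e' \<longleftrightarrow> proj_class (W *v v) \<in> Tor e"
    using projective_transformation_Tor[OF assms(10,11)] by blast
  have "\<exists>Q. unimod Q \<and> Q ` range (coords \<circ> e) = range (coords \<circ> e')"
  proof -
    consider "\<not> simplex_like (range (coords \<circ> e))" | "\<not> simplex_like (range (coords \<circ> e'))"
      | "simplex_like (range (coords \<circ> e))" "simplex_like (range (coords \<circ> e'))"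
      by blast
    then show ?thesis
    proof cases
      case 1
      show ?thesis
        by (rule unimod_of_binomials[OF inj_e inj_e' conv_e a b 1 WM
              transported_torus_binomials[OF MW WM M]])
    next
      case 2
      have "\<exists>Q. unimod Q \<and> Q ` range (coords \<circ> e') = range (coords \<circ> e)"
        by (rule unimod_of_binomials[OF inj_e' inj_e conv_e(2,1) b a 2 MW
              transported_torus_binomials[OF WM MW W]])
      then obtain Q where Q: "unimod Q" "Q ` range (coords \<circ> e') = range (coords \<circ> e)"
        by blast
      obtain R where R: "unimod R" "\<And>z. Q (R z) = z" "\<And>z. R (Q z) = z"
        using unimod_inverse[OF Q(1)] by blast
      have "R ` range (coords \<circ> e) = range (coords \<circ> e')"
        unfolding Q(2)[symmetric] by (simp add: image_image R(3))
      with R(1) show ?thesis by blast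
    next
      case 3
      have "card (range (coords \<circ> e)) = card (range (coords \<circ> e'))"
        using card_image[OF inj_e] card_image[OF inj_e'] by simp
      then show ?thesis
        by (rule simplex_like_unimod[OF 3])
    qed
  qed
  then show ?thesis
    unfolding range_e range_e' using unimodularly_equivalent_of_unimod[OF assms(1,3)] by blast
qed

end
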